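(* Let $n\ge 1$ and let $V_1,\dots,V_n$ be complex vector spaces with $\dim V_i=2$ for every $i$. Then, as a set, the tangential variety $\tau\left(\mathrm{Seg}(\mathbb{P}V_1^*\times\dots\times\mathbb{P}V_n^* )\right)\subset\mathbb{P}(V_1^*\otimes\dots\otimes V_n^* )$ is the common zero set of the following homogeneous polynomials: all cubics in the isotypic components of $S^3(V_1\otimes\dots\otimes V_n)$ of types $S_{\pi_1}V_1\otimes\dots\otimes S_{\pi_n}V_n$ with exactly four of the $\pi_i$ equal to $(2,1)$ and all other $\pi_i$ equal to $(3,0)$, together with all quartics in the isotypic components of $S^4(V_1\otimes\dots\otimes V_n)$ of types $S_{\pi_1}V_1\otimes\dots\otimes S_{\pi_n}V_n$ with exactly three of the $\pi_i$ equal to $(2,2)$ and all other $\pi_i$ equal to $(4,0)$.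
   Context: All vector spaces are over $\mathbb{C}$. Elements of $S^d(V_1\otimes\dots\otimes V_n)$ are the homogeneous polynomials of degree $d$ on $V_1^*\otimes\dots\otimes V_n^*$. The Segre variety $\mathrm{Seg}(\mathbb{P}V_1^*\times\dots\times\mathbb{P}V_n^* )$ is the set of points $[v_1\otimes\dots\otimes v_n]$ with $0\ne v_i\in V_i^*$. For a smooth projective variety $X\subset\mathbb{P}V$, the tangential variety $\tau(X)$ is the union of all points on all embedded tangent lines ($\mathbb{P}^1$'s) to $X$. $S_\pi V$ denotes the Schur module of the partition $\pi$ (so $S_{d,0}V=S^dV$). $S^d(V_1\otimes\dots\otimes V_n)$ decomposes under $GL(V_1)\times\dots\times GL(V_n)$ into irreducibles $S_{\pi_1}V_1\otimes\dots\otimes S_{\pi_n}V_n$ with each $\pi_i$ a partition of $d$, possibly with multiplicity; the isotypic component of a given type is the sum of all submodules of that type. All positions of the special partitions among the $n$ factors are included, and there are no such cubics if $n<4$ and no such quartics if $n<3$. *)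

theory Defs
  imports
    Complex_Main
    "HOL-Library.FuncSet"
    "HOL-Library.Function_Algebras"
    "HOL-Combinatorics.Permutations"
begin

text \<open>
  Vector spaces are subspaces of an ambient type carrying a complex scalar multiplication \<open>s\<close>
  with \<open>vector_space s\<close>. Dual spaces and tensor products are realised as subspaces of types
  \<open>'x \<Rightarrow> complex\<close>, whose scalar multiplication is \<open>fscale\<close> (addition and zero are pointwise,
  from Function_Algebras). All spaces are finite-dimensional, so a tensor product is the space of
  multilinear forms on the duals of its factors; in particular the tensor product of the duals
  of the \<open>V i\<close> is the space of multilinear forms on the \<open>V i\<close>. Functions on a proper subset of a
  type are made unique by giving them the value 0 (or undefined, for elements of \<open>PiE\<close>) elsewhere.
\<close>

definition fscale :: "complex \<Rightarrow> ('x \<Rightarrow> complex) \<Rightarrow> 'x \<Rightarrow> complex" where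
  "fscale c f = (\<lambda>x. c * f x)"

lemma vector_space_fscale: "vector_space fscale"
  by unfold_locales (auto simp: fscale_def fun_eq_iff algebra_simps)


definition linear_on ::
    "(complex \<Rightarrow> 'a::ab_group_add \<Rightarrow> 'a) \<Rightarrow> (complex \<Rightarrow> 'b::ab_group_add \<Rightarrow> 'b)
      \<Rightarrow> 'a set \<Rightarrow> ('a \<Rightarrow> 'b) \<Rightarrow> bool" where
  "linear_on s1 s2 U f \<longleftrightarrow>
     (\<forall>x\<in>U. \<forall>y\<in>U. f (x + y) = f x + f y) \<and> (\<forall>c. \<forall>x\<in>U. f (s1 c x) = s2 c (f x))"

definition dual_space ::
    "(complex \<Rightarrow> 'a::ab_group_add \<Rightarrow> 'a) \<Rightarrow> 'a set \<Rightarrow> ('a \<Rightarrow> complex) set" where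
  "dual_space s U = {f. linear_on s (*) U f \<and> (\<forall>x. x \<notin> U \<longrightarrow> f x = 0)}"

definition multilinear_forms ::
    "(complex \<Rightarrow> 'a::ab_group_add \<Rightarrow> 'a) \<Rightarrow> 'k set \<Rightarrow> ('k \<Rightarrow> 'a set)
      \<Rightarrow> (('k \<Rightarrow> 'a) \<Rightarrow> complex) set" where
  "multilinear_forms s K U =
     {F. (\<forall>x\<in>Pi\<^sub>E K U. \<forall>k\<in>K. linear_on s (*) (U k) (\<lambda>u. F (x(k := u)))) \<and>
         (\<forall>x. x \<notin> Pi\<^sub>E K U \<longrightarrow> F x = 0)}"

text \<open>Homogeneous polynomials of degree \<open>d\<close> on \<open>W\<close>, i.e. the \<open>d\<close>-th symmetric power of the dual of
  \<open>W\<close>, as polynomial functions: restrictions of \<open>d\<close>-linear forms to the diagonal.\<close>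

definition hom_polys ::
    "(complex \<Rightarrow> 'a::ab_group_add \<Rightarrow> 'a) \<Rightarrow> 'a set \<Rightarrow> nat \<Rightarrow> ('a \<Rightarrow> complex) set" where
  "hom_polys s W d =
     {\<lambda>w. if w \<in> W then B (\<lambda>j\<in>{..<d}. w) else 0 | B. B \<in> multilinear_forms s {..<d} (\<lambda>_. W)}"


text \<open>Points of projective space are one-dimensional linear subspaces.\<close>

definition proj_space ::
    "(complex \<Rightarrow> 'a::ab_group_add \<Rightarrow> 'a) \<Rightarrow> 'a set \<Rightarrow> 'a set set" where
  "proj_space s W = {module.span s {w} | w. w \<in> W \<and> w \<noteq> 0}"

definition zero_locus ::
    "(complex \<Rightarrow> 'a::ab_group_add \<Rightarrow> 'a) \<Rightarrow> 'a set \<Rightarrow> ('a \<Rightarrow> complex) set \<Rightarrow> 'a set set" where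
  "zero_locus s W F = {P \<in> proj_space s W. \<forall>p\<in>F. \<forall>w\<in>P. p w = 0}"

text \<open>The linear subspace of \<open>W\<close> whose projectivization is the embedded (Zariski) tangent space
  of \<open>X\<close> at the point \<open>L\<close>: the common kernel of the differentials, at points spanning \<open>L\<close>, of the
  homogeneous polynomials vanishing on \<open>X\<close>.\<close>

definition embedded_tangent_space ::
    "(complex \<Rightarrow> 'a::ab_group_add \<Rightarrow> 'a) \<Rightarrow> 'a set \<Rightarrow> 'a set set \<Rightarrow> 'a set \<Rightarrow> 'a set" where
  "embedded_tangent_space s W X L =
     {w \<in> W. \<forall>d. \<forall>p\<in>hom_polys s W d. (\<forall>P\<in>X. \<forall>y\<in>P. p y = 0) \<longrightarrow>
        (\<forall>x\<in>L - {0}. ((\<lambda>t. p (x + s t w)) has_field_derivative 0) (at 0))}"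

definition embedded_tangent_lines ::
    "(complex \<Rightarrow> 'a::ab_group_add \<Rightarrow> 'a) \<Rightarrow> 'a set \<Rightarrow> 'a set set \<Rightarrow> 'a set set" where
  "embedded_tangent_lines s W X =
     {E. module.subspace s E \<and> vector_space.dim s E = 2 \<and>
         (\<exists>L\<in>X. L \<subseteq> E \<and> E \<subseteq> embedded_tangent_space s W X L)}"

definition tangential_variety ::
    "(complex \<Rightarrow> 'a::ab_group_add \<Rightarrow> 'a) \<Rightarrow> 'a set \<Rightarrow> 'a set set \<Rightarrow> 'a set set" where
  "tangential_variety s W X =
     {P \<in> proj_space s W. \<exists>E\<in>embedded_tangent_lines s W X. P \<subseteq> E}"

definition rank_one ::
    "'i set \<Rightarrow> ('i \<Rightarrow> 'a set) \<Rightarrow> ('i \<Rightarrow> 'a \<Rightarrow> complex) \<Rightarrow> ('i \<Rightarrow> 'a) \<Rightarrow> complex" where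
  "rank_one I V f = (\<lambda>x. if x \<in> Pi\<^sub>E I V then (\<Prod>i\<in>I. f i (x i)) else 0)"

text \<open>The Segre variety of the product of the projective spaces of the duals of the \<open>V i\<close>.\<close>

definition segre ::
    "(complex \<Rightarrow> 'a::ab_group_add \<Rightarrow> 'a) \<Rightarrow> 'i set \<Rightarrow> ('i \<Rightarrow> 'a set)
      \<Rightarrow> (('i \<Rightarrow> 'a) \<Rightarrow> complex) set set" where
  "segre s I V =
     {module.span fscale {rank_one I V f} | f. \<forall>i\<in>I. f i \<in> dual_space s (V i) \<and> f i \<noteq> 0}"


text \<open>A partition is a list of parts, possibly with trailing zeros. The tensor power of \<open>U\<close> has its
  factors indexed by the cells of the Young diagram, so no numbering of the cells is needed.\<close>

definition cells :: "nat list \<Rightarrow> (nat \<times> nat) set" where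
  "cells \<mu> = {(r, c). r < length \<mu> \<and> c < \<mu> ! r}"

definition row_group :: "nat list \<Rightarrow> (nat \<times> nat \<Rightarrow> nat \<times> nat) set" where
  "row_group \<mu> = {\<sigma>. \<sigma> permutes cells \<mu> \<and> (\<forall>x\<in>cells \<mu>. fst (\<sigma> x) = fst x)}"

definition col_group :: "nat list \<Rightarrow> (nat \<times> nat \<Rightarrow> nat \<times> nat) set" where
  "col_group \<mu> = {\<tau>. \<tau> permutes cells \<mu> \<and> (\<forall>x\<in>cells \<mu>. snd (\<tau> x) = snd x)}"

definition tensor_power ::
    "(complex \<Rightarrow> 'a::ab_group_add \<Rightarrow> 'a) \<Rightarrow> 'k set \<Rightarrow> 'a set
      \<Rightarrow> (('k \<Rightarrow> 'a \<Rightarrow> complex) \<Rightarrow> complex) set" where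
  "tensor_power s K U = multilinear_forms fscale K (\<lambda>_. dual_space s U)"

text \<open>A permutation \<open>\<sigma>\<close> acts on tensors by \<open>T \<mapsto> (\<lambda>\<phi>. T (\<phi> \<circ> \<sigma>))\<close>; the Young symmetrizer is
  the product of the row symmetrizer and the column antisymmetrizer (the latter is applied first).\<close>

definition young_symmetrizer ::
    "nat list \<Rightarrow> ((nat \<times> nat \<Rightarrow> 'b) \<Rightarrow> complex) \<Rightarrow> (nat \<times> nat \<Rightarrow> 'b) \<Rightarrow> complex" where
  "young_symmetrizer \<mu> T =
     (\<lambda>\<phi>. \<Sum>\<sigma>\<in>row_group \<mu>. \<Sum>\<tau>\<in>col_group \<mu>. of_int (sign \<tau>) * T (\<phi> \<circ> \<sigma> \<circ> \<tau>))"

definition schur_module ::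
    "(complex \<Rightarrow> 'a::ab_group_add \<Rightarrow> 'a) \<Rightarrow> nat list \<Rightarrow> 'a set
      \<Rightarrow> ((nat \<times> nat \<Rightarrow> 'a \<Rightarrow> complex) \<Rightarrow> complex) set" where
  "schur_module s \<mu> U = young_symmetrizer \<mu> ` tensor_power s (cells \<mu>) U"

abbreviation tensor_slots :: "'i set \<Rightarrow> ('i \<Rightarrow> nat list) \<Rightarrow> ('i \<times> nat \<times> nat) set" where
  "tensor_slots I \<pi> \<equiv> Sigma I (\<lambda>i. cells (\<pi> i))"

text \<open>The arguments of an element of the tensor product, over \<open>i \<in> I\<close>, of the tensor powers of \<open>V i\<close>
  of degree the size of \<open>\<pi> i\<close>: a covector on \<open>V i\<close> for each cell of each \<open>\<pi> i\<close>.\<close>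

definition covectors ::
    "(complex \<Rightarrow> 'a::ab_group_add \<Rightarrow> 'a) \<Rightarrow> 'i set \<Rightarrow> ('i \<Rightarrow> 'a set) \<Rightarrow> ('i \<Rightarrow> nat list)
      \<Rightarrow> ('i \<times> nat \<times> nat \<Rightarrow> 'a \<Rightarrow> complex) set" where
  "covectors s I V \<pi> = Pi\<^sub>E (tensor_slots I \<pi>) (\<lambda>(i, c). dual_space s (V i))"

definition outer_product ::
    "(complex \<Rightarrow> 'a::ab_group_add \<Rightarrow> 'a) \<Rightarrow> 'i set \<Rightarrow> ('i \<Rightarrow> 'a set) \<Rightarrow> ('i \<Rightarrow> nat list)
      \<Rightarrow> ('i \<Rightarrow> (nat \<times> nat \<Rightarrow> 'a \<Rightarrow> complex) \<Rightarrow> complex)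
      \<Rightarrow> ('i \<times> nat \<times> nat \<Rightarrow> 'a \<Rightarrow> complex) \<Rightarrow> complex" where
  "outer_product s I V \<pi> T =
     (\<lambda>\<phi>. if \<phi> \<in> covectors s I V \<pi> then \<Prod>i\<in>I. T i (\<lambda>c\<in>cells (\<pi> i). \<phi> (i, c)) else 0)"

text \<open>The tensor product, over \<open>i \<in> I\<close>, of the Schur modules, as a subspace of the tensor product
  of the tensor powers containing them.\<close>

definition schur_tensor ::
    "(complex \<Rightarrow> 'a::ab_group_add \<Rightarrow> 'a) \<Rightarrow> 'i set \<Rightarrow> ('i \<Rightarrow> 'a set) \<Rightarrow> ('i \<Rightarrow> nat list)
      \<Rightarrow> (('i \<times> nat \<times> nat \<Rightarrow> 'a \<Rightarrow> complex) \<Rightarrow> complex) set" where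
  "schur_tensor s I V \<pi> =
     module.span fscale
       {outer_product s I V \<pi> T | T. \<forall>i\<in>I. T i \<in> schur_module s (\<pi> i) (V i)}"


definition GL :: "(complex \<Rightarrow> 'a::ab_group_add \<Rightarrow> 'a) \<Rightarrow> 'a set \<Rightarrow> ('a \<Rightarrow> 'a) set" where
  "GL s U = {g \<in> extensional U. bij_betw g U U \<and> linear_on s s U g}"

definition GL_prod ::
    "(complex \<Rightarrow> 'a::ab_group_add \<Rightarrow> 'a) \<Rightarrow> 'i set \<Rightarrow> ('i \<Rightarrow> 'a set) \<Rightarrow> ('i \<Rightarrow> 'a \<Rightarrow> 'a) set" where
  "GL_prod s I V = (\<Pi>\<^sub>E i\<in>I. GL s (V i))"

text \<open>Elements of a tensor product of the \<open>V i\<close> are functions of covectors \<open>f\<close>, and \<open>g\<close> acts on them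
  by substituting \<open>f \<circ> g\<close> for \<open>f\<close>: the evaluation \<open>f \<mapsto> f v\<close>, which represents \<open>v\<close>, is sent to the
  evaluation at \<open>g v\<close>. Likewise a polynomial on the tensor product of the duals is acted on by
  substituting \<open>A \<circ> g\<close> for \<open>A\<close>. Both are left actions.\<close>

definition act_tensor ::
    "(complex \<Rightarrow> 'a::ab_group_add \<Rightarrow> 'a) \<Rightarrow> 'i set \<Rightarrow> ('i \<Rightarrow> 'a set) \<Rightarrow> ('i \<Rightarrow> nat list)
      \<Rightarrow> ('i \<Rightarrow> 'a \<Rightarrow> 'a) \<Rightarrow> (('i \<times> nat \<times> nat \<Rightarrow> 'a \<Rightarrow> complex) \<Rightarrow> complex)
      \<Rightarrow> ('i \<times> nat \<times> nat \<Rightarrow> 'a \<Rightarrow> complex) \<Rightarrow> complex" where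
  "act_tensor s I V \<pi> g T =
     (\<lambda>\<phi>. if \<phi> \<in> covectors s I V \<pi>
           then T (\<lambda>(i, c)\<in>tensor_slots I \<pi>. \<lambda>v. if v \<in> V i then \<phi> (i, c) (g i v) else 0)
           else 0)"

definition act_poly ::
    "(complex \<Rightarrow> 'a::ab_group_add \<Rightarrow> 'a) \<Rightarrow> 'i set \<Rightarrow> ('i \<Rightarrow> 'a set)
      \<Rightarrow> ('i \<Rightarrow> 'a \<Rightarrow> 'a) \<Rightarrow> ((('i \<Rightarrow> 'a) \<Rightarrow> complex) \<Rightarrow> complex)
      \<Rightarrow> (('i \<Rightarrow> 'a) \<Rightarrow> complex) \<Rightarrow> complex" where
  "act_poly s I V g p =
     (\<lambda>A. if A \<in> multilinear_forms s I V
           then p (\<lambda>x. if x \<in> Pi\<^sub>E I V then A (\<lambda>i\<in>I. g i (x i)) else 0)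
           else 0)"

definition submodule ::
    "(complex \<Rightarrow> 'b::ab_group_add \<Rightarrow> 'b) \<Rightarrow> 'g set \<Rightarrow> ('g \<Rightarrow> 'b \<Rightarrow> 'b) \<Rightarrow> 'b set \<Rightarrow> 'b set \<Rightarrow> bool" where
  "submodule s G \<rho> N M \<longleftrightarrow> N \<subseteq> M \<and> module.subspace s N \<and> (\<forall>g\<in>G. \<forall>x\<in>N. \<rho> g x \<in> N)"

definition module_isomorphic ::
    "(complex \<Rightarrow> 'a::ab_group_add \<Rightarrow> 'a) \<Rightarrow> (complex \<Rightarrow> 'b::ab_group_add \<Rightarrow> 'b) \<Rightarrow> 'g set
      \<Rightarrow> ('g \<Rightarrow> 'a \<Rightarrow> 'a) \<Rightarrow> ('g \<Rightarrow> 'b \<Rightarrow> 'b) \<Rightarrow> 'a set \<Rightarrow> 'b set \<Rightarrow> bool" where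
  "module_isomorphic s1 s2 G \<rho>1 \<rho>2 M N \<longleftrightarrow>
     (\<exists>h. bij_betw h M N \<and> linear_on s1 s2 M h \<and> (\<forall>g\<in>G. \<forall>x\<in>M. h (\<rho>1 g x) = \<rho>2 g (h x)))"

text \<open>The isotypic component of type \<open>\<pi>\<close> in the homogeneous polynomials of degree \<open>d\<close> on the tensor
  product of the duals of the \<open>V i\<close>; the span of a union of subspaces is their sum.\<close>

definition isotypic_component ::
    "(complex \<Rightarrow> 'a::ab_group_add \<Rightarrow> 'a) \<Rightarrow> 'i set \<Rightarrow> ('i \<Rightarrow> 'a set) \<Rightarrow> nat \<Rightarrow> ('i \<Rightarrow> nat list)
      \<Rightarrow> ((('i \<Rightarrow> 'a) \<Rightarrow> complex) \<Rightarrow> complex) set" where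
  "isotypic_component s I V d \<pi> =
     module.span fscale (\<Union>{N.
       submodule fscale (GL_prod s I V) (act_poly s I V) N
         (hom_polys fscale (multilinear_forms s I V) d) \<and>
       module_isomorphic fscale fscale (GL_prod s I V) (act_tensor s I V \<pi>) (act_poly s I V)
         (schur_tensor s I V \<pi>) N})"

definition types_with :: "'i set \<Rightarrow> nat \<Rightarrow> nat list \<Rightarrow> nat list \<Rightarrow> ('i \<Rightarrow> nat list) set" where
  "types_with I k \<mu> \<nu> = {\<pi> \<in> I \<rightarrow>\<^sub>E {\<mu>, \<nu>}. card {i \<in> I. \<pi> i = \<mu>} = k}"

end

theory Submission
  imports Defs "HOL-Computational_Algebra.Polynomial"
begin

text \<open>
  The points of the tangential variety are spanned by the forms
  \<open>\<Sum>\<^sub>i x\<^sub>1 \<otimes> \<dots> \<otimes> y\<^sub>i \<otimes> \<dots> \<otimes> x\<^sub>n\<close>; equivalently, in suitable bases \<open>e\<^sub>i, f\<^sub>i\<close> all coordinates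
  \<open>a\<^sub>N\<close> with \<open>card N \<ge> 2\<close> vanish, where \<open>a\<^sub>N\<close> is the value at \<open>f\<^sub>i\<close> for \<open>i \<in> N\<close> and \<open>e\<^sub>i\<close> for \<open>i \<notin> N\<close>.
  On such a form a monomial of degree \<open>d\<close> involves at most \<open>d\<close> of the \<open>f\<^sub>i\<close>, but every weight of
  the given modules involves at least 4 (for \<open>d = 3\<close>) or 6 (for \<open>d = 4\<close>) of them.

  Conversely, normalize a common zero to \<open>a = 1\<close> at the empty set and \<open>a = 0\<close> at singletons. The
  highest weight cubics, at the given and at a moved base point, give
  \<open>a\<^sub>i\<^sub>j\<^sub>k\<^sub>l = - 3 a\<^sub>i\<^sub>j a\<^sub>k\<^sub>l\<close> and \<open>a\<^sub>i\<^sub>j a\<^sub>i\<^sub>k\<^sub>l = a\<^sub>i\<^sub>k a\<^sub>i\<^sub>j\<^sub>l\<close>, and the quartics (hyperdeterminants) give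
  \<open>a\<^sub>i\<^sub>j\<^sub>k\<^sup>2 = - 4 a\<^sub>i\<^sub>j a\<^sub>i\<^sub>k a\<^sub>j\<^sub>k\<close>. Hence either \<open>a\<^sub>i\<^sub>j = - u\<^sub>i u\<^sub>j\<close> and \<open>a\<^sub>i\<^sub>j\<^sub>k = 2 u\<^sub>i u\<^sub>j u\<^sub>k\<close>, and the
  bases \<open>e\<^sub>i, f\<^sub>i + u\<^sub>i e\<^sub>i\<close> are suitable up to \<open>card N = 3\<close>, or the nonzero \<open>a\<^sub>i\<^sub>j\<close> form a star, and it
  suffices to exchange \<open>e\<^sub>c\<close> and \<open>f\<^sub>c\<close> at its centre. The remaining coordinates are determined by the cubics.
\<close>

text \<open>An isotypic component is given only through abstract isomorphisms, so the two inclusions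
  need different access to it. Vanishing on tangent forms has to be proved for every copy of the
  Schur tensors among the polynomials; all that is known of a copy is an equivariant isomorphism, so
  weights are separated by finite linear combinations of torus elements. For the converse, specific
  polynomials have to be placed in the component: a Schur tensor is contracted with the
  \<open>d\<close>-th tensor power of the form. This map is equivariant, and its injectivity is
  shown by hand, with pencils of two decomposable forms and polarization.

  The contraction depends on how the cells of each diagram are matched with the \<open>d\<close>
  copies of the form. The cubic types occur with multiplicity 3, and different matchings reach
  different copies. A matching that treats the four factors alike would yield, in normalized
  coordinates, only \<open>a_ijkl + a_ij a_kl + a_ik a_jl + a_il a_jk = 0\<close>; the one used here
  splits them into two pairs, and permuting its relation separates the three products.\<close>

interpretation fs: vector_space fscale
  by (rule vector_space_fscale)

lemma fscale_apply [simp]: "fscale c f x = c * f x"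
  by (simp add: fscale_def)

lemma sum_fun_apply: "(\<Sum>j\<in>J. f j) x = (\<Sum>j\<in>J. f j x)"
  by (induction J rule: infinite_finite_induct) auto

section \<open>Multilinear forms\<close>

lemma linear_on_add: "linear_on s1 s2 U f \<Longrightarrow> x \<in> U \<Longrightarrow> y \<in> U \<Longrightarrow> f (x + y) = f x + f y"
  by (simp add: linear_on_def)

lemma linear_on_scale: "linear_on s1 s2 U f \<Longrightarrow> x \<in> U \<Longrightarrow> f (s1 c x) = s2 c (f x)"
  by (simp add: linear_on_def)

lemma dual_space_linear: "f \<in> dual_space s U \<Longrightarrow> linear_on s (*) U f"
  by (simp add: dual_space_def)

lemma dual_space_outside: "f \<in> dual_space s U \<Longrightarrow> x \<notin> U \<Longrightarrow> f x = 0"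
  by (simp add: dual_space_def)

lemma dual_spaceI:
  "(\<And>x y. x \<in> U \<Longrightarrow> y \<in> U \<Longrightarrow> f (x + y) = f x + f y) \<Longrightarrow> (\<And>c x. x \<in> U \<Longrightarrow> f (s c x) = c * f x)
    \<Longrightarrow> (\<And>x. x \<notin> U \<Longrightarrow> f x = 0) \<Longrightarrow> f \<in> dual_space s U"
  by (simp add: dual_space_def linear_on_def)

lemma subspace_dual_space: "fs.subspace (dual_space s U)"
  by (rule fs.subspaceI) (auto simp: dual_space_def linear_on_def algebra_simps)

lemma multilinear_formsI:
  "(\<And>x k. x \<in> Pi\<^sub>E K U \<Longrightarrow> k \<in> K \<Longrightarrow> linear_on s (*) (U k) (\<lambda>u. F (x(k := u))))
    \<Longrightarrow> (\<And>x. x \<notin> Pi\<^sub>E K U \<Longrightarrow> F x = 0) \<Longrightarrow> F \<in> multilinear_forms s K U"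
  by (simp add: multilinear_forms_def)

lemma multilinear_forms_linear:
  "F \<in> multilinear_forms s K U \<Longrightarrow> x \<in> Pi\<^sub>E K U \<Longrightarrow> k \<in> K \<Longrightarrow> linear_on s (*) (U k) (\<lambda>u. F (x(k := u)))"
  by (simp add: multilinear_forms_def)

lemma multilinear_forms_outside: "F \<in> multilinear_forms s K U \<Longrightarrow> x \<notin> Pi\<^sub>E K U \<Longrightarrow> F x = 0"
  by (simp add: multilinear_forms_def)

lemma subspace_multilinear_forms: "fs.subspace (multilinear_forms s K U)"
  by (rule fs.subspaceI) (auto simp: multilinear_forms_def linear_on_def algebra_simps)

lemma PiE_upd: "x \<in> Pi\<^sub>E K U \<Longrightarrow> k \<in> K \<Longrightarrow> u \<in> U k \<Longrightarrow> x(k := u) \<in> Pi\<^sub>E K U"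
  by (auto simp: PiE_iff extensional_def)

lemma PiE_if: "x \<in> Pi\<^sub>E K U \<Longrightarrow> L \<subseteq> K \<Longrightarrow> (\<And>k. k \<in> L \<Longrightarrow> v k \<in> U k) \<Longrightarrow>
    (\<lambda>k. if k \<in> L then v k else x k) \<in> Pi\<^sub>E K U"
  by (auto simp: PiE_iff extensional_def)

lemma sum_Pow_insert:
  fixes g :: "'k set \<Rightarrow> 'b::comm_monoid_add"
  assumes "finite L" "k \<notin> L"
  shows "(\<Sum>N\<in>Pow (insert k L). g N) = (\<Sum>N\<in>Pow L. g N) + (\<Sum>N\<in>Pow L. g (insert k N))"
proof -
  have "inj_on (insert k) (Pow L)" "Pow L \<inter> insert k ` Pow L = {}"
    using assms(2) by (auto simp: inj_on_def)
  then show ?thesis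
    using assms(1) by (simp add: Pow_insert sum.union_disjoint sum.reindex o_def)
qed

text \<open>Choosing one of two vectors in each slot of \<open>L\<close> amounts to choosing the set
  \<open>N\<close> of slots that take the \<open>True\<close> one; the induction splits these sets
  by membership of the new slot. Slots outside \<open>L\<close> stay at \<open>x\<close>, since
  shears and slices later touch only some of the slots.\<close>

lemma multilinear_expand_on:
  assumes F: "F \<in> multilinear_forms s K U" and s: "vector_space s"
    and U: "\<And>k. k \<in> K \<Longrightarrow> module.subspace s (U k)"
    and "finite L" "L \<subseteq> K" "x \<in> Pi\<^sub>E K U" "\<And>k b. k \<in> L \<Longrightarrow> v k b \<in> U k"
  shows "F (\<lambda>k. if k \<in> L then s (c k False) (v k False) + s (c k True) (v k True) else x k) =
    (\<Sum>N\<in>Pow L. (\<Prod>k\<in>L. c k (k \<in> N)) * F (\<lambda>k. if k \<in> L then v k (k \<in> N) else x k))"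
  using assms(4-)
proof (induction L arbitrary: x)
  case empty
  then show ?case by simp
next
  case (insert k L)
  interpret s: vector_space s by (rule s)
  let ?w = "\<lambda>k. s (c k False) (v k False) + s (c k True) (v k True)"
  have k: "k \<in> K" and v: "v k b \<in> U k" for b using insert by auto
  have sub: "module.subspace s (U k)" using U k by blast
  have w: "?w j \<in> U j" if "j \<in> L" for j
    using that insert.prems U[of j] by (auto intro!: s.subspace_add s.subspace_scale)
  define y where "y = (\<lambda>j. if j \<in> L then ?w j else x j)"
  have y: "y \<in> Pi\<^sub>E K U" unfolding y_def using insert.prems w by (intro PiE_if) auto
  note lin = multilinear_forms_linear[OF F y k]
  have IH: "F (y(k := v k b)) = (\<Sum>N\<in>Pow L. (\<Prod>k\<in>L. c k (k \<in> N)) *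
      F (\<lambda>j. if j \<in> L then v j (j \<in> N) else (x(k := v k b)) j))" for b
  proof -
    have "y(k := v k b) = (\<lambda>j. if j \<in> L then ?w j else (x(k := v k b)) j)"
      using insert.hyps by (auto simp: y_def fun_eq_iff)
    moreover have "F (\<lambda>j. if j \<in> L then ?w j else (x(k := v k b)) j) =
        (\<Sum>N\<in>Pow L. (\<Prod>k\<in>L. c k (k \<in> N)) *
          F (\<lambda>j. if j \<in> L then v j (j \<in> N) else (x(k := v k b)) j))"
      by (rule insert.IH) (use insert.prems k v in \<open>auto simp: PiE_iff extensional_def\<close>)
    ultimately show ?thesis by simp
  qed
  have "(\<lambda>j. if j \<in> insert k L then ?w j else x j) = y(k := ?w k)"
    by (auto simp: y_def fun_eq_iff)
  then have "F (\<lambda>j. if j \<in> insert k L then ?w j else x j) = F (y(k := ?w k))" by simp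
  also have "\<dots> = c k False * F (y(k := v k False)) + c k True * F (y(k := v k True))"
    using linear_on_add[OF lin] linear_on_scale[OF lin] v s.subspace_scale[OF sub] by simp
  also have "\<dots> = (\<Sum>N\<in>Pow L. (\<Prod>j\<in>insert k L. c j (j \<in> N)) *
        F (\<lambda>j. if j \<in> insert k L then v j (j \<in> N) else x j)) +
      (\<Sum>N\<in>Pow L. (\<Prod>j\<in>insert k L. c j (j \<in> insert k N)) *
        F (\<lambda>j. if j \<in> insert k L then v j (j \<in> insert k N) else x j))"
  proof -
    have *: "(\<lambda>j. if j \<in> L then v j (j \<in> N) else (x(k := v k b)) j) =
       (\<lambda>j. if j \<in> insert k L then v j (j \<in> (if b then insert k N else N)) else x j)"
      "(\<Prod>j\<in>insert k L. c j (j \<in> (if b then insert k N else N))) = c k b * (\<Prod>j\<in>L. c j (j \<in> N))"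
      if "N \<in> Pow L" for N b
    proof -
      have kN: "k \<notin> N" and "\<And>j. j \<in> L \<Longrightarrow> (j = k) = False" using insert.hyps that by auto
      then show "(\<lambda>j. if j \<in> L then v j (j \<in> N) else (x(k := v k b)) j) =
       (\<lambda>j. if j \<in> insert k L then v j (j \<in> (if b then insert k N else N)) else x j)"
        by (auto simp: fun_eq_iff)
      have "(j \<in> insert k N) = (j \<in> N)" if "j \<in> L" for j
        using insert.hyps that by auto
      then have "(\<Prod>j\<in>L. c j (j \<in> insert k N)) = (\<Prod>j\<in>L. c j (j \<in> N))"
        by (intro prod.cong) simp_all
      then show "(\<Prod>j\<in>insert k L. c j (j \<in> (if b then insert k N else N))) =
          c k b * (\<Prod>j\<in>L. c j (j \<in> N))"
        using insert.hyps kN by simp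
    qed
    show ?thesis
      unfolding IH sum_distrib_left
    proof (intro arg_cong2[of _ _ _ _ "(+)"] sum.cong refl)
      fix N assume N: "N \<in> Pow L"
      show "c k False * ((\<Prod>k\<in>L. c k (k \<in> N)) *
          F (\<lambda>j. if j \<in> L then v j (j \<in> N) else (x(k := v k False)) j)) =
        (\<Prod>j\<in>insert k L. c j (j \<in> N)) * F (\<lambda>j. if j \<in> insert k L then v j (j \<in> N) else x j)"
        using *[OF N, of False] by (simp add: mult.assoc)
      show "c k True * ((\<Prod>k\<in>L. c k (k \<in> N)) *
          F (\<lambda>j. if j \<in> L then v j (j \<in> N) else (x(k := v k True)) j)) =
        (\<Prod>j\<in>insert k L. c j (j \<in> insert k N)) *
          F (\<lambda>j. if j \<in> insert k L then v j (j \<in> insert k N) else x j)"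
        using *[OF N, of True] by (simp add: mult.assoc)
    qed
  qed
  also have "\<dots> = (\<Sum>N\<in>Pow (insert k L). (\<Prod>j\<in>insert k L. c j (j \<in> N)) *
        F (\<lambda>j. if j \<in> insert k L then v j (j \<in> N) else x j))"
    using insert.hyps by (subst sum_Pow_insert) auto
  finally show ?case .
qed

lemma multilinear_expand:
  assumes F: "F \<in> multilinear_forms s K U" and s: "vector_space s"
    and U: "\<And>k. k \<in> K \<Longrightarrow> module.subspace s (U k)" and "finite K"
    and v: "\<And>k b. k \<in> K \<Longrightarrow> v k b \<in> U k"
  shows "F (\<lambda>k\<in>K. s (c k False) (v k False) + s (c k True) (v k True)) =
    (\<Sum>N\<in>Pow K. (\<Prod>k\<in>K. c k (k \<in> N)) * F (\<lambda>k\<in>K. v k (k \<in> N)))"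
proof -
  have "(\<lambda>k\<in>K. v k False) \<in> Pi\<^sub>E K U" using v by auto
  moreover have "(\<lambda>k. if k \<in> K then f k else (\<lambda>k\<in>K. v k False) k) = (\<lambda>k\<in>K. f k)" for f
    by (auto simp: fun_eq_iff)
  ultimately show ?thesis
    using multilinear_expand_on[OF F s U \<open>finite K\<close> order_refl, of "\<lambda>k\<in>K. v k False" v c] v
    by simp
qed

lemma multilinear_pencil_on:
  assumes F: "F \<in> multilinear_forms s K U" and s: "vector_space s"
    and U: "\<And>k. k \<in> K \<Longrightarrow> module.subspace s (U k)"
    and L: "finite L" "L \<subseteq> K" and x: "x \<in> Pi\<^sub>E K U" and y: "\<And>k. k \<in> L \<Longrightarrow> y k \<in> U k"
  shows "F (\<lambda>k. if k \<in> L then x k + s t (y k) else x k) =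
    (\<Sum>N\<in>Pow L. t ^ card N * F (\<lambda>k. if k \<in> N then y k else x k))"
proof -
  interpret s: vector_space s by (rule s)
  have "F (\<lambda>k. if k \<in> L then x k + s t (y k) else x k) =
    F (\<lambda>k. if k \<in> L then s (if False then t else 1) (if False then y k else x k)
      + s (if True then t else 1) (if True then y k else x k) else x k)"
    by (rule arg_cong[of _ _ F]) (auto simp: fun_eq_iff)
  also have "\<dots> = (\<Sum>N\<in>Pow L. (\<Prod>k\<in>L. if k \<in> N then t else 1) *
      F (\<lambda>k. if k \<in> L then if k \<in> N then y k else x k else x k))"
    using L x y by (intro multilinear_expand_on[OF F s U L x, of _ "\<lambda>_ b. if b then t else 1"]) auto
  also have "\<dots> = (\<Sum>N\<in>Pow L. t ^ card N * F (\<lambda>k. if k \<in> N then y k else x k))"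
  proof (intro sum.cong refl)
    fix N assume N: "N \<in> Pow L"
    then have "(\<lambda>k. if k \<in> L then if k \<in> N then y k else x k else x k) = (\<lambda>k. if k \<in> N then y k else x k)"
      by (auto simp: fun_eq_iff)
    moreover have "(\<Prod>k\<in>L. if k \<in> N then t else 1) = t ^ card N"
      using N L by (simp add: prod.If_cases Int_absorb1 Int_absorb2)
    ultimately show "(\<Prod>k\<in>L. if k \<in> N then t else 1) *
      F (\<lambda>k. if k \<in> L then if k \<in> N then y k else x k else x k) =
      t ^ card N * F (\<lambda>k. if k \<in> N then y k else x k)" by simp
  qed
  finally show ?thesis .
qed

lemma multilinear_pencil:
  assumes F: "F \<in> multilinear_forms s K U" and s: "vector_space s"
    and U: "\<And>k. k \<in> K \<Longrightarrow> module.subspace s (U k)" and K: "finite K"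
    and x: "\<And>k. k \<in> K \<Longrightarrow> x k \<in> U k" and y: "\<And>k. k \<in> K \<Longrightarrow> y k \<in> U k"
  shows "F (\<lambda>k\<in>K. x k + s t (y k)) =
    (\<Sum>N\<in>Pow K. t ^ card N * F (\<lambda>k\<in>K. if k \<in> N then y k else x k))"
proof -
  have X: "(\<lambda>k\<in>K. x k) \<in> Pi\<^sub>E K U" using x by auto
  have "(\<lambda>k\<in>K. x k + s t (y k)) =
      (\<lambda>k. if k \<in> K then (\<lambda>k\<in>K. x k) k + s t (y k) else (\<lambda>k\<in>K. x k) k)"
    by (auto simp: fun_eq_iff)
  then have "F (\<lambda>k\<in>K. x k + s t (y k)) =
      (\<Sum>N\<in>Pow K. t ^ card N * F (\<lambda>k. if k \<in> N then y k else (\<lambda>k\<in>K. x k) k))"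
    using multilinear_pencil_on[OF F s U K order_refl X y, of t] by simp
  also have "\<dots> = (\<Sum>N\<in>Pow K. t ^ card N * F (\<lambda>k\<in>K. if k \<in> N then y k else x k))"
  proof (intro sum.cong refl)
    fix N assume "N \<in> Pow K"
    then have "(\<lambda>k. if k \<in> N then y k else (\<lambda>k\<in>K. x k) k) = (\<lambda>k\<in>K. if k \<in> N then y k else x k)"
      by (auto simp: fun_eq_iff)
    then show "t ^ card N * F (\<lambda>k. if k \<in> N then y k else (\<lambda>k\<in>K. x k) k) =
       t ^ card N * F (\<lambda>k\<in>K. if k \<in> N then y k else x k)" by simp
  qed
  finally show ?thesis .
qed

text \<open>A polynomial function on the complex numbers that vanishes identically has zero
  coefficients. Several \<open>x\<close> may share an exponent, so each coefficient is itself a sum.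
  Expansions along pencils are exploited in this way.\<close>

lemma sum_power_coeff_zero:
  fixes a :: "'b \<Rightarrow> complex"
  assumes S: "finite S" and z: "\<And>t. (\<Sum>x\<in>S. t ^ N x * a x) = 0"
  shows "(\<Sum>x\<in>{x \<in> S. N x = k}. a x) = 0"
proof (cases "k \<in> N ` S")
  case True
  define m where "m = Max (N ` S)"
  define c where "c = (\<lambda>i. \<Sum>x\<in>{x \<in> S. N x = i}. a x)"
  have "(\<Sum>i\<le>m. c i * t ^ i) = 0" for t
  proof -
    have "(\<Sum>i\<le>m. c i * t ^ i) = (\<Sum>i\<le>m. \<Sum>x\<in>{x \<in> S. N x = i}. t ^ N x * a x)"
      by (auto simp: c_def sum_distrib_left sum_distrib_right mult.commute intro!: sum.cong)
    also have "\<dots> = (\<Sum>x\<in>S. t ^ N x * a x)"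
      using S by (intro sum.group) (auto simp: m_def)
    finally show ?thesis using z by simp
  qed
  then have "\<forall>i\<le>m. c i = 0" using polyfun_eq_0[of c m] by blast
  moreover have "k \<le> m" using True S by (simp add: m_def)
  ultimately show ?thesis by (auto simp: c_def)
next
  case False
  then show ?thesis by (intro sum.neutral) auto
qed

section \<open>Dual bases of planes and coordinates of multilinear forms\<close>

text \<open>Bases are indexed by \<open>bool\<close>, so that the elements of a basis of the space of multilinear forms
  with slots \<open>K\<close> are indexed by the subsets of \<open>K\<close>.\<close>

definition dual_bases ::
    "(complex \<Rightarrow> 'a::ab_group_add \<Rightarrow> 'a) \<Rightarrow> 'a set \<Rightarrow> (bool \<Rightarrow> 'a) \<Rightarrow> (bool \<Rightarrow> 'a \<Rightarrow> complex) \<Rightarrow> bool" where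
  "dual_bases s U E D \<longleftrightarrow> (\<forall>b. E b \<in> U \<and> D b \<in> dual_space s U) \<and>
     (\<forall>b b'. D b (E b') = of_bool (b = b')) \<and>
     (\<forall>u\<in>U. u = s (D False u) (E False) + s (D True u) (E True))"

lemma dual_basesD:
  assumes "dual_bases s U E D"
  shows "E b \<in> U" "D b \<in> dual_space s U" "D b (E b') = of_bool (b = b')"
    "u \<in> U \<Longrightarrow> s (D False u) (E False) + s (D True u) (E True) = u"
  using assms by (auto simp: dual_bases_def)

lemma dual_bases_expand_dual:
  assumes B: "dual_bases s U E D" and s: "vector_space s" and U: "module.subspace s U"
    and \<phi>: "\<phi> \<in> dual_space s U"
  shows "\<phi> = fscale (\<phi> (E False)) (D False) + fscale (\<phi> (E True)) (D True)"
proof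
  interpret s: vector_space s by (rule s)
  fix u
  show "\<phi> u = (fscale (\<phi> (E False)) (D False) + fscale (\<phi> (E True)) (D True)) u"
  proof (cases "u \<in> U")
    case True
    note lin = dual_space_linear[OF \<phi>]
    have "\<phi> u = \<phi> (s (D False u) (E False) + s (D True u) (E True))"
      using dual_basesD(4)[OF B True] by simp
    also have "\<dots> = D False u * \<phi> (E False) + D True u * \<phi> (E True)"
      using linear_on_add[OF lin] linear_on_scale[OF lin] dual_basesD(1)[OF B]
        s.subspace_scale[OF U] by simp
    finally show ?thesis by simp
  next
    case False
    then show ?thesis
      using dual_space_outside[OF \<phi>] dual_space_outside[OF dual_basesD(2)[OF B]] by simp
  qed
qed

lemma dual_bases_exist:
  assumes s: "vector_space s" and U: "module.subspace s U" and dim: "vector_space.dim s U = 2"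
    and e: "e \<in> U" "e \<noteq> 0"
  obtains E D where "dual_bases s U E D" "E False = e"
proof -
  interpret s: vector_space s by (rule s)
  have "s.independent {e}" using e by simp
  then obtain B where B: "{e} \<subseteq> B" "B \<subseteq> U" "s.independent B" "U \<subseteq> s.span B"
    using s.maximal_independent_subset_extend[of "{e}" U] e by auto
  have "card B = 2" using s.basis_card_eq_dim[OF B(2,4,3)] dim by simp
  then obtain f where f: "B = {e, f}" "e \<noteq> f"
    using B(1) by (auto simp: card_2_iff)
  have span: "s.span B = U" using B U by (simp add: s.span_minimal subset_antisym)
  define E where "E = (\<lambda>b. if b then f else e)"
  define D where "D = (\<lambda>b u. if u \<in> U then s.representation B u (E b) else 0)"
  have "dual_bases s U E D"
    unfolding dual_bases_def
  proof (intro conjI allI ballI)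
    fix b show "E b \<in> U" using B f by (auto simp: E_def)
    show "D b \<in> dual_space s U"
      using B span U by (intro dual_spaceI)
        (auto simp: D_def s.subspace_add s.subspace_scale s.representation_add s.representation_scale)
    fix b' show "D b (E b') = of_bool (b = b')"
      using B f by (auto simp: D_def E_def s.representation_basis)
  next
    fix u assume u: "u \<in> U"
    have "(\<Sum>b\<in>B. s (s.representation B u b) b) = u"
      using B f span u by (intro s.sum_representation_eq) auto
    then show "u = s (D False u) (E False) + s (D True u) (E True)"
      using f u by (simp add: D_def E_def)
  qed
  moreover have "E False = e" by (simp add: E_def)
  ultimately show thesis using that by blast
qed

lemma dual_bases_shear:
  assumes B: "dual_bases s U E D" and s: "vector_space s" and U: "module.subspace s U"
  shows "dual_bases s U (E(True := E True + s c (E False))) (D(False := D False - fscale c (D True)))"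
proof -
  interpret s: vector_space s by (rule s)
  note B' = dual_basesD[OF B]
  note lin = dual_space_linear[OF B'(2)]
  have D: "D b (E True + s c (E False)) = of_bool b + c * of_bool (\<not> b)" for b
    using linear_on_add[OF lin] linear_on_scale[OF lin] B' s.subspace_scale[OF U] by simp
  show ?thesis
    unfolding dual_bases_def
  proof (intro conjI allI ballI)
    fix b show "(E(True := E True + s c (E False))) b \<in> U"
      using B' U by (simp add: s.subspace_add s.subspace_scale)
    show "(D(False := D False - fscale c (D True))) b \<in> dual_space s U"
      using B' by (simp add: fs.subspace_diff[OF subspace_dual_space] fs.subspace_scale[OF subspace_dual_space])
    fix b' show "(D(False := D False - fscale c (D True))) b ((E(True := E True + s c (E False))) b') =
      of_bool (b = b')" using B'(3) D by auto
  next
    fix u assume "u \<in> U"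
    then have "u = s (D False u) (E False) + s (D True u) (E True)" using B'(4) by simp
    then show "u = s ((D(False := D False - fscale c (D True))) False u) ((E(True := E True + s c (E False))) False)
      + s ((D(False := D False - fscale c (D True))) True u) ((E(True := E True + s c (E False))) True)"
      by (simp add: s.scale_left_diff_distrib s.scale_right_distrib mult.commute)
  qed
qed

lemma dual_bases_swap:
  assumes "dual_bases s U E D"
  shows "dual_bases s U (\<lambda>b. E (\<not> b)) (\<lambda>b. D (\<not> b))"
  using assms by (auto simp: dual_bases_def add.commute)

lemma dual_bases_exist_dual:
  assumes s: "vector_space s" and U: "module.subspace s U" and dim: "vector_space.dim s U = 2"
    and \<phi>: "\<phi> \<in> dual_space s U" "\<phi> \<noteq> 0"
  obtains E D where "dual_bases s U E D" "D False = \<phi>"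
proof -
  interpret s: vector_space s by (rule s)
  note lin = dual_space_linear[OF \<phi>(1)]
  obtain u where u: "\<phi> u \<noteq> 0" using \<phi>(2) by (auto simp: fun_eq_iff)
  then have uU: "u \<in> U" using dual_space_outside[OF \<phi>(1)] by blast
  define e where "e = s (1 / \<phi> u) u"
  have e: "e \<in> U" "\<phi> e = 1" using uU u U linear_on_scale[OF lin] by (auto simp: e_def s.subspace_scale)
  have "\<phi> 0 = 0" using linear_on_scale[OF lin uU, of 0] by simp
  then have "e \<noteq> 0" using e by auto
  then obtain E D where ED: "dual_bases s U E D" "E False = e"
    using dual_bases_exist[OF s U dim e(1)] by blast
  \<comment> \<open>As \<open>\<phi> e = 1\<close>, the form \<phi> differs from
    \<open>D False\<close> only by its value at \<open>E True\<close> times \<open>D True\<close>,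
    and a shear absorbs this difference.\<close>
  have "D False - fscale (- \<phi> (E True)) (D True) = \<phi>"
    using dual_bases_expand_dual[OF ED(1) s U \<phi>(1)] ED(2) e
    by (simp add: fs.scale_minus_left)
  then have "(D(False := D False - fscale (- \<phi> (E True)) (D True))) False = \<phi>" by simp
  then show thesis using that dual_bases_shear[OF ED(1) s U] by blast
qed

lemma rank_one_multilinear:
  assumes s: "vector_space s" and U: "\<And>k. k \<in> K \<Longrightarrow> module.subspace s (U k)" and K: "finite K"
    and f: "\<And>k. k \<in> K \<Longrightarrow> f k \<in> dual_space s (U k)"
  shows "rank_one K U f \<in> multilinear_forms s K U"
proof (rule multilinear_formsI)
  interpret s: vector_space s by (rule s)
  fix x k assume x: "x \<in> Pi\<^sub>E K U" and k: "k \<in> K"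
  have *: "rank_one K U f (x(k := u)) = f k u * (\<Prod>j\<in>K - {k}. f j (x j))" if "u \<in> U k" for u
    using x k K PiE_upd[OF x k that] by (simp add: rank_one_def prod.remove)
  show "linear_on s (*) (U k) (\<lambda>u. rank_one K U f (x(k := u)))"
    using dual_space_linear[OF f[OF k]] s.subspace_add[OF U[OF k]] s.subspace_scale[OF U[OF k]]
    by (auto simp: * linear_on_def algebra_simps)
qed (simp add: rank_one_def)

text \<open>The index set is kept general because the locale serves twice: for the tensor factors,
  and for the cells of all their Young diagrams. Dimension 2 enters through the existence of
  \<open>bases\<close>.\<close>

locale planes = vector_space scale
  for scale :: "complex \<Rightarrow> 'a::ab_group_add \<Rightarrow> 'a" and K :: "'k set" and U :: "'k \<Rightarrow> 'a set" +
  assumes finite_slots: "finite K"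
    and subspace_planes: "\<And>k. k \<in> K \<Longrightarrow> subspace (U k)"
begin

abbreviation forms :: "(('k \<Rightarrow> 'a) \<Rightarrow> complex) set" where
  "forms \<equiv> multilinear_forms scale K U"

definition bases :: "('k \<Rightarrow> bool \<Rightarrow> 'a) \<Rightarrow> ('k \<Rightarrow> bool \<Rightarrow> 'a \<Rightarrow> complex) \<Rightarrow> bool" where
  "bases E D \<longleftrightarrow> (\<forall>k\<in>K. dual_bases scale (U k) (E k) (D k))"

text \<open>The entries of \<open>E\<close> have an arbitrary type because the same function reads
  coordinates of forms at vectors and coordinates of tensors at covectors.\<close>

definition coord :: "('k \<Rightarrow> bool \<Rightarrow> 'b) \<Rightarrow> (('k \<Rightarrow> 'b) \<Rightarrow> complex) \<Rightarrow> 'k set \<Rightarrow> complex" where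
  "coord E A N = A (\<lambda>k\<in>K. E k (k \<in> N))"

lemma basesD:
  assumes "bases E D" "k \<in> K"
  shows "E k b \<in> U k" "D k b \<in> dual_space scale (U k)" "D k b (E k b') = of_bool (b = b')"
    "u \<in> U k \<Longrightarrow> scale (D k False u) (E k False) + scale (D k True u) (E k True) = u"
    "\<phi> \<in> dual_space scale (U k) \<Longrightarrow>
      fscale (\<phi> (E k False)) (D k False) + fscale (\<phi> (E k True)) (D k True) = \<phi>"
  using assms dual_basesD[of scale "U k" "E k" "D k"]
    dual_bases_expand_dual[of scale "U k" "E k" "D k" \<phi>] vector_space_axioms subspace_planes
  by (auto simp: bases_def)

lemma forms_expand:
  assumes A: "A \<in> forms" and B: "bases E D" and u: "u \<in> Pi\<^sub>E K U"
  shows "A u = (\<Sum>N\<in>Pow K. (\<Prod>k\<in>K. D k (k \<in> N) (u k)) * coord E A N)"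
proof -
  have "u = (\<lambda>k\<in>K. scale (D k False (u k)) (E k False) + scale (D k True (u k)) (E k True))"
    using u basesD(4)[OF B] by (auto simp: fun_eq_iff PiE_iff extensional_def)
  then have "A u = A (\<lambda>k\<in>K. scale (D k False (u k)) (E k False) + scale (D k True (u k)) (E k True))"
    by simp
  also have "\<dots> = (\<Sum>N\<in>Pow K. (\<Prod>k\<in>K. D k (k \<in> N) (u k)) * A (\<lambda>k\<in>K. E k (k \<in> N)))"
    by (rule multilinear_expand[OF A vector_space_axioms subspace_planes finite_slots])
      (use basesD(1)[OF B] in auto)
  finally show ?thesis by (simp add: coord_def)
qed

lemma forms_eqI:
  assumes A: "A \<in> forms" "A' \<in> forms" and B: "bases E D"
    and eq: "\<And>N. N \<subseteq> K \<Longrightarrow> coord E A N = coord E A' N"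
  shows "A = A'"
proof
  fix u
  show "A u = A' u"
  proof (cases "u \<in> Pi\<^sub>E K U")
    case True
    then show ?thesis using eq by (simp add: forms_expand[OF A(1) B] forms_expand[OF A(2) B])
  next
    case False
    then show ?thesis using multilinear_forms_outside A by metis
  qed
qed

lemma coord_rank_one:
  assumes B: "bases E D" and NM: "N \<subseteq> K" "M \<subseteq> K"
  shows "coord E (rank_one K U (\<lambda>k. D k (k \<in> M))) N = of_bool (N = M)"
proof -
  have "coord E (rank_one K U (\<lambda>k. D k (k \<in> M))) N = (\<Prod>k\<in>K. of_bool ((k \<in> M) = (k \<in> N)))"
    using basesD[OF B] by (auto simp: coord_def rank_one_def intro!: prod.cong)
  also have "\<dots> = of_bool (N = M)"
  proof (cases "N = M")
    case False
    then obtain k where "k \<in> K" "(k \<in> M) \<noteq> (k \<in> N)" using NM by blast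
    then show ?thesis using False finite_slots by (auto intro!: prod_zero)
  qed simp
  finally show ?thesis .
qed

lemma rank_one_forms:
  "(\<And>k. k \<in> K \<Longrightarrow> f k \<in> dual_space scale (U k)) \<Longrightarrow> rank_one K U f \<in> forms"
  by (rule rank_one_multilinear[OF vector_space_axioms subspace_planes finite_slots])

lemma form_with_coord:
  assumes B: "bases E D"
  obtains A where "A \<in> forms" "\<And>N. N \<subseteq> K \<Longrightarrow> coord E A N = c N"
proof
  define A where "A = (\<Sum>M\<in>Pow K. fscale (c M) (rank_one K U (\<lambda>k. D k (k \<in> M))))"
  show "A \<in> forms"
    unfolding A_def using basesD(2)[OF B]
    by (intro fs.subspace_sum fs.subspace_scale subspace_multilinear_forms rank_one_forms)
  fix N assume N: "N \<subseteq> K"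
  have "coord E A N = (\<Sum>M\<in>Pow K. c M * coord E (rank_one K U (\<lambda>k. D k (k \<in> M))) N)"
    by (simp add: A_def coord_def sum_fun_apply)
  also have "\<dots> = (\<Sum>M\<in>Pow K. if N = M then c M else 0)"
    using N by (intro sum.cong) (auto simp: coord_rank_one[OF B])
  also have "\<dots> = c N" using N finite_slots by simp
  finally show "coord E A N = c N" .
qed

section \<open>The pairing of contravariant and covariant tensors\<close>

text \<open>The natural contraction of a tensor with a multilinear form, as a dot product of
  coordinates in dual bases. If either argument is decomposable, it evaluates the other one; these
  two cases and the adjunction below make it usable without coordinates.\<close>

definition pairing where
  "pairing E D T \<Phi> = (\<Sum>N\<in>Pow K. coord D T N * coord E \<Phi> N)"

abbreviation tensors :: "(('k \<Rightarrow> 'a \<Rightarrow> complex) \<Rightarrow> complex) set" where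
  "tensors \<equiv> multilinear_forms fscale K (\<lambda>k. dual_space scale (U k))"

lemma tensors_expand:
  assumes T: "T \<in> tensors" and B: "bases E D" and \<phi>: "\<phi> \<in> Pi\<^sub>E K (\<lambda>k. dual_space scale (U k))"
  shows "T \<phi> = (\<Sum>N\<in>Pow K. (\<Prod>k\<in>K. \<phi> k (E k (k \<in> N))) * coord D T N)"
proof -
  have "\<phi> = (\<lambda>k\<in>K. fscale (\<phi> k (E k False)) (D k False) + fscale (\<phi> k (E k True)) (D k True))"
  proof
    fix k show "\<phi> k = (\<lambda>k\<in>K. fscale (\<phi> k (E k False)) (D k False) + fscale (\<phi> k (E k True)) (D k True)) k"
      using \<phi> basesD(5)[OF B, of k "\<phi> k"] by (cases "k \<in> K") (auto simp: PiE_iff extensional_def)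
  qed
  then have "T \<phi> = T (\<lambda>k\<in>K. fscale (\<phi> k (E k False)) (D k False) + fscale (\<phi> k (E k True)) (D k True))"
    by simp
  also have "\<dots> = (\<Sum>N\<in>Pow K. (\<Prod>k\<in>K. \<phi> k (E k (k \<in> N))) * T (\<lambda>k\<in>K. D k (k \<in> N)))"
    by (rule multilinear_expand[OF T vector_space_fscale subspace_dual_space finite_slots])
      (use basesD(2)[OF B] in auto)
  finally show ?thesis by (simp add: coord_def)
qed

lemma pairing_evaluation:
  assumes "bases E D" "\<Phi> \<in> forms" "v \<in> Pi\<^sub>E K U"
    and "\<And>\<phi>. \<phi> \<in> Pi\<^sub>E K (\<lambda>k. dual_space scale (U k)) \<Longrightarrow> T \<phi> = (\<Prod>k\<in>K. \<phi> k (v k))"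
  shows "pairing E D T \<Phi> = \<Phi> v"
proof -
  have "coord D T N = (\<Prod>k\<in>K. D k (k \<in> N) (v k))" for N
    using assms(4)[of "\<lambda>k\<in>K. D k (k \<in> N)"] basesD(2)[OF assms(1)] by (simp add: coord_def)
  then show ?thesis by (simp add: pairing_def forms_expand[OF assms(2,1,3)])
qed

lemma pairing_rank_one:
  assumes "bases E D" "T \<in> tensors" "\<phi> \<in> Pi\<^sub>E K (\<lambda>k. dual_space scale (U k))"
    and "\<And>v. v \<in> Pi\<^sub>E K U \<Longrightarrow> \<Phi> v = (\<Prod>k\<in>K. \<phi> k (v k))"
  shows "pairing E D T \<Phi> = T \<phi>"
proof -
  have "coord E \<Phi> N = (\<Prod>k\<in>K. \<phi> k (E k (k \<in> N)))" for N
    using assms(4)[of "\<lambda>k\<in>K. E k (k \<in> N)"] basesD(1)[OF assms(1)] by (simp add: coord_def)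
  then show ?thesis by (simp add: pairing_def tensors_expand[OF assms(2,1,3)] mult.commute)
qed

text \<open>Expanded in coordinates, both sides are the same double sum: the tensor is transformed
  by the matrix \<open>?G\<close>, the form by its transpose.\<close>

lemma pairing_adjoint:
  assumes B: "bases E D" and T: "T \<in> tensors" and \<Phi>: "\<Phi> \<in> forms"
    and g: "\<And>k. k \<in> K \<Longrightarrow> linear_on scale scale (U k) (g k)" "\<And>k. k \<in> K \<Longrightarrow> g k ` U k \<subseteq> U k"
    and T': "\<And>\<phi>. \<phi> \<in> Pi\<^sub>E K (\<lambda>k. dual_space scale (U k)) \<Longrightarrow>
      T' \<phi> = T (\<lambda>k\<in>K. \<lambda>v. if v \<in> U k then \<phi> k (g k v) else 0)"
    and \<Phi>': "\<And>v. v \<in> Pi\<^sub>E K U \<Longrightarrow> \<Phi>' v = \<Phi> (\<lambda>k\<in>K. g k (v k))"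
  shows "pairing E D T' \<Phi> = pairing E D T \<Phi>'"
proof -
  let ?G = "\<lambda>N M. \<Prod>k\<in>K. D k (k \<in> N) (g k (E k (k \<in> M)))"
  have 1: "coord D T' N = (\<Sum>M\<in>Pow K. ?G N M * coord D T M)" for N
  proof -
    have "(\<lambda>v. if v \<in> U k then D k b (g k v) else 0) \<in> dual_space scale (U k)" if k: "k \<in> K" for k b
      using dual_space_linear[OF basesD(2)[OF B k]] g(1)[OF k] g(2)[OF k] subspace_planes[OF k]
      by (intro dual_spaceI) (auto simp: linear_on_def subspace_add subspace_scale image_subset_iff)
    then have *: "(\<lambda>k\<in>K. \<lambda>v. if v \<in> U k then D k (k \<in> N) (g k v) else 0)
        \<in> Pi\<^sub>E K (\<lambda>k. dual_space scale (U k))" by auto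
    have "coord D T' N = T (\<lambda>k\<in>K. \<lambda>v. if v \<in> U k then (\<lambda>k\<in>K. D k (k \<in> N)) k (g k v) else 0)"
      unfolding coord_def using basesD(2)[OF B] by (intro T') auto
    also have "(\<lambda>k\<in>K. \<lambda>v. if v \<in> U k then (\<lambda>k\<in>K. D k (k \<in> N)) k (g k v) else 0) =
        (\<lambda>k\<in>K. \<lambda>v. if v \<in> U k then D k (k \<in> N) (g k v) else 0)" by (auto simp: fun_eq_iff)
    also have "T (\<lambda>k\<in>K. \<lambda>v. if v \<in> U k then D k (k \<in> N) (g k v) else 0) =
        (\<Sum>M\<in>Pow K. ?G N M * coord D T M)"
      unfolding tensors_expand[OF T B *] using basesD(1)[OF B]
      by (intro sum.cong arg_cong2[of _ _ _ _ "(*)"] prod.cong refl) simp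
    finally show ?thesis .
  qed
  have 2: "coord E \<Phi>' M = (\<Sum>N\<in>Pow K. ?G N M * coord E \<Phi> N)" for M
  proof -
    have *: "(\<lambda>k\<in>K. g k (E k (k \<in> M))) \<in> Pi\<^sub>E K U"
      using g(2) basesD(1)[OF B] by (auto simp: image_subset_iff)
    have "coord E \<Phi>' M = \<Phi> (\<lambda>k\<in>K. g k ((\<lambda>k\<in>K. E k (k \<in> M)) k))"
      unfolding coord_def using basesD(1)[OF B] by (intro \<Phi>') auto
    also have "(\<lambda>k\<in>K. g k ((\<lambda>k\<in>K. E k (k \<in> M)) k)) = (\<lambda>k\<in>K. g k (E k (k \<in> M)))"
      by (auto simp: fun_eq_iff)
    also have "\<Phi> (\<lambda>k\<in>K. g k (E k (k \<in> M))) = (\<Sum>N\<in>Pow K. ?G N M * coord E \<Phi> N)"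
      unfolding forms_expand[OF \<Phi> B *]
      by (intro sum.cong arg_cong2[of _ _ _ _ "(*)"] prod.cong refl) simp
    finally show ?thesis .
  qed
  have "pairing E D T' \<Phi> = (\<Sum>N\<in>Pow K. \<Sum>M\<in>Pow K. ?G N M * coord D T M * coord E \<Phi> N)"
    by (simp add: pairing_def 1 sum_distrib_right)
  also have "\<dots> = (\<Sum>M\<in>Pow K. \<Sum>N\<in>Pow K. ?G N M * coord D T M * coord E \<Phi> N)"
    by (rule sum.swap)
  also have "\<dots> = pairing E D T \<Phi>'"
    by (simp add: pairing_def 2 sum_distrib_left mult.assoc mult.left_commute)
  finally show ?thesis .
qed

end

section \<open>Embedded tangent spaces of the Segre variety\<close>

text \<open>Along a line, a \<open>d\<close>-linear form on the diagonal expands by the slots that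
  receive the direction \<open>w\<close>; its linear term has exactly one such slot and is therefore
  linear in \<open>w\<close>. This makes the embedded tangent space, defined by vanishing
  derivatives, a subspace.\<close>

lemma hom_poly_derivative:
  assumes s: "vector_space s" and W: "module.subspace s W" and p: "p \<in> hom_polys s W d" and x: "x \<in> W"
  obtains D where "linear_on s (*) W D"
    "\<And>w. w \<in> W \<Longrightarrow> ((\<lambda>t. p (x + s t w)) has_field_derivative D w) (at 0)"
proof -
  interpret s: vector_space s by (rule s)
  obtain B where B: "B \<in> multilinear_forms s {..<d} (\<lambda>_. W)"
    and pB: "p = (\<lambda>w. if w \<in> W then B (\<lambda>j\<in>{..<d}. w) else 0)"
    using p by (auto simp: hom_polys_def)
  let ?D = "\<lambda>w. \<Sum>j<d. B ((\<lambda>i\<in>{..<d}. x)(j := w))"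
  have lin: "linear_on s (*) W (\<lambda>w. B ((\<lambda>i\<in>{..<d}. x)(j := w)))" if "j < d" for j
    using multilinear_forms_linear[OF B, of "\<lambda>i\<in>{..<d}. x" j] x that by auto
  have D: "linear_on s (*) W ?D"
    unfolding linear_on_def
  proof (intro conjI ballI allI)
    fix v w assume "v \<in> W" "w \<in> W"
    then show "?D (v + w) = ?D v + ?D w"
      unfolding sum.distrib[symmetric] using linear_on_add[OF lin] by (intro sum.cong) auto
  next
    fix c w assume "w \<in> W"
    then show "?D (s c w) = c * ?D w"
      unfolding sum_distrib_left using linear_on_scale[OF lin] by (intro sum.cong) auto
  qed
  have "((\<lambda>t. p (x + s t w)) has_field_derivative ?D w) (at 0)" if w: "w \<in> W" for w
  proof -
    let ?b = "\<lambda>N. B (\<lambda>j\<in>{..<d}. if j \<in> N then w else x)"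
    have "p (x + s t w) = (\<Sum>N\<in>Pow {..<d}. t ^ card N * ?b N)" for t
      using multilinear_pencil[OF B s W, of "\<lambda>_. x" "\<lambda>_. w" t] x w s.subspace_add[OF W] s.subspace_scale[OF W]
      by (simp add: pB)
    moreover have "((\<lambda>t. \<Sum>N\<in>Pow {..<d}. t ^ card N * ?b N) has_field_derivative
        (\<Sum>N\<in>Pow {..<d}. of_nat (card N) * 0 ^ (card N - Suc 0) * ?b N)) (at 0)"
      by (auto intro!: derivative_eq_intros sum.cong)
    moreover have "(\<Sum>N\<in>Pow {..<d}. of_nat (card N) * 0 ^ (card N - Suc 0) * ?b N) = ?D w"
    proof -
      \<comment> \<open>Only singletons contribute. For the empty set the truncated exponent yields
        \<open>0 ^ 0 = 1\<close>, but the factor \<open>of_nat (card N)\<close> is zero.\<close>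
      have "(\<Sum>N\<in>Pow {..<d}. of_nat (card N) * 0 ^ (card N - Suc 0) * ?b N) =
        (\<Sum>N\<in>(\<lambda>j. {j}) ` {..<d}. of_nat (card N) * 0 ^ (card N - Suc 0) * ?b N)"
      proof (intro sum.mono_neutral_right ballI)
        fix N assume N: "N \<in> Pow {..<d} - (\<lambda>j. {j}) ` {..<d}"
        then have "card N \<noteq> 1" by (auto simp: card_1_singleton_iff)
        then show "of_nat (card N) * 0 ^ (card N - Suc 0) * ?b N = 0"
          by (cases "card N = 0") (auto simp: power_0_left)
      qed auto
      also have "\<dots> = (\<Sum>j<d. ?b {j})"
        by (subst sum.reindex) (auto simp: inj_on_def)
      also have "\<dots> = ?D w"
        by (intro sum.cong refl arg_cong[of _ _ B]) (auto simp: fun_eq_iff)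
      finally show ?thesis .
    qed
    ultimately show ?thesis by simp
  qed
  with D show thesis using that by blast
qed

lemma embedded_tangent_spaceD:
  assumes "w \<in> embedded_tangent_space s W X L" "p \<in> hom_polys s W d" "\<forall>P\<in>X. \<forall>y\<in>P. p y = 0" "x \<in> L - {0}"
  shows "w \<in> W" "((\<lambda>t. p (x + s t w)) has_field_derivative 0) (at 0)"
  using assms unfolding embedded_tangent_space_def by blast+

lemma subspace_embedded_tangent_space:
  assumes s: "vector_space s" and W: "module.subspace s W" and L: "L \<subseteq> W"
  shows "module.subspace s (embedded_tangent_space s W X L)"
proof -
  interpret s: vector_space s by (rule s)
  show ?thesis
  proof (rule s.subspaceI)
    show "0 \<in> embedded_tangent_space s W X L"
      by (auto simp: embedded_tangent_space_def s.subspace_0[OF W])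
  next
    fix v w assume vw: "v \<in> embedded_tangent_space s W X L" "w \<in> embedded_tangent_space s W X L"
    show "v + w \<in> embedded_tangent_space s W X L"
      unfolding embedded_tangent_space_def
    proof (clarify, intro conjI allI ballI impI)
      show "v + w \<in> W" using vw s.subspace_add[OF W] by (auto simp: embedded_tangent_space_def)
      fix d p x assume p: "p \<in> hom_polys s W d" "\<forall>P\<in>X. \<forall>y\<in>P. p y = 0" "x \<in> L - {0}"
      then obtain D where D: "linear_on s (*) W D"
        "\<And>w. w \<in> W \<Longrightarrow> ((\<lambda>t. p (x + s t w)) has_field_derivative D w) (at 0)"
        using hom_poly_derivative[OF s W p(1), of x] L by blast
      have "v \<in> W" "w \<in> W" using vw by (auto simp: embedded_tangent_space_def)
      moreover from this have "D v = 0" "D w = 0"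
        using D(2) DERIV_unique embedded_tangent_spaceD(2)[OF vw(1) p] embedded_tangent_spaceD(2)[OF vw(2) p]
        by blast+
      ultimately show "((\<lambda>t. p (x + s t (v + w))) has_field_derivative 0) (at 0)"
        using D(2)[of "v + w"] linear_on_add[OF D(1)] s.subspace_add[OF W] by simp
    qed
  next
    fix c w assume w: "w \<in> embedded_tangent_space s W X L"
    show "s c w \<in> embedded_tangent_space s W X L"
      unfolding embedded_tangent_space_def
    proof (clarify, intro conjI allI ballI impI)
      show "s c w \<in> W" using w s.subspace_scale[OF W] by (auto simp: embedded_tangent_space_def)
      fix d p x assume p: "p \<in> hom_polys s W d" "\<forall>P\<in>X. \<forall>y\<in>P. p y = 0" "x \<in> L - {0}"
      then obtain D where D: "linear_on s (*) W D"
        "\<And>w. w \<in> W \<Longrightarrow> ((\<lambda>t. p (x + s t w)) has_field_derivative D w) (at 0)"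
        using hom_poly_derivative[OF s W p(1), of x] L by blast
      have "w \<in> W" using w by (auto simp: embedded_tangent_space_def)
      moreover from this have "D w = 0"
        using D(2) DERIV_unique embedded_tangent_spaceD(2)[OF w p] by blast
      ultimately show "((\<lambda>t. p (x + s t (s c w))) has_field_derivative 0) (at 0)"
        using D(2)[of "s c w"] linear_on_scale[OF D(1)] s.subspace_scale[OF W] by simp
    qed
  qed
qed

section \<open>Tangent spaces of the Segre variety in coordinates\<close>

context planes
begin

text \<open>If \<open>E\<close> and \<open>D\<close> are dual bases, this is the affine tangent
  space to the cone over the Segre variety at the product of the \<open>D k False\<close>.\<close>

definition tangent_forms where
  "tangent_forms E = {A \<in> forms. \<forall>N\<subseteq>K. 2 \<le> card N \<longrightarrow> coord E A N = 0}"

lemma subspace_tangent_forms: "fs.subspace (tangent_forms E)"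
  using fs.subspace_add[OF subspace_multilinear_forms] fs.subspace_scale[OF subspace_multilinear_forms]
    fs.subspace_0[OF subspace_multilinear_forms]
  by (intro fs.subspaceI) (auto simp: tangent_forms_def coord_def)

lemma evaluation_dual: "(\<lambda>A. if A \<in> forms then A x else 0) \<in> dual_space fscale forms"
  by (intro dual_spaceI) (simp_all add: fs.subspace_add[OF subspace_multilinear_forms]
      fs.subspace_scale[OF subspace_multilinear_forms])

text \<open>Supplies the 2 x 2 minors as quadratic polynomials; these equations of the Segre variety
  suffice to bound its tangent spaces from above.\<close>

lemma evaluation_product_hom_poly:
  "(\<lambda>A. if A \<in> forms then A x * A y - A x' * A y' else 0) \<in> hom_polys fscale forms 2"
proof -
  let ?e = "\<lambda>x A. if A \<in> forms then A x else 0"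
  let ?R = "\<lambda>x y. rank_one {..<2} (\<lambda>_. forms) (\<lambda>j::nat. ?e (if j = 0 then x else y))"
  have R: "?R x y \<in> multilinear_forms fscale {..<2} (\<lambda>_. forms)" for x y
    using evaluation_dual
    by (intro rank_one_multilinear[OF vector_space_fscale]) (auto intro: subspace_multilinear_forms)
  have 1: "?R x y (\<lambda>j\<in>{..<2}. A) = A x * A y" if "A \<in> forms" for x y A
    using that by (simp add: rank_one_def lessThan_nat_numeral)
  have "?R x y - ?R x' y' \<in> multilinear_forms fscale {..<2} (\<lambda>_. forms)"
    using fs.subspace_diff[OF subspace_multilinear_forms R R] .
  moreover have "(\<lambda>A. if A \<in> forms then A x * A y - A x' * A y' else 0) =
      (\<lambda>A. if A \<in> forms then (?R x y - ?R x' y') (\<lambda>j\<in>{..<2}. A) else 0)"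
    by (auto simp: fun_eq_iff 1)
  ultimately show ?thesis unfolding hom_polys_def by blast
qed

lemma span_singleton_apply: "A \<in> fs.span {B} \<longleftrightarrow> (\<exists>c. A = fscale c B)"
  by (auto simp: fs.span_singleton)

text \<open>On a product of covectors, exchanging the arguments in slot \<open>i\<close> between two
  evaluations leaves their product unchanged: in every slot the same two values occur on both
  sides.\<close>

lemma segre_minor_zero:
  assumes P: "P \<in> segre scale K U" and A: "A \<in> P" and B: "bases E D" and N: "i \<in> N" "N \<subseteq> K"
  shows "coord E A {} * coord E A N - coord E A {i} * coord E A (N - {i}) = 0"
proof -
  obtain f where "P = fs.span {rank_one K U f}"
    using P by (auto simp: segre_def)
  then obtain c where c: "A = fscale c (rank_one K U f)" using A by (auto simp: span_singleton_apply)
  have *: "coord E A M = c * (\<Prod>k\<in>K. f k (E k (k \<in> M)))" for M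
    using basesD(1)[OF B] by (auto simp: c coord_def rank_one_def PiE_iff)
  have "(\<Prod>k\<in>K. f k (E k (k \<in> {}))) * (\<Prod>k\<in>K. f k (E k (k \<in> N))) =
    (\<Prod>k\<in>K. f k (E k (k \<in> {i}))) * (\<Prod>k\<in>K. f k (E k (k \<in> N - {i})))"
    unfolding prod.distrib[symmetric]
  proof (intro prod.cong refl)
    fix k
    show "f k (E k (k \<in> {})) * f k (E k (k \<in> N)) = f k (E k (k \<in> {i})) * f k (E k (k \<in> N - {i}))"
      using N(1) by (cases "k = i"; cases "k \<in> N") auto
  qed
  then show ?thesis unfolding * by (simp add: algebra_simps)
qed

text \<open>With bases adapted to the point \<open>x\<close> of \<open>L\<close>, only the
  coordinate of \<open>x\<close> at the empty set is nonzero. Hence the first product of the minor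
  for \<open>N\<close> changes to first order by \<open>coord E w N\<close>, while the second starts
  at order two, and tangency forces this coordinate to vanish.\<close>

lemma embedded_tangent_space_segre:
  assumes dim: "\<And>k. k \<in> K \<Longrightarrow> dim (U k) = 2"
    and L: "L \<in> segre scale K U"
    and w: "w \<in> embedded_tangent_space fscale forms (segre scale K U) L"
  obtains E D where "bases E D" "w \<in> tangent_forms E"
proof -
  obtain f where Lf: "L = fs.span {rank_one K U f}" and f: "\<And>k. k \<in> K \<Longrightarrow> f k \<in> dual_space scale (U k) \<and> f k \<noteq> 0"
    using L by (auto simp: segre_def)
  have "\<forall>k\<in>K. \<exists>E D. dual_bases scale (U k) E D \<and> D False = f k"
    using dual_bases_exist_dual[OF vector_space_axioms subspace_planes dim] f by metis
  then obtain E D where ED: "\<And>k. k \<in> K \<Longrightarrow> dual_bases scale (U k) (E k) (D k) \<and> D k False = f k"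
    by metis
  then have B: "bases E D" by (simp add: bases_def)
  define x where "x = rank_one K U f"
  have xD: "x = rank_one K U (\<lambda>k. D k (k \<in> {}))"
    using ED by (auto simp: x_def rank_one_def fun_eq_iff)
  have x: "coord E x N = of_bool (N = {})" if "N \<subseteq> K" for N
    using coord_rank_one[OF B that, of "{}"] by (simp add: xD)
  have xF: "x \<in> forms" unfolding x_def using f by (intro rank_one_forms) auto
  have "x \<noteq> 0" using x[of "{}"] by (auto simp: coord_def)
  then have xL: "x \<in> L - {0}" by (simp add: Lf x_def fs.span_base)
  have wF: "w \<in> forms" using w by (simp add: embedded_tangent_space_def)
  have "coord E w N = 0" if N: "N \<subseteq> K" "2 \<le> card N" for N
  proof -
    obtain i where i: "i \<in> N" using N(2) by fastforce
    have "finite N" using N finite_slots finite_subset by blast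
    then have Ni: "N \<noteq> {}" "N - {i} \<noteq> {}" using N(2) i by (auto dest: card_mono[of "{i}" N, rotated])
    let ?x = "\<lambda>N. \<lambda>k\<in>K. E k (k \<in> N)"
    define q where "q = (\<lambda>A. if A \<in> forms then A (?x {}) * A (?x N) - A (?x {i}) * A (?x (N - {i})) else 0)"
    have q: "q \<in> hom_polys fscale forms 2"
      unfolding q_def by (rule evaluation_product_hom_poly)
    have "q A = 0" if "P \<in> segre scale K U" "A \<in> P" for P A
      using segre_minor_zero[OF that B i N(1)] by (simp add: q_def coord_def)
    then have 1: "((\<lambda>t. q (x + fscale t w)) has_field_derivative 0) (at 0)"
      using w q xL unfolding embedded_tangent_space_def by blast
    have "x + fscale t w \<in> forms" for t
      using xF wF by (simp add: fs.subspace_add[OF subspace_multilinear_forms] fs.subspace_scale[OF subspace_multilinear_forms])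
    moreover have "q A = coord E A {} * coord E A N - coord E A {i} * coord E A (N - {i})" if "A \<in> forms" for A
      using that by (simp add: q_def coord_def)
    moreover have "coord E (x + fscale t w) M = coord E x M + t * coord E w M" for t M
      by (simp add: coord_def)
    moreover have "coord E x {} = 1" "coord E x N = 0" "coord E x {i} = 0" "coord E x (N - {i}) = 0"
      using x[of "{}"] x[of N] x[of "{i}"] x[of "N - {i}"] N i Ni by (simp_all add: subset_insertI2 subset_iff)
    ultimately have "q (x + fscale t w) = (1 + t * coord E w {}) * (t * coord E w N) -
        (t * coord E w {i}) * (t * coord E w (N - {i}))" for t by simp
    moreover have "((\<lambda>t. (1 + t * coord E w {}) * (t * coord E w N) -
        (t * coord E w {i}) * (t * coord E w (N - {i}))) has_field_derivative coord E w N) (at 0)"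
      by (auto intro!: derivative_eq_intros)
    ultimately show ?thesis using DERIV_unique[OF 1] by simp
  qed
  then show thesis using that B wF by (auto simp: tangent_forms_def)
qed

lemma tangential_variety_segre_subset:
  assumes dim: "\<And>k. k \<in> K \<Longrightarrow> dim (U k) = 2"
    and P: "P \<in> tangential_variety fscale forms (segre scale K U)" and A: "A \<in> P"
  obtains E D where "bases E D" "A \<in> tangent_forms E"
proof -
  obtain L where "L \<in> segre scale K U" "A \<in> embedded_tangent_space fscale forms (segre scale K U) L"
    using P A unfolding tangential_variety_def embedded_tangent_lines_def by blast
  then show thesis using embedded_tangent_space_segre[OF dim] that by blast
qed

text \<open>A tangent form is a combination of the forms \<open>R N\<close> with at most one factor
  \<open>D k True\<close>. Moving from a point of \<open>L\<close> in such a direction changes a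
  single factor, so the whole line stays in the cone over the Segre variety, and a polynomial
  vanishing there vanishes along it. Linearity of the tangent space does the rest.\<close>

lemma tangent_forms_embedded:
  assumes B: "bases E D" and w: "w \<in> tangent_forms E"
  shows "w \<in> embedded_tangent_space fscale forms (segre scale K U)
    (fs.span {rank_one K U (\<lambda>k. D k False)})"
proof -
  define R where "R = (\<lambda>N. rank_one K U (\<lambda>k. D k (k \<in> N)))"
  let ?L = "fs.span {R {}}" and ?S = "segre scale K U"
  let ?T = "embedded_tangent_space fscale forms ?S ?L"
  have RF: "R N \<in> forms" for N unfolding R_def using basesD(2)[OF B] by (intro rank_one_forms) auto
  have LF: "?L \<subseteq> forms" using RF by (intro fs.span_minimal subspace_multilinear_forms) auto
  have ne: "D k b \<noteq> 0" if "k \<in> K" for k b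
    using basesD(3)[OF B that, of b b] by auto
  have Lseg: "?L \<in> ?S"
    unfolding segre_def R_def using basesD(2)[OF B] ne by auto
  have zero: "p (x + fscale t (R N)) = 0"
    if p: "\<forall>P\<in>?S. \<forall>y\<in>P. p y = 0" and x: "x \<in> ?L - {0}" and N: "N \<subseteq> K" "card N < 2" for p x t N
  proof (cases "N = {}")
    case True
    have "x + fscale t (R {}) \<in> ?L" using x by (intro fs.span_add fs.span_scale) (auto intro: fs.span_base)
    then show ?thesis using True p Lseg by blast
  next
    case False
    have "finite N" using N finite_slots finite_subset by blast
    then have "card N = 1" using False N card_gt_0_iff[of N] by linarith
    then obtain k where k: "N = {k}" by (auto simp: card_1_singleton_iff)
    then have kK: "k \<in> K" using N by auto
    obtain c where c: "x = fscale c (R {})" "c \<noteq> 0"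
      using x unfolding span_singleton_apply Diff_iff by fastforce
    define f where "f = (\<lambda>j. D j False)(k := fscale c (D k False) + fscale t (D k True))"
    have "(x + fscale t (R N)) v = rank_one K U f v" for v
    proof (cases "v \<in> Pi\<^sub>E K U")
      case True
      have "(\<Prod>j\<in>K - {k}. f j (v j)) = (\<Prod>j\<in>K - {k}. D j False (v j))"
        "(\<Prod>j\<in>K - {k}. D j (j = k) (v j)) = (\<Prod>j\<in>K - {k}. D j False (v j))"
        by (auto simp: f_def intro!: prod.cong)
      then show ?thesis
        using True kK finite_slots
        by (simp add: c R_def k rank_one_def prod.remove[of K k]) (simp add: f_def algebra_simps)
    next
      case False
      then show ?thesis by (simp add: c R_def rank_one_def)
    qed
    then have *: "x + fscale t (R N) = rank_one K U f" by (simp add: fun_eq_iff)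
    \<comment> \<open>Since \<open>c\<close> is nonzero, the modified factor is nonzero for every
      \<open>t\<close>, as membership in the Segre variety demands.\<close>
    have "f k (E k False) = c" using basesD(3)[OF B kK] by (simp add: f_def)
    then have "f k \<noteq> 0" using c(2) by auto
    then have "f j \<noteq> 0" if "j \<in> K" for j
      using ne[OF that] by (cases "j = k") (simp_all add: f_def)
    moreover have "f j \<in> dual_space scale (U j)" if "j \<in> K" for j
      using basesD(2)[OF B that]
      by (auto simp: f_def fs.subspace_add[OF subspace_dual_space] fs.subspace_scale[OF subspace_dual_space])
    ultimately have "fs.span {rank_one K U f} \<in> ?S" unfolding segre_def by auto
    then show ?thesis using p by (auto simp: * intro: fs.span_base)
  qed
  have sub: "fs.subspace ?T"
    by (rule subspace_embedded_tangent_space[OF vector_space_fscale subspace_multilinear_forms LF])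
  have RT: "R N \<in> ?T" if "N \<subseteq> K" "card N < 2" for N
  proof -
    have "((\<lambda>t. p (x + fscale t (R N))) has_field_derivative 0) (at 0)"
      if "\<forall>P\<in>?S. \<forall>y\<in>P. p y = 0" "x \<in> ?L - {0}" for p x
      unfolding zero[OF that \<open>N \<subseteq> K\<close> \<open>card N < 2\<close>] by simp
    then show ?thesis using RF by (simp add: embedded_tangent_space_def)
  qed
  have "w = (\<Sum>N\<in>Pow K. fscale (coord E w N) (R N))"
  proof (rule forms_eqI[OF _ _ B])
    show "w \<in> forms" using w by (simp add: tangent_forms_def)
    show "(\<Sum>N\<in>Pow K. fscale (coord E w N) (R N)) \<in> forms"
      using RF by (intro fs.subspace_sum fs.subspace_scale subspace_multilinear_forms)
    fix M assume M: "M \<subseteq> K"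
    have "coord E (\<Sum>N\<in>Pow K. fscale (coord E w N) (R N)) M = (\<Sum>N\<in>Pow K. coord E w N * coord E (R N) M)"
      by (simp add: coord_def sum_fun_apply)
    also have "\<dots> = (\<Sum>N\<in>Pow K. if M = N then coord E w N else 0)"
      using M by (intro sum.cong) (auto simp: R_def coord_rank_one[OF B])
    also have "\<dots> = coord E w M" using M finite_slots by simp
    finally show "coord E w M = coord E (\<Sum>N\<in>Pow K. fscale (coord E w N) (R N)) M" by simp
  qed
  also have "\<dots> \<in> ?T"
  proof (rule fs.subspace_sum[OF sub])
    fix N assume N: "N \<in> Pow K"
    show "fscale (coord E w N) (R N) \<in> ?T"
    proof (cases "card N < 2")
      case True
      then show ?thesis using RT N fs.subspace_scale[OF sub] by auto
    next
      case False
      then have "coord E w N = 0" using w N by (auto simp: tangent_forms_def)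
      then show ?thesis using fs.subspace_0[OF sub] by simp
    qed
  qed
  finally show ?thesis by (simp add: R_def)
qed

text \<open>A tangent line joins the base point to a second direction \<open>C\<close>. If
  \<open>A\<close> spans the base point itself, any \<open>R {k}\<close> serves as \<open>C\<close>;
  this is where a tensor factor must exist.\<close>

lemma tangent_forms_tangential_variety:
  assumes ne: "K \<noteq> {}" and B: "bases E D" and A: "A \<in> tangent_forms E" "A \<noteq> 0"
  shows "fs.span {A} \<in> tangential_variety fscale forms (segre scale K U)"
proof -
  define R where "R = (\<lambda>N. rank_one K U (\<lambda>k. D k (k \<in> N)))"
  let ?L = "fs.span {R {}}"
  obtain k where k: "k \<in> K" using ne by blast
  have R: "R N \<in> tangent_forms E" if "N \<subseteq> K" "card N < 2" for N
    unfolding tangent_forms_def R_def using basesD(2)[OF B] that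
    by (auto simp: coord_rank_one[OF B] intro!: rank_one_forms)
  have Rc: "coord E (R M) N = of_bool (N = M)" if "N \<subseteq> K" "M \<subseteq> K" for N M
    unfolding R_def by (rule coord_rank_one[OF B that])
  have R0: "R {} \<noteq> 0" using Rc[of "{}" "{}"] by (auto simp: coord_def)
  have "\<exists>C\<in>tangent_forms E. C \<notin> ?L \<and> A \<in> fs.span {R {}, C}"
  proof (cases "A \<in> ?L")
    case False
    then show ?thesis using A by (intro bexI[of _ A]) (auto intro: fs.span_base)
  next
    case True
    have "R {k} \<noteq> fscale c (R {})" for c
    proof
      assume "R {k} = fscale c (R {})"
      then have "coord E (R {k}) {k} = c * coord E (R {}) {k}" by (simp add: coord_def)
      then show False using Rc[of "{k}" "{k}"] Rc[of "{k}" "{}"] k by simp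
    qed
    then show ?thesis
      using True k R[of "{k}"] fs.span_mono[of "{R {}}" "{R {}, R {k}}"]
      by (intro bexI[of _ "R {k}"]) (auto simp: span_singleton_apply)
  qed
  then obtain C where C: "C \<in> tangent_forms E" "C \<notin> ?L" "A \<in> fs.span {R {}, C}" by blast
  define Z where "Z = fs.span {R {}, C}"
  have ind: "fs.independent {R {}, C}"
    using C(2) R0 by (subst insert_commute) (simp add: fs.independent_insert)
  have "R {} \<noteq> C" using C(2) fs.span_base[of "R {}" "{R {}}"] by auto
  then have dim: "fs.dim Z = 2" unfolding Z_def using fs.dim_span_eq_card_independent[OF ind] by simp
  have ne: "D k b \<noteq> 0" if "k \<in> K" for k b
    using basesD(3)[OF B that, of b b] by auto
  have L: "?L \<in> segre scale K U"
    unfolding segre_def R_def using basesD(2)[OF B] ne by auto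
  have "Z \<subseteq> tangent_forms E"
    unfolding Z_def using C R[of "{}"] by (intro fs.span_minimal subspace_tangent_forms) auto
  then have Z: "Z \<subseteq> embedded_tangent_space fscale forms (segre scale K U) ?L"
    using tangent_forms_embedded[OF B] by (auto simp: R_def)
  have "?L \<subseteq> Z" unfolding Z_def by (rule fs.span_mono) auto
  then have "Z \<in> embedded_tangent_lines fscale forms (segre scale K U)"
    unfolding embedded_tangent_lines_def using L Z dim by (auto simp: Z_def)
  moreover have "fs.span {A} \<subseteq> Z"
    using C(3) unfolding Z_def by (intro fs.span_minimal) auto
  moreover have "fs.span {A} \<in> proj_space fscale forms"
    using A by (auto simp: proj_space_def tangent_forms_def)
  ultimately show ?thesis unfolding tangential_variety_def by blast
qed

end

section \<open>Contracting Schur tensors with powers of a multilinear form\<close>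

lemma finite_cells: "finite (cells \<mu>)"
proof -
  have "cells \<mu> = Sigma {..<length \<mu>} (\<lambda>r. {..<\<mu> ! r})" by (auto simp: cells_def)
  then show ?thesis by simp
qed

lemma permute_PiE_iff:
  assumes "\<rho> permutes K"
  shows "\<phi> \<circ> \<rho> \<in> Pi\<^sub>E K (\<lambda>_. W) \<longleftrightarrow> \<phi> \<in> Pi\<^sub>E K (\<lambda>_. W)"
proof -
  have *: "\<phi> \<circ> \<rho> \<in> Pi\<^sub>E K (\<lambda>_. W)" if "\<phi> \<in> Pi\<^sub>E K (\<lambda>_. W)" "\<rho> permutes K" for \<phi> \<rho>
    using that permutes_in_image[OF that(2)] permutes_not_in[OF that(2)]
    by (auto simp: PiE_iff extensional_def)
  show ?thesis
    using *[of \<phi> \<rho>] *[of "\<phi> \<circ> \<rho>" "inv \<rho>"] assms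
    by (auto simp: permutes_inv comp_assoc permutes_inv_o)
qed

lemma multilinear_permute:
  assumes T: "T \<in> multilinear_forms s K (\<lambda>_. W)" and \<rho>: "\<rho> permutes K"
  shows "(\<lambda>\<phi>. T (\<phi> \<circ> \<rho>)) \<in> multilinear_forms s K (\<lambda>_. W)"
proof (rule multilinear_formsI)
  fix \<phi> k assume \<phi>: "\<phi> \<in> Pi\<^sub>E K (\<lambda>_. W)" and k: "k \<in> K"
  have "\<phi>(k := u) \<circ> \<rho> = (\<phi> \<circ> \<rho>)(inv \<rho> k := u)" for u
    using permutes_inverses[OF \<rho>] by (auto simp: fun_eq_iff)
  moreover have "\<phi> \<circ> \<rho> \<in> Pi\<^sub>E K (\<lambda>_. W)" "inv \<rho> k \<in> K"
    by (simp_all only: permute_PiE_iff[OF \<rho>] \<phi> permutes_in_image[OF permutes_inv[OF \<rho>]] k)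
  ultimately show "linear_on s (*) W (\<lambda>u. T (\<phi>(k := u) \<circ> \<rho>))"
    using multilinear_forms_linear[OF T] by (simp only:)
next
  fix \<phi> assume "\<phi> \<notin> Pi\<^sub>E K (\<lambda>_. W)"
  then show "T (\<phi> \<circ> \<rho>) = 0"
    by (intro multilinear_forms_outside[OF T]) (simp only: permute_PiE_iff[OF \<rho>] not_False_eq_True)
qed

lemma schur_module_tensor_power:
  assumes "T \<in> schur_module s \<mu> W"
  shows "T \<in> tensor_power s (cells \<mu>) W"
proof -
  obtain S where S: "S \<in> tensor_power s (cells \<mu>) W" and T: "T = young_symmetrizer \<mu> S"
    using assms by (auto simp: schur_module_def)
  have "T = (\<Sum>\<sigma>\<in>row_group \<mu>. \<Sum>\<tau>\<in>col_group \<mu>. fscale (of_int (sign \<tau>)) (\<lambda>\<phi>. S (\<phi> \<circ> (\<sigma> \<circ> \<tau>))))"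
    by (simp add: T young_symmetrizer_def fun_eq_iff sum_fun_apply o_assoc)
  also have "\<dots> \<in> tensor_power s (cells \<mu>) W"
    unfolding tensor_power_def
    by (intro fs.subspace_sum fs.subspace_scale subspace_multilinear_forms
        multilinear_permute[OF S[unfolded tensor_power_def]] permutes_compose)
      (simp_all add: row_group_def col_group_def)
  finally show ?thesis .
qed

text \<open>The bijection \<open>\<gamma> i\<close> decides which cell of the diagram of factor
  \<open>i\<close> belongs to the \<open>j\<close>-th of \<open>d\<close> copies of a form. Each
  choice yields its own equivariant map from Schur tensors to polynomials of degree
  \<open>d\<close>. The bases \<open>E\<close> and \<open>D\<close> serve to write the pairing and,
  later, the torus.\<close>

locale tensor_type = planes scale I V
  for scale :: "complex \<Rightarrow> 'a::ab_group_add \<Rightarrow> 'a" and I :: "'i set" and V :: "'i \<Rightarrow> 'a set" +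
  fixes \<pi> :: "'i \<Rightarrow> nat list" and d :: nat and \<gamma> :: "'i \<Rightarrow> nat \<Rightarrow> nat \<times> nat"
    and E :: "'i \<Rightarrow> bool \<Rightarrow> 'a" and D :: "'i \<Rightarrow> bool \<Rightarrow> 'a \<Rightarrow> complex"
  assumes labelling: "\<And>i. i \<in> I \<Longrightarrow> bij_betw (\<gamma> i) {..<d} (cells (\<pi> i))"
    and ref_bases: "bases E D"

sublocale tensor_type \<subseteq> slots: planes scale "tensor_slots I \<pi>" "\<lambda>k. V (fst k)"
  using finite_slots finite_cells subspace_planes by unfold_locales auto

context tensor_type
begin

abbreviation "slots \<equiv> tensor_slots I \<pi>"

definition label :: "'i \<Rightarrow> nat \<times> nat \<Rightarrow> nat" where
  "label i = inv_into {..<d} (\<gamma> i)"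

lemma label_cell [simp]: "i \<in> I \<Longrightarrow> j < d \<Longrightarrow> label i (\<gamma> i j) = j"
  using bij_betw_inv_into_left[OF labelling, of i j] by (simp add: label_def)

lemma cell_label [simp]: "i \<in> I \<Longrightarrow> c \<in> cells (\<pi> i) \<Longrightarrow> \<gamma> i (label i c) = c"
  using bij_betw_inv_into_right[OF labelling, of i c] by (simp add: label_def)

lemma label_less: "i \<in> I \<Longrightarrow> c \<in> cells (\<pi> i) \<Longrightarrow> label i c < d"
  using bij_betw_inv_into[OF labelling, of i] by (auto simp: label_def bij_betw_def)

lemma cell_in [simp]: "i \<in> I \<Longrightarrow> j < d \<Longrightarrow> \<gamma> i j \<in> cells (\<pi> i)"
  using labelling[of i] by (auto simp: bij_betw_def)

lemma prod_slots:
  fixes g :: "'i \<times> nat \<times> nat \<Rightarrow> complex"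
  shows "(\<Prod>k\<in>slots. g k) = (\<Prod>j<d. \<Prod>i\<in>I. g (i, \<gamma> i j))"
proof -
  have "(\<Prod>k\<in>slots. g k) = (\<Prod>i\<in>I. \<Prod>c\<in>cells (\<pi> i). g (i, c))"
    using finite_slots finite_cells by (subst prod.Sigma) auto
  also have "\<dots> = (\<Prod>i\<in>I. \<Prod>j<d. g (i, \<gamma> i j))"
    by (intro prod.cong refl prod.reindex_bij_betw[symmetric] labelling)
  finally show ?thesis by (subst prod.swap)
qed

lemma slot_bases: "slots.bases (\<lambda>k. E (fst k)) (\<lambda>k. D (fst k))"
  using ref_bases by (auto simp: slots.bases_def bases_def)

lemma covectors_eq: "covectors scale I V \<pi> = Pi\<^sub>E slots (\<lambda>k. dual_space scale (V (fst k)))"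
  unfolding covectors_def by (rule arg_cong[of _ _ "Pi\<^sub>E slots"]) (auto simp: fun_eq_iff)

lemma outer_product_tensor:
  assumes T: "\<And>i. i \<in> I \<Longrightarrow> T i \<in> tensor_power scale (cells (\<pi> i)) (V i)"
  shows "outer_product scale I V \<pi> T \<in> slots.tensors"
proof (rule multilinear_formsI)
  fix \<phi> k assume \<phi>: "\<phi> \<in> Pi\<^sub>E slots (\<lambda>k. dual_space scale (V (fst k)))" and k: "k \<in> slots"
  obtain i c where ic: "k = (i, c)" "i \<in> I" "c \<in> cells (\<pi> i)" using k by auto
  have lin: "linear_on fscale (*) (dual_space scale (V i)) (\<lambda>u. T i ((\<lambda>c\<in>cells (\<pi> i). \<phi> (i, c))(c := u)))"
  proof (rule multilinear_forms_linear[OF T[OF ic(2), unfolded tensor_power_def] _ ic(3)])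
    show "(\<lambda>c\<in>cells (\<pi> i). \<phi> (i, c)) \<in> Pi\<^sub>E (cells (\<pi> i)) (\<lambda>_. dual_space scale (V i))"
      using \<phi> ic(2) by fastforce
  qed
  have *: "outer_product scale I V \<pi> T (\<phi>(k := u)) = T i ((\<lambda>c\<in>cells (\<pi> i). \<phi> (i, c))(c := u)) *
      (\<Prod>l\<in>I - {i}. T l (\<lambda>c\<in>cells (\<pi> l). \<phi> (l, c)))"
    if u: "u \<in> dual_space scale (V i)" for u
  proof -
    have "(\<lambda>c\<in>cells (\<pi> i). (\<phi>(k := u)) (i, c)) = (\<lambda>c\<in>cells (\<pi> i). \<phi> (i, c))(c := u)"
      using ic by (auto simp: fun_eq_iff)
    moreover have "\<phi>(k := u) \<in> Pi\<^sub>E slots (\<lambda>k. dual_space scale (V (fst k)))"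
      using PiE_upd[OF \<phi> k] u ic by simp
    moreover have "(\<Prod>l\<in>I - {i}. T l (\<lambda>c\<in>cells (\<pi> l). (\<phi>(k := u)) (l, c))) =
      (\<Prod>l\<in>I - {i}. T l (\<lambda>c\<in>cells (\<pi> l). \<phi> (l, c)))"
      using ic by (intro prod.cong) auto
    ultimately show ?thesis
      using prod.remove[OF finite_slots ic(2), of "\<lambda>l. T l (\<lambda>c\<in>cells (\<pi> l). (\<phi>(k := u)) (l, c))"]
      by (simp add: outer_product_def covectors_eq)
  qed
  have "linear_on fscale (*) (dual_space scale (V i)) (\<lambda>u. outer_product scale I V \<pi> T (\<phi>(k := u)))"
    using lin fs.subspace_add[OF subspace_dual_space[of scale "V i"]]
      fs.subspace_scale[OF subspace_dual_space[of scale "V i"]]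
    unfolding linear_on_def by (simp add: * algebra_simps del: fun_upd_apply)
  then show "linear_on fscale (*) (dual_space scale (V (fst k))) (\<lambda>u. outer_product scale I V \<pi> T (\<phi>(k := u)))"
    by (simp add: ic(1))
qed (simp add: outer_product_def covectors_eq)

lemma schur_tensor_tensors: "schur_tensor scale I V \<pi> \<subseteq> slots.tensors"
  unfolding schur_tensor_def
  by (intro fs.span_minimal subspace_multilinear_forms)
    (auto intro!: outer_product_tensor schur_module_tensor_power)

text \<open>With all \<open>As j\<close> equal, this is the \<open>d\<close>-th tensor power of a
  form, its arguments sorted by cells. Distinct forms are allowed so that the contraction is the
  diagonal of a \<open>d\<close>-linear form, as \<open>hom_polys\<close> demands, and can be
  expanded along pencils.\<close>

definition power_form :: "(nat \<Rightarrow> ('i \<Rightarrow> 'a) \<Rightarrow> complex) \<Rightarrow> ('i \<times> nat \<times> nat \<Rightarrow> 'a) \<Rightarrow> complex" where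
  "power_form As v = (if v \<in> Pi\<^sub>E slots (\<lambda>k. V (fst k))
     then \<Prod>j<d. As j (\<lambda>i\<in>I. v (i, \<gamma> i j)) else 0)"

lemma power_form_forms:
  assumes As: "\<And>j. j < d \<Longrightarrow> As j \<in> forms"
  shows "power_form As \<in> slots.forms"
proof (rule multilinear_formsI)
  fix v k assume v: "v \<in> Pi\<^sub>E slots (\<lambda>k. V (fst k))" and k: "k \<in> slots"
  obtain i c where ic: "k = (i, c)" "i \<in> I" "c \<in> cells (\<pi> i)" using k by auto
  define j where "j = label i c"
  have j: "j < d" "\<gamma> i j = c" using ic label_less by (auto simp: j_def)
  let ?x = "\<lambda>l. \<lambda>i\<in>I. v (i, \<gamma> i l)"
  have x: "?x l \<in> Pi\<^sub>E I V" if "l < d" for l using v that by fastforce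
  have *: "power_form As (v(k := u)) = As j ((?x j)(i := u)) * (\<Prod>l\<in>{..<d} - {j}. As l (?x l))"
    if u: "u \<in> V i" for u
  proof -
    have "(\<lambda>a\<in>I. (v(k := u)) (a, \<gamma> a j)) = (?x j)(i := u)"
      using ic j by (auto simp: fun_eq_iff)
    moreover have "(\<lambda>a\<in>I. (v(k := u)) (a, \<gamma> a l)) = ?x l" if "l \<in> {..<d} - {j}" for l
    proof -
      have "label i (\<gamma> i l) = l" using that ic by simp
      then have "\<gamma> i l \<noteq> c" using that j_def by auto
      then show ?thesis using ic by (auto simp: fun_eq_iff)
    qed
    moreover have "v(k := u) \<in> Pi\<^sub>E slots (\<lambda>k. V (fst k))"
      using PiE_upd[OF v k] u ic by simp
    ultimately show ?thesis
      using prod.remove[of "{..<d}" j "\<lambda>l. As l (\<lambda>a\<in>I. (v(k := u)) (a, \<gamma> a l))"] j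
      by (simp add: power_form_def)
  qed
  have "linear_on scale (*) (V i) (\<lambda>u. As j ((?x j)(i := u)))"
    by (rule multilinear_forms_linear[OF As[OF j(1)] x[OF j(1)] ic(2)])
  then have "linear_on scale (*) (V i) (\<lambda>u. power_form As (v(k := u)))"
    using subspace_add[OF subspace_planes[OF ic(2)]] subspace_scale[OF subspace_planes[OF ic(2)]]
    unfolding linear_on_def by (simp add: * algebra_simps del: fun_upd_apply)
  then show "linear_on scale (*) (V (fst k)) (\<lambda>u. power_form As (v(k := u)))"
    by (simp add: ic(1))
qed (simp add: power_form_def)

definition contraction where
  "contraction T As = slots.pairing (\<lambda>k. E (fst k)) (\<lambda>k. D (fst k)) T (power_form As)"

definition contraction_poly where
  "contraction_poly T = (\<lambda>A. if A \<in> forms then contraction T (\<lambda>_. A) else 0)"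

lemma contraction_multilinear:
  "(\<lambda>As. if As \<in> Pi\<^sub>E {..<d} (\<lambda>_. forms) then contraction T As else 0)
    \<in> multilinear_forms fscale {..<d} (\<lambda>_. forms)"
proof -
  let ?R = "\<lambda>N. rank_one {..<d} (\<lambda>_. forms)
    (\<lambda>j A. if A \<in> forms then A (\<lambda>i\<in>I. E i ((i, \<gamma> i j) \<in> N)) else 0)"
  have R: "?R N \<in> multilinear_forms fscale {..<d} (\<lambda>_. forms)" for N
    using evaluation_dual
    by (intro rank_one_multilinear[OF vector_space_fscale]) (auto intro: subspace_multilinear_forms)
  have "slots.coord (\<lambda>k. E (fst k)) (power_form As) N = ?R N As" if "As \<in> Pi\<^sub>E {..<d} (\<lambda>_. forms)" for As N
  proof -
    have "(\<lambda>k\<in>slots. E (fst k) (k \<in> N)) \<in> Pi\<^sub>E slots (\<lambda>k. V (fst k))"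
      using basesD(1)[OF ref_bases] by auto
    moreover have "(\<lambda>i\<in>I. (\<lambda>k\<in>slots. E (fst k) (k \<in> N)) (i, \<gamma> i j)) = (\<lambda>i\<in>I. E i ((i, \<gamma> i j) \<in> N))"
      if "j < d" for j using that by (auto simp: fun_eq_iff)
    ultimately show ?thesis
      using that by (auto simp: slots.coord_def power_form_def rank_one_def intro!: prod.cong)
  qed
  then have "(\<lambda>As. if As \<in> Pi\<^sub>E {..<d} (\<lambda>_. forms) then contraction T As else 0) =
      (\<Sum>N\<in>Pow slots. fscale (slots.coord (\<lambda>k. D (fst k)) T N) (?R N))"
    by (auto simp: fun_eq_iff sum_fun_apply contraction_def slots.pairing_def rank_one_def)
  also have "\<dots> \<in> multilinear_forms fscale {..<d} (\<lambda>_. forms)"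
    by (intro fs.subspace_sum fs.subspace_scale subspace_multilinear_forms R)
  finally show ?thesis .
qed

lemma contraction_poly_restrict:
  assumes "A \<in> forms"
  shows "contraction_poly T A = contraction T (\<lambda>j\<in>{..<d}. A)"
proof -
  have "power_form (\<lambda>_. A) = power_form (\<lambda>j\<in>{..<d}. A)" by (auto simp: power_form_def fun_eq_iff)
  then show ?thesis using assms by (simp add: contraction_poly_def contraction_def)
qed

lemma contraction_poly_hom_poly: "contraction_poly T \<in> hom_polys fscale forms d"
proof -
  define B where "B = (\<lambda>As. if As \<in> Pi\<^sub>E {..<d} (\<lambda>_. forms) then contraction T As else 0)"
  have "contraction_poly T = (\<lambda>A. if A \<in> forms then B (\<lambda>j\<in>{..<d}. A) else 0)"
    using contraction_poly_restrict[of _ T] by (auto simp: B_def contraction_poly_def)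
  moreover have "B \<in> multilinear_forms fscale {..<d} (\<lambda>_. forms)"
    unfolding B_def by (rule contraction_multilinear)
  ultimately show ?thesis unfolding hom_polys_def by blast
qed

section \<open>Equivariance of the contraction and stability of the Schur tensors\<close>

lemma GL_prodD:
  assumes "g \<in> GL_prod scale I V" "i \<in> I"
  shows "linear_on scale scale (V i) (g i)" "g i ` V i = V i"
  using assms by (auto simp: GL_prod_def GL_def bij_betw_def PiE_iff)

lemma pullback_dual:
  assumes "linear_on scale scale (V i) g" "g ` V i \<subseteq> V i" "i \<in> I" "\<phi> \<in> dual_space scale (V i)"
  shows "(\<lambda>v. if v \<in> V i then \<phi> (g v) else 0) \<in> dual_space scale (V i)"
  using dual_space_linear[OF assms(4)] assms subspace_planes[OF assms(3)]
  by (intro dual_spaceI) (auto simp: linear_on_def subspace_add subspace_scale image_subset_iff)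

lemma pullback_form:
  assumes A: "A \<in> forms" and g: "\<And>i. i \<in> I \<Longrightarrow> linear_on scale scale (V i) (g i)"
    "\<And>i. i \<in> I \<Longrightarrow> g i ` V i \<subseteq> V i"
  shows "(\<lambda>x. if x \<in> Pi\<^sub>E I V then A (\<lambda>i\<in>I. g i (x i)) else 0) \<in> forms"
proof (rule multilinear_formsI)
  fix x i assume x: "x \<in> Pi\<^sub>E I V" and i: "i \<in> I"
  have "(\<lambda>a\<in>I. g a (x a)) \<in> Pi\<^sub>E I V" using x g(2) by (auto simp: image_subset_iff)
  from multilinear_forms_linear[OF A this i]
  have lin: "linear_on scale (*) (V i) (\<lambda>u. A ((\<lambda>a\<in>I. g a (x a))(i := u)))" .
  have "(\<lambda>a\<in>I. g a ((x(i := u)) a)) = (\<lambda>a\<in>I. g a (x a))(i := g i u)" for u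
    using i by (auto simp: fun_eq_iff)
  then show "linear_on scale (*) (V i) (\<lambda>u. if x(i := u) \<in> Pi\<^sub>E I V then A (\<lambda>a\<in>I. g a ((x(i := u)) a)) else 0)"
    using lin g[OF i] PiE_upd[OF x i] subspace_add[OF subspace_planes[OF i]] subspace_scale[OF subspace_planes[OF i]]
    unfolding linear_on_def by (simp add: image_subset_iff del: fun_upd_apply)
qed simp

text \<open>The group acts on tensors by pulling back covectors and on polynomials by pulling back
  forms; \<open>pairing_adjoint\<close> carries it from one argument to the other, with
  \<open>g i\<close> in every cell of factor \<open>i\<close>.\<close>

lemma contraction_poly_equivariant:
  assumes g: "g \<in> GL_prod scale I V" and T: "T \<in> slots.tensors"
  shows "contraction_poly (act_tensor scale I V \<pi> g T) = act_poly scale I V g (contraction_poly T)"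
proof
  fix A
  show "contraction_poly (act_tensor scale I V \<pi> g T) A = act_poly scale I V g (contraction_poly T) A"
  proof (cases "A \<in> forms")
    case True
    define A' where "A' = (\<lambda>x. if x \<in> Pi\<^sub>E I V then A (\<lambda>i\<in>I. g i (x i)) else 0)"
    have A': "A' \<in> forms" unfolding A'_def by (rule pullback_form[OF True]) (use GL_prodD[OF g] in auto)
    have "contraction (act_tensor scale I V \<pi> g T) (\<lambda>_. A) = contraction T (\<lambda>_. A')"
      unfolding contraction_def
    proof (rule slots.pairing_adjoint[OF slot_bases T, of _ "\<lambda>k. g (fst k)"])
      show "power_form (\<lambda>_. A) \<in> slots.forms" using True by (intro power_form_forms)
      fix k assume "k \<in> slots"
      then have "fst k \<in> I" by auto
      from GL_prodD[OF g this]
      show "linear_on scale scale (V (fst k)) (g (fst k))" "g (fst k) ` V (fst k) \<subseteq> V (fst k)"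
        by simp_all
    next
      fix \<phi> assume "\<phi> \<in> Pi\<^sub>E slots (\<lambda>k. dual_space scale (V (fst k)))"
      moreover have "(\<lambda>(i, c)\<in>slots. \<lambda>v. if v \<in> V i then \<phi> (i, c) (g i v) else 0) =
        (\<lambda>k\<in>slots. \<lambda>v. if v \<in> V (fst k) then \<phi> k (g (fst k) v) else 0)"
        by (auto simp: fun_eq_iff)
      ultimately show "act_tensor scale I V \<pi> g T \<phi> =
        T (\<lambda>k\<in>slots. \<lambda>v. if v \<in> V (fst k) then \<phi> k (g (fst k) v) else 0)"
        by (simp add: act_tensor_def covectors_eq)
    next
      fix v assume v: "v \<in> Pi\<^sub>E slots (\<lambda>k. V (fst k))"
      have "(\<lambda>k\<in>slots. g (fst k) (v k)) \<in> Pi\<^sub>E slots (\<lambda>k. V (fst k))"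
        using v GL_prodD(2)[OF g] by fastforce
      moreover have "A' (\<lambda>i\<in>I. v (i, \<gamma> i j)) = A (\<lambda>i\<in>I. (\<lambda>k\<in>slots. g (fst k) (v k)) (i, \<gamma> i j))"
        if "j < d" for j
      proof -
        have "(\<lambda>i\<in>I. v (i, \<gamma> i j)) \<in> Pi\<^sub>E I V" using v that by fastforce
        moreover have "(\<lambda>i\<in>I. g i ((\<lambda>i\<in>I. v (i, \<gamma> i j)) i)) = (\<lambda>i\<in>I. (\<lambda>k\<in>slots. g (fst k) (v k)) (i, \<gamma> i j))"
          using that by (auto simp: fun_eq_iff)
        ultimately show ?thesis by (simp add: A'_def)
      qed
      ultimately show "power_form (\<lambda>_. A') v = power_form (\<lambda>_. A) (\<lambda>k\<in>slots. g (fst k) (v k))"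
        using v by (simp add: power_form_def)
    qed
    then show ?thesis
      using True A' by (simp add: contraction_poly_def act_poly_def A'_def)
  next
    case False
    then show ?thesis by (simp add: contraction_poly_def act_poly_def)
  qed
qed

lemma tensor_power_pullback:
  assumes T: "T \<in> tensor_power scale C (V i)" and i: "i \<in> I"
    and g: "linear_on scale scale (V i) g" "g ` V i \<subseteq> V i"
  shows "(\<lambda>\<phi>. if \<phi> \<in> Pi\<^sub>E C (\<lambda>_. dual_space scale (V i))
      then T (\<lambda>c\<in>C. \<lambda>v. if v \<in> V i then \<phi> c (g v) else 0) else 0) \<in> tensor_power scale C (V i)"
  unfolding tensor_power_def
proof (rule multilinear_formsI)
  let ?g = "\<lambda>u v. if v \<in> V i then u (g v) else 0"
  fix \<phi> c assume \<phi>: "\<phi> \<in> Pi\<^sub>E C (\<lambda>_. dual_space scale (V i))" and c: "c \<in> C"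
  note pb = pullback_dual[OF g i]
  have "(\<lambda>c\<in>C. ?g (\<phi> c)) \<in> Pi\<^sub>E C (\<lambda>_. dual_space scale (V i))" using \<phi> pb by auto
  from multilinear_forms_linear[OF T[unfolded tensor_power_def] this c]
  have lin: "linear_on fscale (*) (dual_space scale (V i)) (\<lambda>u. T ((\<lambda>c\<in>C. ?g (\<phi> c))(c := u)))" .
  have *: "(\<lambda>a\<in>C. ?g ((\<phi>(c := u)) a)) = (\<lambda>c\<in>C. ?g (\<phi> c))(c := ?g u)" for u
    using c by (auto simp: fun_eq_iff)
  have g: "?g (u + w) = ?g u + ?g w" "?g (fscale a u) = fscale a (?g u)" for u w a
    by (auto simp: fun_eq_iff)
  show "linear_on fscale (*) (dual_space scale (V i)) (\<lambda>u. if \<phi>(c := u) \<in> Pi\<^sub>E C (\<lambda>_. dual_space scale (V i))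
      then T (\<lambda>a\<in>C. ?g ((\<phi>(c := u)) a)) else 0)"
    unfolding linear_on_def *
  proof (intro conjI ballI allI)
    fix u w assume u: "u \<in> dual_space scale (V i)" "w \<in> dual_space scale (V i)"
    have "u + w \<in> dual_space scale (V i)" using u fs.subspace_add[OF subspace_dual_space] by blast
    then show "(if \<phi>(c := u + w) \<in> Pi\<^sub>E C (\<lambda>_. dual_space scale (V i)) then T ((\<lambda>c\<in>C. ?g (\<phi> c))(c := ?g (u + w))) else 0) =
      (if \<phi>(c := u) \<in> Pi\<^sub>E C (\<lambda>_. dual_space scale (V i)) then T ((\<lambda>c\<in>C. ?g (\<phi> c))(c := ?g u)) else 0) +
      (if \<phi>(c := w) \<in> Pi\<^sub>E C (\<lambda>_. dual_space scale (V i)) then T ((\<lambda>c\<in>C. ?g (\<phi> c))(c := ?g w)) else 0)"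
      using PiE_upd[OF \<phi> c] u linear_on_add[OF lin pb pb] unfolding g by (simp del: fun_upd_apply)
  next
    fix a u assume u: "u \<in> dual_space scale (V i)"
    have "fscale a u \<in> dual_space scale (V i)" using u fs.subspace_scale[OF subspace_dual_space] by blast
    then show "(if \<phi>(c := fscale a u) \<in> Pi\<^sub>E C (\<lambda>_. dual_space scale (V i)) then T ((\<lambda>c\<in>C. ?g (\<phi> c))(c := ?g (fscale a u))) else 0) =
      a * (if \<phi>(c := u) \<in> Pi\<^sub>E C (\<lambda>_. dual_space scale (V i)) then T ((\<lambda>c\<in>C. ?g (\<phi> c))(c := ?g u)) else 0)"
      using PiE_upd[OF \<phi> c] u linear_on_scale[OF lin pb] unfolding g by (simp del: fun_upd_apply)
  qed
qed auto

text \<open>The pullback treats all slots alike, so it commutes with permuting them and hence with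
  the Young symmetrizer.\<close>

lemma schur_module_pullback:
  assumes T: "T \<in> schur_module scale \<mu> (V i)" and i: "i \<in> I"
    and g: "linear_on scale scale (V i) g" "g ` V i \<subseteq> V i"
  shows "(\<lambda>\<phi>. if \<phi> \<in> Pi\<^sub>E (cells \<mu>) (\<lambda>_. dual_space scale (V i))
      then T (\<lambda>c\<in>cells \<mu>. \<lambda>v. if v \<in> V i then \<phi> c (g v) else 0) else 0) \<in> schur_module scale \<mu> (V i)"
proof -
  let ?g = "\<lambda>T \<phi>. if \<phi> \<in> Pi\<^sub>E (cells \<mu>) (\<lambda>_. dual_space scale (V i))
      then T (\<lambda>c\<in>cells \<mu>. \<lambda>v. if v \<in> V i then \<phi> c (g v) else 0) else 0"
  obtain S where S: "S \<in> tensor_power scale (cells \<mu>) (V i)" and TS: "T = young_symmetrizer \<mu> S"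
    using T by (auto simp: schur_module_def)
  have "?g T = young_symmetrizer \<mu> (?g S)"
  proof
    fix \<phi>
    have "S ((\<lambda>c\<in>cells \<mu>. \<lambda>v. if v \<in> V i then \<phi> c (g v) else 0) \<circ> \<sigma> \<circ> \<tau>) =
        S (\<lambda>c\<in>cells \<mu>. \<lambda>v. if v \<in> V i then (\<phi> \<circ> \<sigma> \<circ> \<tau>) c (g v) else 0)"
      and "\<phi> \<circ> \<sigma> \<circ> \<tau> \<in> Pi\<^sub>E (cells \<mu>) (\<lambda>_. dual_space scale (V i)) \<longleftrightarrow>
        \<phi> \<in> Pi\<^sub>E (cells \<mu>) (\<lambda>_. dual_space scale (V i))"
      if "\<sigma> \<in> row_group \<mu>" "\<tau> \<in> col_group \<mu>" for \<sigma> \<tau>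
    proof -
      have p: "\<sigma> \<circ> \<tau> permutes cells \<mu>"
        using that by (auto simp: row_group_def col_group_def intro: permutes_compose)
      show "S ((\<lambda>c\<in>cells \<mu>. \<lambda>v. if v \<in> V i then \<phi> c (g v) else 0) \<circ> \<sigma> \<circ> \<tau>) =
        S (\<lambda>c\<in>cells \<mu>. \<lambda>v. if v \<in> V i then (\<phi> \<circ> \<sigma> \<circ> \<tau>) c (g v) else 0)"
        using permutes_in_image[OF p] by (intro arg_cong[of _ _ S]) (auto simp: fun_eq_iff)
      show "\<phi> \<circ> \<sigma> \<circ> \<tau> \<in> Pi\<^sub>E (cells \<mu>) (\<lambda>_. dual_space scale (V i)) \<longleftrightarrow>
        \<phi> \<in> Pi\<^sub>E (cells \<mu>) (\<lambda>_. dual_space scale (V i))"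
        using permute_PiE_iff[OF p] by (simp add: o_assoc)
    qed
    then show "?g T \<phi> = young_symmetrizer \<mu> (?g S) \<phi>"
      unfolding TS young_symmetrizer_def
      by (auto intro!: sum.cong sum.neutral[symmetric])
  qed
  moreover have "?g S \<in> tensor_power scale (cells \<mu>) (V i)"
    by (rule tensor_power_pullback[OF S i g])
  ultimately show ?thesis unfolding schur_module_def by blast
qed

lemma act_tensor_linear:
  "act_tensor scale I V \<pi> g (T + T') = act_tensor scale I V \<pi> g T + act_tensor scale I V \<pi> g T'"
  "act_tensor scale I V \<pi> g (fscale c T) = fscale c (act_tensor scale I V \<pi> g T)"
  "act_tensor scale I V \<pi> g 0 = 0"
  by (auto simp: act_tensor_def fun_eq_iff)

lemma schur_tensor_act:
  assumes g: "g \<in> GL_prod scale I V" and T: "T \<in> schur_tensor scale I V \<pi>"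
  shows "act_tensor scale I V \<pi> g T \<in> schur_tensor scale I V \<pi>"
  using T unfolding schur_tensor_def
proof (induction rule: fs.span_induct_alt)
  case base
  show ?case unfolding act_tensor_linear(3) by (rule fs.span_zero)
next
  case (step c T S)
  then obtain Ti where Ti: "\<And>i. i \<in> I \<Longrightarrow> Ti i \<in> schur_module scale (\<pi> i) (V i)"
    and T: "T = outer_product scale I V \<pi> Ti" by auto
  let ?Ti = "\<lambda>i \<phi>. if \<phi> \<in> Pi\<^sub>E (cells (\<pi> i)) (\<lambda>_. dual_space scale (V i))
      then Ti i (\<lambda>c\<in>cells (\<pi> i). \<lambda>v. if v \<in> V i then \<phi> c (g i v) else 0) else 0"
  have "act_tensor scale I V \<pi> g T = outer_product scale I V \<pi> ?Ti"
  proof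
    fix \<phi>
    show "act_tensor scale I V \<pi> g T \<phi> = outer_product scale I V \<pi> ?Ti \<phi>"
    proof (cases "\<phi> \<in> covectors scale I V \<pi>")
      case True
      let ?\<psi> = "\<lambda>(i, c)\<in>slots. \<lambda>v. if v \<in> V i then \<phi> (i, c) (g i v) else 0"
      have "?\<psi> \<in> covectors scale I V \<pi>"
        using True pullback_dual[OF GL_prodD(1)[OF g] equalityD1[OF GL_prodD(2)[OF g]]]
        by (fastforce simp: covectors_def)
      moreover have "(\<lambda>c\<in>cells (\<pi> i). ?\<psi> (i, c)) =
          (\<lambda>c\<in>cells (\<pi> i). \<lambda>v. if v \<in> V i then (\<lambda>c\<in>cells (\<pi> i). \<phi> (i, c)) c (g i v) else 0)"
        and "(\<lambda>c\<in>cells (\<pi> i). \<phi> (i, c)) \<in> Pi\<^sub>E (cells (\<pi> i)) (\<lambda>_. dual_space scale (V i))" if "i \<in> I" for i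
        using that True by (auto simp: fun_eq_iff covectors_def)
      ultimately show ?thesis
        using True by (simp add: act_tensor_def T outer_product_def)
    next
      case False
      then show ?thesis by (simp add: act_tensor_def outer_product_def)
    qed
  qed
  moreover have "?Ti i \<in> schur_module scale (\<pi> i) (V i)" if "i \<in> I" for i
    using schur_module_pullback[OF Ti[OF that] that] GL_prodD[OF g that] by simp
  ultimately have "act_tensor scale I V \<pi> g T \<in>
      fs.span {outer_product scale I V \<pi> T |T. \<forall>i\<in>I. T i \<in> schur_module scale (\<pi> i) (V i)}"
    by (intro fs.span_base) blast
  then show ?case
    unfolding act_tensor_linear using step.IH by (intro fs.span_add fs.span_scale)
qed

lemma contraction_poly_linear:
  "contraction_poly (T + T') = contraction_poly T + contraction_poly T'"
  "contraction_poly (fscale c T) = fscale c (contraction_poly T)"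
  by (auto simp: contraction_poly_def contraction_def slots.pairing_def slots.coord_def fun_eq_iff
      algebra_simps sum.distrib sum_distrib_left)

text \<open>Given injectivity, the image of the Schur tensors is itself one of the submodules whose
  sum is the isotypic component; the contraction is the required isomorphism.\<close>

lemma contraction_poly_isotypic:
  assumes inj: "\<And>T. T \<in> schur_tensor scale I V \<pi> \<Longrightarrow> contraction_poly T = 0 \<Longrightarrow> T = 0"
    and T: "T \<in> schur_tensor scale I V \<pi>"
  shows "contraction_poly T \<in> isotypic_component scale I V d \<pi>"
proof -
  let ?M = "schur_tensor scale I V \<pi>"
  let ?N = "contraction_poly ` ?M"
  have M: "fs.subspace ?M" unfolding schur_tensor_def by (rule fs.subspace_span)
  have "inj_on contraction_poly ?M"
  proof (rule inj_onI)
    fix S S' assume S: "S \<in> ?M" "S' \<in> ?M" and eq: "contraction_poly S = contraction_poly S'"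
    have "contraction_poly (S + fscale (-1) S') = contraction_poly S + fscale (-1) (contraction_poly S')"
      by (simp only: contraction_poly_linear)
    also have "\<dots> = 0" by (simp add: eq fun_eq_iff)
    finally have "S + fscale (-1) S' = 0"
      by (intro inj fs.subspace_add[OF M] fs.subspace_scale[OF M] S)
    then show "S = S'" by (simp add: fun_eq_iff)
  qed
  then have "bij_betw contraction_poly ?M ?N" by (simp add: bij_betw_def)
  moreover have eqv: "contraction_poly (act_tensor scale I V \<pi> g S) = act_poly scale I V g (contraction_poly S)"
    if "g \<in> GL_prod scale I V" "S \<in> ?M" for g S
    using contraction_poly_equivariant that schur_tensor_tensors by blast
  ultimately have "module_isomorphic fscale fscale (GL_prod scale I V) (act_tensor scale I V \<pi>)
      (act_poly scale I V) ?M ?N"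
    unfolding module_isomorphic_def linear_on_def using contraction_poly_linear by blast
  moreover have "submodule fscale (GL_prod scale I V) (act_poly scale I V) ?N (hom_polys fscale forms d)"
    unfolding submodule_def
  proof (intro conjI ballI)
    show "?N \<subseteq> hom_polys fscale forms d" using contraction_poly_hom_poly by auto
    show "fs.subspace ?N"
    proof (rule fs.subspaceI)
      have "contraction_poly 0 = 0"
        using contraction_poly_linear(2)[of 0 0] by simp
      then show "0 \<in> ?N" using fs.subspace_0[OF M] by force
    next
      fix x y assume "x \<in> ?N" "y \<in> ?N"
      then show "x + y \<in> ?N"
        using fs.subspace_add[OF M] by (auto simp: contraction_poly_linear(1)[symmetric])
    next
      fix c x assume "x \<in> ?N"
      then show "fscale c x \<in> ?N"
        using fs.subspace_scale[OF M] by (auto simp: contraction_poly_linear(2)[symmetric])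
    qed
    fix g x assume "g \<in> GL_prod scale I V" "x \<in> ?N"
    then show "act_poly scale I V g x \<in> ?N"
      using eqv schur_tensor_act by (auto simp: image_iff) metis
  qed
  ultimately show ?thesis
    unfolding isotypic_component_def using T by (intro fs.span_base) blast
qed

text \<open>The polynomial of \<open>T\<close> is restricted to \<open>A False + t A True\<close>
  with decomposable forms. Contracting with decomposable forms evaluates \<open>T\<close>, and
  \<open>P\<close> is the set of copies that take \<open>A True\<close>, so the coefficient of
  \<open>t ^ r\<close> collects the sets of size \<open>r\<close>.\<close>

lemma contraction_poly_pencil:
  assumes T: "T \<in> slots.tensors" and z: "contraction_poly T = 0"
    and f: "\<And>i b. i \<in> I \<Longrightarrow> f i b \<in> dual_space scale (V i)"
  shows "(\<Sum>P\<in>{P \<in> Pow {..<d}. card P = r}. T (\<lambda>(i, c)\<in>slots. f i (label i c \<in> P))) = 0"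
proof (rule sum_power_coeff_zero)
  fix t :: complex
  define A where "A = (\<lambda>b. rank_one I V (\<lambda>i. f i b))"
  have A: "A b \<in> forms" for b unfolding A_def using f by (intro rank_one_forms)
  let ?B = "\<lambda>As. if As \<in> Pi\<^sub>E {..<d} (\<lambda>_. forms) then contraction T As else 0"
  have AA: "A False + fscale t (A True) \<in> forms"
    using A by (simp add: fs.subspace_add[OF subspace_multilinear_forms] fs.subspace_scale[OF subspace_multilinear_forms])
  have "0 = contraction_poly T (A False + fscale t (A True))" by (simp add: z)
  also have "\<dots> = ?B (\<lambda>j\<in>{..<d}. A False + fscale t (A True))"
    using contraction_poly_restrict[OF AA] AA by simp
  also have "\<dots> = (\<Sum>P\<in>Pow {..<d}. t ^ card P * ?B (\<lambda>j\<in>{..<d}. if j \<in> P then A True else A False))"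
    by (rule multilinear_pencil[OF contraction_multilinear vector_space_fscale])
      (auto intro: A subspace_multilinear_forms)
  also have "\<dots> = (\<Sum>P\<in>Pow {..<d}. t ^ card P * T (\<lambda>(i, c)\<in>slots. f i (label i c \<in> P)))"
  proof (intro sum.cong refl arg_cong2[of _ _ _ _ "(*)"])
    fix P assume "P \<in> Pow {..<d}"
    have "contraction T (\<lambda>j\<in>{..<d}. if j \<in> P then A True else A False) = T (\<lambda>(i, c)\<in>slots. f i (label i c \<in> P))"
      unfolding contraction_def
    proof (rule slots.pairing_rank_one[OF slot_bases T])
      show "(\<lambda>(i, c)\<in>slots. f i (label i c \<in> P)) \<in> Pi\<^sub>E slots (\<lambda>k. dual_space scale (V (fst k)))"
        using f by auto
      fix v assume v: "v \<in> Pi\<^sub>E slots (\<lambda>k. V (fst k))"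
      then have v': "(\<lambda>i\<in>I. v (i, \<gamma> i j)) \<in> Pi\<^sub>E I V" if "j < d" for j using that by fastforce
      have "power_form (\<lambda>j\<in>{..<d}. if j \<in> P then A True else A False) v =
          (\<Prod>j<d. \<Prod>i\<in>I. f i (j \<in> P) (v (i, \<gamma> i j)))"
        using v v' by (auto simp: power_form_def A_def rank_one_def intro!: prod.cong)
      also have "\<dots> = (\<Prod>k\<in>slots. (\<lambda>(i, c)\<in>slots. f i (label i c \<in> P)) k (v k))"
        unfolding prod_slots by (intro prod.cong refl) simp
      finally show "power_form (\<lambda>j\<in>{..<d}. if j \<in> P then A True else A False) v =
          (\<Prod>k\<in>slots. (\<lambda>(i, c)\<in>slots. f i (label i c \<in> P)) k (v k))" .
    qed
    moreover have "(\<lambda>j\<in>{..<d}. if j \<in> P then A True else A False) \<in> Pi\<^sub>E {..<d} (\<lambda>_. forms)" using A by auto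
    ultimately show "?B (\<lambda>j\<in>{..<d}. if j \<in> P then A True else A False) = T (\<lambda>(i, c)\<in>slots. f i (label i c \<in> P))"
      by simp
  qed
  finally show "(\<Sum>P\<in>Pow {..<d}. t ^ card P * T (\<lambda>(i, c)\<in>slots. f i (label i c \<in> P))) = 0" by simp
qed simp

text \<open>Turns a Schur tensor given by decomposable ones into an explicit polynomial in the
  values of \<open>A\<close>: \<open>P i\<close> is the set of copies in which factor
  \<open>i\<close> receives \<open>y i True\<close>, and expanding the product over the factors lets
  these sets vary independently.\<close>

lemma contraction_poly_outer_product:
  assumes T: "\<And>i \<phi>. i \<in> I \<Longrightarrow> \<phi> \<in> Pi\<^sub>E (cells (\<pi> i)) (\<lambda>_. dual_space scale (V i)) \<Longrightarrow>
      T i \<phi> = (\<Sum>P\<in>Q i. w i P * (\<Prod>j<d. \<phi> (\<gamma> i j) (y i (j \<in> P))))"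
    and Q: "\<And>i. i \<in> I \<Longrightarrow> finite (Q i)" and y: "\<And>i b. i \<in> I \<Longrightarrow> y i b \<in> V i" and A: "A \<in> forms"
  shows "contraction_poly (outer_product scale I V \<pi> T) A =
    (\<Sum>P\<in>Pi\<^sub>E I Q. (\<Prod>i\<in>I. w i (P i)) * (\<Prod>j<d. A (\<lambda>i\<in>I. y i (j \<in> P i))))"
proof -
  let ?v = "\<lambda>P. \<lambda>(i, c)\<in>slots. y i (label i c \<in> P i)"
  let ?e = "\<lambda>P \<phi>. \<Prod>k\<in>slots. \<phi> k (?v P k)"
  have outer: "outer_product scale I V \<pi> T \<phi> = (\<Sum>P\<in>Pi\<^sub>E I Q. (\<Prod>i\<in>I. w i (P i)) * ?e P \<phi>)"
    if \<phi>: "\<phi> \<in> Pi\<^sub>E slots (\<lambda>k. dual_space scale (V (fst k)))" for \<phi>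
  proof -
    have "T i (\<lambda>c\<in>cells (\<pi> i). \<phi> (i, c)) = (\<Sum>P\<in>Q i. w i P * (\<Prod>j<d. \<phi> (i, \<gamma> i j) (y i (j \<in> P))))"
      if i: "i \<in> I" for i
    proof -
      have "(\<lambda>c\<in>cells (\<pi> i). \<phi> (i, c)) \<in> Pi\<^sub>E (cells (\<pi> i)) (\<lambda>_. dual_space scale (V i))"
        using \<phi> i by fastforce
      from T[OF i this] show ?thesis using i by simp
    qed
    then have "outer_product scale I V \<pi> T \<phi> =
        (\<Prod>i\<in>I. \<Sum>P\<in>Q i. w i P * (\<Prod>j<d. \<phi> (i, \<gamma> i j) (y i (j \<in> P))))"
      using \<phi> by (simp add: outer_product_def covectors_eq)
    also have "\<dots> = (\<Sum>P\<in>Pi\<^sub>E I Q. \<Prod>i\<in>I. w i (P i) * (\<Prod>j<d. \<phi> (i, \<gamma> i j) (y i (j \<in> P i))))"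
      using finite_slots Q by (intro prod_sum_PiE) auto
    also have "\<dots> = (\<Sum>P\<in>Pi\<^sub>E I Q. (\<Prod>i\<in>I. w i (P i)) * ?e P \<phi>)"
    proof (intro sum.cong refl)
      fix P
      have "(\<Prod>i\<in>I. \<Prod>j<d. \<phi> (i, \<gamma> i j) (y i (j \<in> P i))) = ?e P \<phi>"
        unfolding prod_slots by (subst prod.swap) (intro prod.cong refl, simp)
      then show "(\<Prod>i\<in>I. w i (P i) * (\<Prod>j<d. \<phi> (i, \<gamma> i j) (y i (j \<in> P i)))) = (\<Prod>i\<in>I. w i (P i)) * ?e P \<phi>"
        by (simp add: prod.distrib)
    qed
    finally show ?thesis .
  qed
  have D: "(\<lambda>k\<in>slots. D (fst k) (k \<in> N)) \<in> Pi\<^sub>E slots (\<lambda>k. dual_space scale (V (fst k)))" for N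
    using basesD(2)[OF ref_bases] by auto
  have "contraction_poly (outer_product scale I V \<pi> T) A = (\<Sum>P\<in>Pi\<^sub>E I Q. (\<Prod>i\<in>I. w i (P i)) *
      slots.pairing (\<lambda>k. E (fst k)) (\<lambda>k. D (fst k)) (?e P) (power_form (\<lambda>_. A)))"
    using A by (simp add: contraction_poly_def contraction_def slots.pairing_def
        slots.coord_def outer[OF D] sum_distrib_left sum_distrib_right)
      (subst sum.swap, simp add: mult.assoc)
  also have "\<dots> = (\<Sum>P\<in>Pi\<^sub>E I Q. (\<Prod>i\<in>I. w i (P i)) * (\<Prod>j<d. A (\<lambda>i\<in>I. y i (j \<in> P i))))"
  proof (intro sum.cong refl arg_cong2[of _ _ _ _ "(*)"])
    fix P
    have v: "?v P \<in> Pi\<^sub>E slots (\<lambda>k. V (fst k))" using y by auto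
    have "slots.pairing (\<lambda>k. E (fst k)) (\<lambda>k. D (fst k)) (?e P) (power_form (\<lambda>_. A)) = power_form (\<lambda>_. A) (?v P)"
      by (rule slots.pairing_evaluation[OF slot_bases _ v]) (use A power_form_forms in auto)
    also have "\<dots> = (\<Prod>j<d. A (\<lambda>i\<in>I. ?v P (i, \<gamma> i j)))" using v by (simp add: power_form_def)
    also have "\<dots> = (\<Prod>j<d. A (\<lambda>i\<in>I. y i (j \<in> P i)))"
      by (intro prod.cong refl arg_cong[of _ _ A]) (auto simp: fun_eq_iff)
    finally show "slots.pairing (\<lambda>k. E (fst k)) (\<lambda>k. D (fst k)) (?e P) (power_form (\<lambda>_. A)) =
      (\<Prod>j<d. A (\<lambda>i\<in>I. y i (j \<in> P i)))" .
  qed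
  finally show ?thesis .
qed

end

section \<open>Young symmetrizers of small shapes\<close>

lemma row_group_compose: "\<sigma> \<in> row_group \<mu> \<Longrightarrow> \<sigma>' \<in> row_group \<mu> \<Longrightarrow> \<sigma> \<circ> \<sigma>' \<in> row_group \<mu>"
  by (auto simp: row_group_def permutes_compose permutes_in_image)

lemma row_group_inv:
  assumes "\<sigma> \<in> row_group \<mu>"
  shows "inv \<sigma> \<in> row_group \<mu>"
proof -
  have p: "\<sigma> permutes cells \<mu>" and r: "\<And>x. x \<in> cells \<mu> \<Longrightarrow> fst (\<sigma> x) = fst x"
    using assms by (auto simp: row_group_def)
  have "fst (inv \<sigma> x) = fst x" if "x \<in> cells \<mu>" for x
    using r[of "inv \<sigma> x"] that permutes_inverses(1)[OF p] permutes_in_image[OF permutes_inv[OF p]] by simp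
  then show ?thesis using permutes_inv[OF p] by (simp add: row_group_def)
qed

text \<open>The row symmetrizer is the outer sum, and reindexing it by left multiplication absorbs
  \<sigma>.\<close>

lemma schur_module_row_symmetric:
  assumes T: "T \<in> schur_module s \<mu> W" and \<sigma>: "\<sigma> \<in> row_group \<mu>"
  shows "T (\<phi> \<circ> \<sigma>) = T \<phi>"
proof -
  obtain S where S: "T = young_symmetrizer \<mu> S" using T by (auto simp: schur_module_def)
  have "bij \<sigma>" using \<sigma> by (auto simp: row_group_def permutes_bij)
  then have inv: "\<sigma> \<circ> (inv \<sigma> \<circ> \<sigma>') = \<sigma>'" "inv \<sigma> \<circ> (\<sigma> \<circ> \<sigma>') = \<sigma>'" for \<sigma>'
    by (auto simp: fun_eq_iff bij_is_inj bij_is_surj surj_f_inv_f)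
  have "bij_betw (\<lambda>\<sigma>'. \<sigma> \<circ> \<sigma>') (row_group \<mu>) (row_group \<mu>)"
    by (rule bij_betw_byWitness[where f' = "\<lambda>\<sigma>'. inv \<sigma> \<circ> \<sigma>'"])
      (use inv row_group_compose row_group_inv \<sigma> in auto)
  from sum.reindex_bij_betw[OF this, of "\<lambda>\<sigma>'. \<Sum>\<tau>\<in>col_group \<mu>. of_int (sign \<tau>) * S (\<phi> \<circ> \<sigma>' \<circ> \<tau>)"]
  show ?thesis by (simp add: S young_symmetrizer_def o_assoc)
qed

lemma transpose_row_group:
  "c \<in> cells \<mu> \<Longrightarrow> c' \<in> cells \<mu> \<Longrightarrow> fst c = fst c' \<Longrightarrow> transpose c c' \<in> row_group \<mu>"
  by (auto simp: row_group_def permutes_swap_id transpose_def)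

lemma cells_21: "cells [2, 1] = {(0, 0), (0, 1), (1, 0)}"
  by (auto simp: cells_def less_Suc_eq nth_Cons split: nat.splits)

lemmas cells_21_Suc = cells_21[unfolded One_nat_def]

lemma cells_22: "cells [2, 2] = {(0, 0), (0, 1), (1, 0), (1, 1)}"
  by (auto simp: cells_def less_Suc_eq nth_Cons split: nat.splits)

lemma cells_row: "cells [m, 0] = Pair 0 ` {..<m}"
  by (auto simp: cells_def less_Suc_eq nth_Cons split: nat.splits)

lemma permutes_eqI: "p permutes S \<Longrightarrow> q permutes S \<Longrightarrow> (\<And>x. x \<in> S \<Longrightarrow> p x = q x) \<Longrightarrow> p = q"
  by (metis ext permutes_not_in)

lemma permutes_pair:
  assumes p: "\<sigma> permutes {a, b, c}" and dist: "distinct [a, b, c]"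
    and ab: "\<sigma> a \<in> {a, b}" "\<sigma> b \<in> {a, b}"
  shows "\<sigma> \<in> {id, transpose a b}"
proof -
  have i: "\<sigma> c \<in> {a, b, c}" using permutes_in_image[OF p, of c] by simp
  have "\<sigma> a \<noteq> \<sigma> b" "\<sigma> c \<noteq> \<sigma> a" "\<sigma> c \<noteq> \<sigma> b" using permutes_inj[OF p] dist by (auto simp: inj_eq)
  then consider "\<sigma> a = a \<and> \<sigma> b = b \<and> \<sigma> c = c" | "\<sigma> a = b \<and> \<sigma> b = a \<and> \<sigma> c = c"
    using ab i dist by auto
  then show ?thesis
  proof cases
    case 1
    then have "\<sigma> = id" by (intro permutes_eqI[OF p permutes_id]) auto
    then show ?thesis by simp
  next
    case 2
    have "transpose a b permutes {a, b, c}" by (simp add: permutes_swap_id)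
    then have "\<sigma> = transpose a b"
      by (rule permutes_eqI[OF p]) (use 2 dist in \<open>auto simp: transpose_def\<close>)
    then show ?thesis by simp
  qed
qed

lemma row_group_21: "row_group [2, 1] = {id, transpose (0, 0) (0, 1)}"
proof (intro equalityI subsetI)
  fix \<sigma> assume "\<sigma> \<in> row_group [2, 1]"
  then have p: "\<sigma> permutes {(0, 0), (0, 1), (1, 0)}"
    and r: "\<And>x. x \<in> {(0, 0), (0, 1), (1, 0)} \<Longrightarrow> fst (\<sigma> x) = fst x"
    unfolding row_group_def cells_21 by auto
  show "\<sigma> \<in> {id, transpose (0, 0) (0, 1)}"
    using r[of "(0, 0)"] r[of "(0, 1)"] permutes_in_image[OF p, of "(0, 0)"] permutes_in_image[OF p, of "(0, 1)"]
    by (intro permutes_pair[OF p]) auto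
qed (unfold row_group_def cells_21, auto simp: permutes_id permutes_swap_id transpose_def)

lemma col_group_21: "col_group [2, 1] = {id, transpose (0, 0) (1, 0)}"
proof (intro equalityI subsetI)
  fix \<sigma> assume "\<sigma> \<in> col_group [2, 1]"
  then have p: "\<sigma> permutes {(0, 0), (1, 0), (0, 1)}"
    and r: "\<And>x. x \<in> {(0, 0), (0, 1), (1, 0)} \<Longrightarrow> snd (\<sigma> x) = snd x"
    unfolding col_group_def cells_21 by (auto simp: insert_commute)
  show "\<sigma> \<in> {id, transpose (0, 0) (1, 0)}"
    using r[of "(0, 0)"] r[of "(1, 0)"] permutes_in_image[OF p, of "(0, 0)"] permutes_in_image[OF p, of "(1, 0)"]
    by (intro permutes_pair[OF p]) auto
qed (unfold col_group_def cells_21, auto simp: permutes_id permutes_swap_id transpose_def)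

lemma permutes_two_pairs:
  assumes p: "\<sigma> permutes {a, b, c, d}" and dist: "distinct [a, b, c, d]"
    and ab: "\<sigma> a \<in> {a, b}" "\<sigma> b \<in> {a, b}" and cd: "\<sigma> c \<in> {c, d}" "\<sigma> d \<in> {c, d}"
  shows "\<sigma> \<in> {id, transpose a b, transpose c d, transpose a b \<circ> transpose c d}"
proof -
  have "\<sigma> a \<noteq> \<sigma> b" "\<sigma> c \<noteq> \<sigma> d" using permutes_inj[OF p] dist by (auto simp: inj_eq)
  then have ab': "\<sigma> a = a \<and> \<sigma> b = b \<or> \<sigma> a = b \<and> \<sigma> b = a"
    and cd': "\<sigma> c = c \<and> \<sigma> d = d \<or> \<sigma> c = d \<and> \<sigma> d = c"
    using ab cd by auto
  have q: "id permutes {a, b, c, d}" "transpose a b permutes {a, b, c, d}"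
      "transpose c d permutes {a, b, c, d}" "transpose a b \<circ> transpose c d permutes {a, b, c, d}"
    by (auto simp: permutes_id permutes_swap_id intro!: permutes_compose)
  note eq = q[THEN permutes_eqI[OF p]]
  consider "\<sigma> a = a \<and> \<sigma> b = b \<and> \<sigma> c = c \<and> \<sigma> d = d" | "\<sigma> a = b \<and> \<sigma> b = a \<and> \<sigma> c = c \<and> \<sigma> d = d" |
    "\<sigma> a = a \<and> \<sigma> b = b \<and> \<sigma> c = d \<and> \<sigma> d = c" | "\<sigma> a = b \<and> \<sigma> b = a \<and> \<sigma> c = d \<and> \<sigma> d = c"
    using ab' cd' by blast
  then show ?thesis
  proof cases
    case 1
    then have "\<sigma> = id" by (intro eq(1)) auto
    then show ?thesis by simp
  next
    case 2
    then have "\<sigma> = transpose a b" using dist by (intro eq(2)) (auto simp: transpose_def)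
    then show ?thesis by simp
  next
    case 3
    then have "\<sigma> = transpose c d" using dist by (intro eq(3)) (auto simp: transpose_def)
    then show ?thesis by simp
  next
    case 4
    then have "\<sigma> = transpose a b \<circ> transpose c d" using dist by (intro eq(4)) (auto simp: transpose_def)
    then show ?thesis by simp
  qed
qed

lemma row_group_22: "row_group [2, 2] = {id, transpose (0, 0) (0, 1), transpose (1, 0) (1, 1),
    transpose (0, 0) (0, 1) \<circ> transpose (1, 0) (1, 1)}"
proof (intro equalityI subsetI)
  fix \<sigma> assume "\<sigma> \<in> row_group [2, 2]"
  then have p: "\<sigma> permutes {(0, 0), (0, 1), (1, 0), (1, 1)}" and r: "\<And>x. x \<in> cells [2, 2] \<Longrightarrow> fst (\<sigma> x) = fst x"
    by (auto simp: row_group_def cells_22)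
  have i: "\<sigma> x \<in> cells [2, 2]" if "x \<in> cells [2, 2]" for x
    using permutes_in_image[OF p] that by (simp add: cells_22)
  show "\<sigma> \<in> {id, transpose (0, 0) (0, 1), transpose (1, 0) (1, 1),
    transpose (0, 0) (0, 1) \<circ> transpose (1, 0) (1, 1)}"
    using r[of "(0, 0)"] i[of "(0, 0)"] r[of "(0, 1)"] i[of "(0, 1)"] r[of "(1, 0)"] i[of "(1, 0)"]
      r[of "(1, 1)"] i[of "(1, 1)"]
    by (intro permutes_two_pairs[OF p]) (auto simp: cells_22)
qed (auto simp: row_group_def cells_22 permutes_id permutes_swap_id permutes_compose transpose_def)

lemma col_group_22: "col_group [2, 2] = {id, transpose (0, 0) (1, 0), transpose (0, 1) (1, 1),
    transpose (0, 0) (1, 0) \<circ> transpose (0, 1) (1, 1)}"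
proof (intro equalityI subsetI)
  fix \<sigma> assume "\<sigma> \<in> col_group [2, 2]"
  then have p: "\<sigma> permutes {(0, 0), (1, 0), (0, 1), (1, 1)}" and r: "\<And>x. x \<in> cells [2, 2] \<Longrightarrow> snd (\<sigma> x) = snd x"
    by (auto simp: col_group_def cells_22 insert_commute)
  have i: "\<sigma> x \<in> cells [2, 2]" if "x \<in> cells [2, 2]" for x
    using permutes_in_image[OF p] that by (auto simp: cells_22)
  show "\<sigma> \<in> {id, transpose (0, 0) (1, 0), transpose (0, 1) (1, 1),
    transpose (0, 0) (1, 0) \<circ> transpose (0, 1) (1, 1)}"
    using r[of "(0, 0)"] i[of "(0, 0)"] r[of "(0, 1)"] i[of "(0, 1)"] r[of "(1, 0)"] i[of "(1, 0)"]
      r[of "(1, 1)"] i[of "(1, 1)"]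
    by (intro permutes_two_pairs[OF p]) (auto simp: cells_22)
qed (auto simp: col_group_def cells_22 permutes_id permutes_swap_id permutes_compose transpose_def)

lemma col_group_row: "col_group [m, 0] = {id}"
proof (intro equalityI subsetI)
  fix \<tau> assume "\<tau> \<in> col_group [m, 0]"
  then have p: "\<tau> permutes cells [m, 0]" and r: "\<And>x. x \<in> cells [m, 0] \<Longrightarrow> snd (\<tau> x) = snd x"
    by (auto simp: col_group_def)
  have i: "\<tau> x \<in> cells [m, 0]" if "x \<in> cells [m, 0]" for x using permutes_in_image[OF p] that by simp
  have "\<tau> = id"
    by (rule permutes_eqI[OF p permutes_id]) (use r i in \<open>force simp: cells_row prod_eq_iff\<close>)
  then show "\<tau> \<in> {id}" by simp
qed (auto simp: col_group_def permutes_id)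

section \<open>Linear relations and weights in the Schur modules of shapes \<open>[2, 1]\<close> and
  \<open>[2, 2]\<close>\<close>

definition fill21 :: "'b \<Rightarrow> 'b \<Rightarrow> 'b \<Rightarrow> nat \<times> nat \<Rightarrow> 'b" where
  "fill21 x y z = (\<lambda>c\<in>cells [2, 1]. if c = (0, 0) then x else if c = (0, 1) then y else z)"

definition fill22 :: "'b \<Rightarrow> 'b \<Rightarrow> 'b \<Rightarrow> 'b \<Rightarrow> nat \<times> nat \<Rightarrow> 'b" where
  "fill22 x y z w = (\<lambda>c\<in>cells [2, 2]. if c = (0, 0) then x else if c = (0, 1) then y else
     if c = (1, 0) then z else w)"

lemma fill21_transpose:
  "fill21 x y z \<circ> transpose (0, 0) (0, 1) = fill21 y x z"
  "fill21 x y z \<circ> transpose (0, 0) (1, 0) = fill21 z y x"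
  by (auto simp: fill21_def fun_eq_iff transpose_def cells_21_Suc restrict_def)

lemma fill22_transpose:
  "fill22 x y z w \<circ> transpose (0, 0) (0, 1) = fill22 y x z w"
  "fill22 x y z w \<circ> transpose (1, 0) (1, 1) = fill22 x y w z"
  "fill22 x y z w \<circ> transpose (0, 0) (1, 0) = fill22 z y x w"
  "fill22 x y z w \<circ> transpose (0, 1) (1, 1) = fill22 x w z y"
  by (auto simp: fill22_def fun_eq_iff transpose_def cells_22 restrict_def)

lemma transpose_neq_id: "a \<noteq> b \<Longrightarrow> transpose a b \<noteq> id"
  by (metis id_apply transpose_apply_first)

lemma young_symmetrizer_21:
  "young_symmetrizer [2, 1] S (fill21 x y z) =
    S (fill21 x y z) - S (fill21 z y x) + S (fill21 y x z) - S (fill21 z x y)"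
proof -
  have "transpose (0, 0) (0, 1 :: nat) \<noteq> (id :: nat \<times> nat \<Rightarrow> _)"
      "transpose (0, 0) (1 :: nat, 0) \<noteq> (id :: nat \<times> nat \<Rightarrow> _)" by (simp_all add: transpose_neq_id)
  then show ?thesis
    unfolding young_symmetrizer_def row_group_21 col_group_21
    by (simp add: fill21_transpose sign_swap_id eq_commute[of id] del: One_nat_def)
qed

lemma sum_klein:
  fixes g :: "('b \<Rightarrow> 'b) \<Rightarrow> complex"
  assumes "distinct [a, b, c, d]"
  shows "(\<Sum>\<sigma>\<in>{id, transpose a b, transpose c d, transpose a b \<circ> transpose c d}. g \<sigma>) =
    g id + g (transpose a b) + g (transpose c d) + g (transpose a b \<circ> transpose c d)"
proof -
  let ?p = "transpose a b" and ?q = "transpose c d"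
  \<comment> \<open>The images of \<open>a\<close> and \<open>c\<close> tell the four permutations
    apart, so the sum over the set has four summands.\<close>
  have "id a = a" "?p a = b" "?q a = a" "(?p \<circ> ?q) a = b" "id c = c" "?p c = c" "?q c = d" "(?p \<circ> ?q) c = d"
    using assms by (auto simp: transpose_def)
  then have "id \<noteq> ?p" "id \<noteq> ?q" "id \<noteq> ?p \<circ> ?q" "?p \<noteq> ?q" "?p \<noteq> ?p \<circ> ?q" "?q \<noteq> ?p \<circ> ?q"
    using assms by (metis distinct_length_2_or_more)+
  then show ?thesis by (simp add: add.assoc)
qed

lemma sign_klein:
  fixes a :: "nat \<times> nat"
  assumes "distinct [a, b, c, d]"
  shows "sign (transpose a b) = -1" "sign (transpose c d) = -1" "sign (transpose a b \<circ> transpose c d) = 1"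
  using assms by (auto simp: sign_swap_id sign_compose permutation_swap_id)

lemma young_symmetrizer_22:
  "young_symmetrizer [2, 2] S (fill22 x y z w) =
    S (fill22 x y z w) - S (fill22 z y x w) - S (fill22 x w z y) + S (fill22 z w x y) +
    (S (fill22 y x z w) - S (fill22 z x y w) - S (fill22 y w z x) + S (fill22 z w y x)) +
    (S (fill22 x y w z) - S (fill22 w y x z) - S (fill22 x z w y) + S (fill22 w z x y)) +
    (S (fill22 y x w z) - S (fill22 w x y z) - S (fill22 y z w x) + S (fill22 w z y x))"
proof -
  have 1: "distinct [(0 :: nat, 0 :: nat), (0, 1), (1, 0), (1, 1)]"
    "distinct [(0 :: nat, 0 :: nat), (1, 0), (0, 1), (1, 1)]" by simp_all
  show ?thesis
    unfolding young_symmetrizer_def row_group_22 col_group_22 sum_klein[OF 1(1)] sum_klein[OF 1(2)]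
      sign_klein[OF 1(2)] o_assoc fill22_transpose o_id sign_id
    by simp
qed

text \<open>The second identity is the Garnir relation: the column antisymmetrizer kills the sum
  over cyclic shifts. Together with row symmetry it determines the values at fillings with two equal
  covectors and a third one up to a common scalar.\<close>

lemma schur_module_21:
  assumes "T \<in> schur_module s [2, 1] W"
  shows "T (fill21 x y z) = T (fill21 y x z)"
    and "T (fill21 x y z) + T (fill21 y z x) + T (fill21 z x y) = 0"
proof -
  obtain S where "T = young_symmetrizer [2, 1] S" using assms by (auto simp: schur_module_def)
  then show "T (fill21 x y z) = T (fill21 y x z)"
    and "T (fill21 x y z) + T (fill21 y z x) + T (fill21 z x y) = 0"
    by (simp_all add: young_symmetrizer_21 del: One_nat_def)
qed

lemma schur_module_22:
  assumes "T \<in> schur_module s [2, 2] W"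
  shows "T (fill22 x y z w) = T (fill22 y x z w)" "T (fill22 x y z w) = T (fill22 x y w z)"
    and "T (fill22 x y z w) + T (fill22 z y x w) + T (fill22 x z y w) = 0"
proof -
  obtain S where "T = young_symmetrizer [2, 2] S" using assms by (auto simp: schur_module_def)
  then show "T (fill22 x y z w) = T (fill22 y x z w)" "T (fill22 x y z w) = T (fill22 x y w z)"
    and "T (fill22 x y z w) + T (fill22 z y x w) + T (fill22 x z y w) = 0"
    by (simp_all add: young_symmetrizer_22)
qed

lemma fill21_cells: "(\<lambda>c\<in>cells [2, 1]. h c) = fill21 (h (0, 0)) (h (0, 1)) (h (1, 0))"
  by (auto simp: fill21_def fun_eq_iff restrict_def cells_21_Suc)

lemma fill22_cells: "(\<lambda>c\<in>cells [2, 2]. h c) = fill22 (h (0, 0)) (h (0, 1)) (h (1, 0)) (h (1, 1))"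
  by (auto simp: fill22_def fun_eq_iff restrict_def cells_22)

text \<open>The two marked positions in the first row have equal values by symmetry, and the values
  at all three positions sum to zero; hence the factor \<open>- 1 / 2\<close> relative to the mark
  in the second row.\<close>

lemma schur_module_21_filling:
  assumes T: "T \<in> schur_module s [2, 1] W" and p: "p \<in> cells [2, 1]"
  shows "T (\<lambda>c\<in>cells [2, 1]. f (c = p)) =
    (if p = (1, 0) then 1 else - 1 / 2) * T (\<lambda>c\<in>cells [2, 1]. f (fst c = 1))"
proof -
  note T' = schur_module_21[OF T]
  have "T (fill21 (f True) (f False) (f False)) = T (fill21 (f False) (f True) (f False))"
    "T (fill21 (f False) (f False) (f True)) + T (fill21 (f False) (f True) (f False)) +
      T (fill21 (f True) (f False) (f False)) = 0"
    by (rule T')+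
  then have "2 * T (fill21 (f False) (f True) (f False)) = - T (fill21 (f False) (f False) (f True))"
      "T (fill21 (f True) (f False) (f False)) = T (fill21 (f False) (f True) (f False))"
    by (auto simp: algebra_simps eq_neg_iff_add_eq_0)
  then show ?thesis using p unfolding fill21_cells unfolding cells_21 by (auto simp: field_simps)
qed

lemma schur_module_21_constant:
  assumes T: "T \<in> schur_module s [2, 1] W"
  shows "T (\<lambda>c\<in>cells [2, 1]. x) = 0"
  using schur_module_21(2)[OF T, of x x x] unfolding fill21_cells by simp

text \<open>With three equal entries, row symmetry turns the Garnir relation into a multiple of a
  single value. Thus, of two covectors, each must fill two cells for a nonzero value, which bounds
  the weights from below.\<close>

lemma schur_module_22_three_equal:
  assumes T: "T \<in> schur_module s [2, 2] W"
  shows "T (fill22 x x x w) = 0" "T (fill22 x x w x) = 0" "T (fill22 x w x x) = 0" "T (fill22 w x x x) = 0"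
proof -
  note T' = schur_module_22[OF T]
  show 1: "T (fill22 x x x w) = 0" using T'(3)[of x x x w] by simp
  show 2: "T (fill22 x x w x) = 0" using 1 T'(2)[of x x x w] by simp
  have "T (fill22 w x x x) + T (fill22 w x x x) = 0" using T'(3)[of w x x x] 2 T'(1)[of w x x x] by simp
  then show 4: "T (fill22 w x x x) = 0" by simp
  show "T (fill22 x w x x) = 0" using T'(1)[of x w x x] 4 by simp
qed

text \<open>The four pairs with one cell in each row agree by row symmetry. Each Garnir relation
  compares them with a full row, so the two rows have the same value and the other pairs carry
  \<open>- 1 / 2\<close> of it.\<close>

lemma schur_module_22_filling:
  assumes T: "T \<in> schur_module s [2, 2] W" and C: "C \<subseteq> cells [2, 2]" "card C = 2"
  shows "T (\<lambda>c\<in>cells [2, 2]. f (c \<in> C)) =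
    (if C = {(0, 0), (0, 1)} \<or> C = {(1, 0), (1, 1)} then 1 else - 1 / 2) * T (\<lambda>c\<in>cells [2, 2]. f (fst c = 1))"
proof -
  note T' = schur_module_22[OF T]
  let ?t = "f True" and ?f = "f False"
  have 1: "T (fill22 ?f ?t ?t ?f) = T (fill22 ?t ?f ?f ?t)" "T (fill22 ?t ?f ?t ?f) = T (fill22 ?t ?f ?f ?t)"
    "T (fill22 ?f ?t ?f ?t) = T (fill22 ?t ?f ?f ?t)"
    using T'(1)[of ?f ?t ?t ?f] T'(2)[of ?t ?f ?t ?f] T'(1)[of ?f ?t ?f ?t] by simp_all
  have 2: "2 * T (fill22 ?t ?f ?f ?t) = - T (fill22 ?f ?f ?t ?t)"
    using T'(3)[of ?f ?f ?t ?t] 1 by (simp add: eq_neg_iff_add_eq_0 algebra_simps)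
  have 3: "2 * T (fill22 ?t ?f ?f ?t) = - T (fill22 ?t ?t ?f ?f)"
    using T'(3)[of ?t ?t ?f ?f] 1 by (simp add: eq_neg_iff_add_eq_0 algebra_simps)
  have 4: "T (fill22 ?t ?t ?f ?f) = T (fill22 ?f ?f ?t ?t)" using 2 3 by simp
  have 5: "T (fill22 ?t ?f ?f ?t) = - 1 / 2 * T (fill22 ?f ?f ?t ?t)"
    using 2 by (simp add: field_simps)
  obtain c c' where cc: "C = {c, c'}" "c \<noteq> c'" using C(2) by (auto simp: card_2_iff)
  then have "c \<in> {(0, 0), (0, 1), (1, 0), (1, 1)}" "c' \<in> {(0, 0), (0, 1), (1, 0), (1, 1)}"
    using C(1) by (auto simp: cells_22)
  then show ?thesis
    unfolding fill22_cells using cc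
    by (elim insertE emptyE) (simp_all add: 1 4 5 doubleton_eq_iff)
qed

section \<open>Polarization\<close>

text \<open>Polarization, one slot at a time. If the slots of \<open>R\<close> share a vector and
  slot \<open>r\<close> carries another, adding \<open>t\<close> times the latter to the shared
  vector throughout \<open>insert r R\<close> gives a vanishing polynomial in \<open>t\<close>; by
  symmetry its linear coefficient is \<open>card (insert r R)\<close> times the value in question.
  Slots outside \<open>R0\<close> are frozen at \<open>z\<close> so that blocks can be treated in
  turn.\<close>

lemma symmetric_zero_on_block:
  assumes F: "F \<in> multilinear_forms s K U" and s: "vector_space s"
    and U: "\<And>k. k \<in> K \<Longrightarrow> module.subspace s (U k)"
    and R: "finite R" "R \<subseteq> R0" "R0 \<subseteq> K" and W: "\<And>k. k \<in> R0 \<Longrightarrow> U k = W"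
    and sym: "\<And>a b x. a \<in> R0 \<Longrightarrow> b \<in> R0 \<Longrightarrow> x \<in> Pi\<^sub>E K U \<Longrightarrow> F (x \<circ> transpose a b) = F x"
    and zero: "\<And>x. x \<in> Pi\<^sub>E K U \<Longrightarrow> (\<And>k. k \<notin> R0 \<Longrightarrow> x k = z k) \<Longrightarrow>
      (\<And>a b. a \<in> R \<Longrightarrow> b \<in> R \<Longrightarrow> x a = x b) \<Longrightarrow> F x = 0"
    and x: "x \<in> Pi\<^sub>E K U" "\<And>k. k \<notin> R0 \<Longrightarrow> x k = z k"
  shows "F x = 0"
  using R(1,2) zero x
proof (induction R arbitrary: x rule: finite_induct)
  case empty
  then show ?case by blast
next
  case (insert r R)
  interpret s: vector_space s by (rule s)
  show ?case
  proof (rule insert.IH)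
    show "R \<subseteq> R0" using insert.prems by simp
    show "x \<in> Pi\<^sub>E K U" "\<And>k. k \<notin> R0 \<Longrightarrow> x k = z k" by fact+
    fix x assume x: "x \<in> Pi\<^sub>E K U" "\<And>k. k \<notin> R0 \<Longrightarrow> x k = z k"
      "\<And>a b. a \<in> R \<Longrightarrow> b \<in> R \<Longrightarrow> x a = x b"
    show "F x = 0"
    proof (cases "R = {}")
      case True
      then show ?thesis using insert.prems(2) x by auto
    next
      case False
      then obtain q where q: "q \<in> R" by blast
      define x0 where "x0 = x(r := x q)"
      have rq: "r \<in> K" "q \<in> K" "U r = W" "U q = W" using insert.prems(1) q R(3) W by auto
      have x0: "x0 \<in> Pi\<^sub>E K U" unfolding x0_def using x(1) rq by (intro PiE_upd) auto
      have const: "x0 k = x q" if "k \<in> insert r R" for k using that x(3)[OF _ q] by (auto simp: x0_def)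
      have sub: "insert r R \<subseteq> K" using insert.prems R by blast
      have xr: "x r \<in> U k" if "k \<in> insert r R" for k
      proof -
        have "U k = W" using that insert.prems(1) by (intro W) auto
        then show ?thesis using x(1) rq by (auto simp: PiE_iff)
      qed
      have "(\<Sum>N\<in>Pow (insert r R). t ^ card N * F (\<lambda>k. if k \<in> N then x r else x0 k)) = 0" for t
      proof -
        have "F (\<lambda>k. if k \<in> insert r R then x0 k + s t (x r) else x0 k) = 0"
        proof (rule insert.prems(2))
          show "(\<lambda>k. if k \<in> insert r R then x0 k + s t (x r) else x0 k) \<in> Pi\<^sub>E K U"
            using x0 sub xr s.subspace_add[OF U] s.subspace_scale[OF U]
            by (intro PiE_if) (auto simp: PiE_iff)
          show "(if k \<in> insert r R then x0 k + s t (x r) else x0 k) = z k" if "k \<notin> R0" for k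
            using that insert.prems(1) x(2) by (auto simp: x0_def)
          show "(if a \<in> insert r R then x0 a + s t (x r) else x0 a) =
              (if b \<in> insert r R then x0 b + s t (x r) else x0 b)"
            if "a \<in> insert r R" "b \<in> insert r R" for a b
            using that const by simp
        qed
        then show ?thesis
          using multilinear_pencil_on[OF F s U _ sub x0 xr] insert.hyps(1) by simp
      qed
      from sum_power_coeff_zero[OF _ this, of 1]
      have "0 = (\<Sum>N\<in>{N \<in> Pow (insert r R). card N = 1}. F (\<lambda>k. if k \<in> N then x r else x0 k))"
        using insert.hyps(1) by simp
      also have "{N \<in> Pow (insert r R). card N = 1} = (\<lambda>k. {k}) ` insert r R"
        by (auto simp: card_1_singleton_iff)
      also have "(\<Sum>N\<in>(\<lambda>k. {k}) ` insert r R. F (\<lambda>k. if k \<in> N then x r else x0 k)) =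
          (\<Sum>j\<in>insert r R. F (\<lambda>k. if k \<in> {j} then x r else x0 k))"
        by (subst sum.reindex) (auto simp: inj_on_def)
      also have "\<dots> = (\<Sum>j\<in>insert r R. F x)"
      proof (rule sum.cong[OF refl])
        fix j assume j: "j \<in> insert r R"
        have xeq: "(\<lambda>k. if k \<in> {j} then x r else x0 k) = x \<circ> transpose r j"
        proof
          fix k
          show "(if k \<in> {j} then x r else x0 k) = (x \<circ> transpose r j) k"
            using const[OF j] insert.hyps(2) by (auto simp: transpose_def x0_def)
        qed
        show "F (\<lambda>k. if k \<in> {j} then x r else x0 k) = F x"
          unfolding xeq using j insert.prems(1) x(1) by (intro sym) auto
      qed
      also have "\<dots> = of_nat (card (insert r R)) * F x" by simp
      finally show ?thesis using insert.hyps by (simp add: of_nat_eq_0_iff del: of_nat_Suc)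
    qed
  qed
qed

text \<open>The fibres of \<rho> are the blocks, later the rows of the diagrams. \<open>J\<close>
  holds the blocks on which vanishing is known only for constant arguments; the induction frees them
  one by one.\<close>

lemma symmetric_zero_on_blocks:
  assumes F: "F \<in> multilinear_forms s K U" and s: "vector_space s"
    and U: "\<And>k. k \<in> K \<Longrightarrow> module.subspace s (U k)" and K: "finite K"
    and W: "\<And>k l. k \<in> K \<Longrightarrow> l \<in> K \<Longrightarrow> \<rho> k = \<rho> l \<Longrightarrow> U k = U l"
    and sym: "\<And>a b x. a \<in> K \<Longrightarrow> b \<in> K \<Longrightarrow> \<rho> a = \<rho> b \<Longrightarrow> x \<in> Pi\<^sub>E K U \<Longrightarrow> F (x \<circ> transpose a b) = F x"
    and J: "finite J"
    and zero: "\<And>x. x \<in> Pi\<^sub>E K U \<Longrightarrow>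
      (\<And>a b. a \<in> K \<Longrightarrow> b \<in> K \<Longrightarrow> \<rho> a = \<rho> b \<Longrightarrow> \<rho> a \<in> J \<Longrightarrow> x a = x b) \<Longrightarrow> F x = 0"
    and x: "x \<in> Pi\<^sub>E K U"
  shows "F x = 0"
  using J zero x
proof (induction J arbitrary: x rule: finite_induct)
  case empty
  then show ?case by blast
next
  case (insert q J)
  show ?case
  proof (rule insert.IH)
    show "x \<in> Pi\<^sub>E K U" by fact
    fix x assume x: "x \<in> Pi\<^sub>E K U" "\<And>a b. a \<in> K \<Longrightarrow> b \<in> K \<Longrightarrow> \<rho> a = \<rho> b \<Longrightarrow> \<rho> a \<in> J \<Longrightarrow> x a = x b"
    define R where "R = {k \<in> K. \<rho> k = q}"
    show "F x = 0"
    proof (cases "R = {}")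
      case True
      show ?thesis
      proof (rule insert.prems(1)[OF x(1)])
        fix a b assume ab: "a \<in> K" "b \<in> K" "\<rho> a = \<rho> b" "\<rho> a \<in> insert q J"
        then have "\<rho> a \<in> J" using True by (auto simp: R_def)
        with ab show "x a = x b" by (intro x(2))
      qed
    next
      case False
      then obtain k0 where k0: "k0 \<in> R" by blast
      show ?thesis
      proof (rule symmetric_zero_on_block[OF F s U, of R R "U k0" x])
        show "U k = U k0" if "k \<in> R" for k using that k0 W by (auto simp: R_def)
        show "F (y \<circ> transpose a b) = F y" if "a \<in> R" "b \<in> R" "y \<in> Pi\<^sub>E K U" for a b y
          using that by (intro sym) (auto simp: R_def)
        fix y assume y: "y \<in> Pi\<^sub>E K U" "\<And>k. k \<notin> R \<Longrightarrow> y k = x k" "\<And>a b. a \<in> R \<Longrightarrow> b \<in> R \<Longrightarrow> y a = y b"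
        show "F y = 0"
        proof (rule insert.prems(1)[OF y(1)])
          fix a b assume ab: "a \<in> K" "b \<in> K" "\<rho> a = \<rho> b" "\<rho> a \<in> insert q J"
          show "y a = y b"
          proof (cases "\<rho> a = q")
            case True
            then show ?thesis using ab by (intro y(3)) (auto simp: R_def)
          next
            case False
            then have "a \<notin> R" "b \<notin> R" using ab by (auto simp: R_def)
            moreover have "x a = x b" using ab False by (intro x(2)) simp_all
            ultimately show ?thesis by (simp add: y(2))
          qed
        qed
      qed (use K x in \<open>auto simp: R_def\<close>)
    qed
  qed
qed

section \<open>Vanishing on the tangential variety\<close>

text \<open>The \<open>a j\<close> are the coefficients of the polynomial whose roots are the
  \<open>2 ^ l\<close> with \<open>l \<noteq> m\<close>, and the sum is its value at
  \<open>2 ^ k\<close>. Applied to the torus elements \<open>2 ^ j\<close>, these coefficients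
  extract the weight \<open>m\<close> up to a nonzero factor.\<close>

lemma geometric_interpolation:
  assumes "m \<le> L"
  obtains a :: "nat \<Rightarrow> complex" and J
  where "\<And>k. k \<le> L \<Longrightarrow> (\<Sum>j\<le>J. a j * ((2 ^ j) ^ k)) = 0 \<longleftrightarrow> k \<noteq> m"
proof -
  define p :: "complex poly" where "p = (\<Prod>l\<in>{..L} - {m}. [:- (2 ^ l), 1:])"
  have eval: "(\<Sum>j\<le>degree p. coeff p j * ((2 ^ j) ^ k)) = (\<Prod>l\<in>{..L} - {m}. 2 ^ k - 2 ^ l)" for k
  proof -
    have "(\<Sum>j\<le>degree p. coeff p j * ((2 ^ j) ^ k)) = poly p (2 ^ k)"
      by (simp add: poly_altdef power_mult[symmetric] mult.commute)
    then show ?thesis by (simp add: p_def poly_prod)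
  qed
  have "(\<Prod>l\<in>{..L} - {m}. 2 ^ k - 2 ^ l :: complex) = 0 \<longleftrightarrow> k \<noteq> m" if "k \<le> L" for k
  proof -
    have "(2 ^ k - 2 ^ l :: complex) = 0 \<longleftrightarrow> k = l" for l
    proof -
      have "(2 ^ k :: complex) = 2 ^ l \<longleftrightarrow> (of_nat (2 ^ k) :: complex) = of_nat (2 ^ l)" by simp
      also have "\<dots> \<longleftrightarrow> k = l" unfolding of_nat_eq_iff by simp
      finally show ?thesis by simp
    qed
    then show ?thesis using that by (auto simp: prod_zero_iff)
  qed
  then show thesis using that[of "coeff p" "degree p"] eval by simp
qed

lemma linear_on_sum:
  assumes s: "vector_space s1" and t: "vector_space s2" and U: "module.subspace s1 U"
    and h: "linear_on s1 s2 U h" and x: "\<And>j. j \<in> J \<Longrightarrow> x j \<in> U" and J: "finite J"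
  shows "h (\<Sum>j\<in>J. s1 (a j) (x j)) = (\<Sum>j\<in>J. s2 (a j) (h (x j)))"
  using J x
proof (induction J rule: finite_induct)
  case empty
  interpret s: vector_space s1 by (rule s)
  interpret t: vector_space s2 by (rule t)
  have "h (s1 0 0) = s2 0 (h 0)" using linear_on_scale[OF h s.subspace_0[OF U]] .
  then show ?case by simp
next
  case (insert j J)
  interpret s: vector_space s1 by (rule s)
  have "(\<Sum>j\<in>J. s1 (a j) (x j)) \<in> U" "s1 (a j) (x j) \<in> U"
    using insert.prems by (auto intro!: s.subspace_sum s.subspace_scale U)
  then show ?case
    using insert linear_on_add[OF h] linear_on_scale[OF h] by simp
qed

context tensor_type
begin

definition torus :: "complex \<Rightarrow> 'i \<Rightarrow> 'a \<Rightarrow> 'a" where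
  "torus t = (\<lambda>i\<in>I. \<lambda>v\<in>V i. scale (D i False v) (E i False) + scale (t * D i True v) (E i True))"

lemma torus_D:
  assumes i: "i \<in> I" and v: "v \<in> V i"
  shows "torus t i v \<in> V i" "D i b (torus t i v) = (if b then t else 1) * D i b v"
proof -
  note B = basesD[OF ref_bases i]
  note lin = dual_space_linear[OF B(2)]
  have m: "scale c (E i b) \<in> V i" for b c using B(1) subspace_scale[OF subspace_planes[OF i]] by simp
  then show "torus t i v \<in> V i" using i v subspace_add[OF subspace_planes[OF i]] by (simp add: torus_def)
  show "D i b (torus t i v) = (if b then t else 1) * D i b v"
    using i v m B(1,3) linear_on_add[OF lin] linear_on_scale[OF lin] by (auto simp: torus_def)
qed

lemma torus_linear:
  assumes i: "i \<in> I"
  shows "linear_on scale scale (V i) (torus t i)"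
  using i dual_space_linear[OF basesD(2)[OF ref_bases i]] subspace_planes[OF i]
  by (auto simp: linear_on_def torus_def subspace_add subspace_scale scale_left_distrib scale_right_distrib
      algebra_simps)

lemma torus_inverse:
  assumes i: "i \<in> I" and v: "v \<in> V i" and t: "t \<noteq> 0"
  shows "torus (1 / t) i (torus t i v) = v"
proof -
  have "torus (1 / t) i (torus t i v) =
      scale (D i False (torus t i v)) (E i False) + scale (1 / t * D i True (torus t i v)) (E i True)"
    using torus_D(1)[OF i v, of t] i by (simp add: torus_def[of "1 / t"])
  also have "\<dots> = v" using torus_D(2)[OF i v] t basesD(4)[OF ref_bases i v] by simp
  finally show ?thesis .
qed

lemma torus_GL:
  assumes t: "t \<noteq> 0"
  shows "torus t \<in> GL_prod scale I V"
proof -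
  have "bij_betw (torus t i) (V i) (V i)" if i: "i \<in> I" for i
    by (rule bij_betw_byWitness[where f' = "torus (1 / t) i"])
      (use torus_inverse[OF i _ t] torus_inverse[OF i, of _ "1 / t"] t torus_D(1)[OF i] in auto)
  moreover have "torus t i \<in> extensional (V i)" if "i \<in> I" for i
    using that by (simp add: torus_def)
  ultimately show ?thesis
    using torus_linear by (auto simp: GL_prod_def GL_def) (simp add: torus_def)
qed

lemma coord_act_torus:
  assumes T: "T \<in> slots.tensors" and N: "N \<subseteq> slots"
  shows "slots.coord (\<lambda>k. D (fst k)) (act_tensor scale I V \<pi> (torus t) T) N =
    t ^ card N * slots.coord (\<lambda>k. D (fst k)) T N"
proof -
  let ?D = "\<lambda>k\<in>slots. D (fst k) (k \<in> N)"
  let ?\<psi> = "\<lambda>(i, c)\<in>slots. \<lambda>v. if v \<in> V i then ?D (i, c) (torus t i v) else 0"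
  let ?t = "\<lambda>b. if b then t else 1"
  have D: "?D \<in> covectors scale I V \<pi>"
    using basesD(2)[OF ref_bases] by (auto simp: covectors_eq)
  have \<psi>: "?\<psi> k = fscale (?t (k \<in> N)) (D (fst k) (k \<in> N))" if "k \<in> slots" for k
  proof
    fix v
    obtain i c where k: "k = (i, c)" by (cases k)
    show "?\<psi> k v = fscale (?t (k \<in> N)) (D (fst k) (k \<in> N)) v"
      using that torus_D(2)[of i v] dual_space_outside[OF basesD(2)[OF ref_bases, of i]]
      by (cases "v \<in> V i") (auto simp: k)
  qed
  have \<psi>': "?\<psi> \<in> Pi\<^sub>E slots (\<lambda>k. dual_space scale (V (fst k)))"
  proof (rule PiE_I)
    fix k assume k: "k \<in> slots"
    then have "fst k \<in> I" by auto
    then show "?\<psi> k \<in> dual_space scale (V (fst k))"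
      unfolding \<psi>[OF k] by (intro fs.subspace_scale subspace_dual_space basesD(2)[OF ref_bases])
  qed simp
  have "slots.coord (\<lambda>k. D (fst k)) (act_tensor scale I V \<pi> (torus t) T) N = T ?\<psi>"
    unfolding slots.coord_def act_tensor_def using D by simp
  also have "\<dots> = (\<Sum>M\<in>Pow slots. (\<Prod>k\<in>slots. ?\<psi> k (E (fst k) (k \<in> M))) * slots.coord (\<lambda>k. D (fst k)) T M)"
    by (rule slots.tensors_expand[OF T slot_bases \<psi>'])
  also have "\<dots> = (\<Sum>M\<in>Pow slots. if M = N then t ^ card N * slots.coord (\<lambda>k. D (fst k)) T N else 0)"
  proof (rule sum.cong[OF refl])
    fix M assume M: "M \<in> Pow slots"
    have "(\<Prod>k\<in>slots. ?\<psi> k (E (fst k) (k \<in> M))) = (\<Prod>k\<in>slots. ?t (k \<in> N) * of_bool ((k \<in> N) = (k \<in> M)))"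
    proof (rule prod.cong[OF refl])
      fix k assume k: "k \<in> slots"
      then have "fst k \<in> I" by auto
      then show "?\<psi> k (E (fst k) (k \<in> M)) = ?t (k \<in> N) * of_bool ((k \<in> N) = (k \<in> M))"
        unfolding \<psi>[OF k] using basesD(3)[OF ref_bases] by simp
    qed
    also have "\<dots> = (if M = N then t ^ card N else 0)"
    proof (cases "M = N")
      case True
      then show ?thesis using N slots.finite_slots by (simp add: prod.If_cases Int_absorb1)
    next
      case False
      then obtain k where "k \<in> slots" "(k \<in> N) \<noteq> (k \<in> M)" using N M by blast
      then show ?thesis using False slots.finite_slots by (auto intro!: prod_zero)
    qed
    finally show "(\<Prod>k\<in>slots. ?\<psi> k (E (fst k) (k \<in> M))) * slots.coord (\<lambda>k. D (fst k)) T M =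
      (if M = N then t ^ card N * slots.coord (\<lambda>k. D (fst k)) T N else 0)" by simp
  qed
  also have "\<dots> = t ^ card N * slots.coord (\<lambda>k. D (fst k)) T N"
    using N slots.finite_slots by simp
  finally show ?thesis .
qed

lemma tensors_eqI:
  assumes "T \<in> slots.tensors" "T' \<in> slots.tensors"
    and "\<And>N. N \<subseteq> slots \<Longrightarrow> slots.coord (\<lambda>k. D (fst k)) T N = slots.coord (\<lambda>k. D (fst k)) T' N"
  shows "T = T'"
proof
  fix \<phi>
  show "T \<phi> = T' \<phi>"
  proof (cases "\<phi> \<in> Pi\<^sub>E slots (\<lambda>k. dual_space scale (V (fst k)))")
    case True
    then show ?thesis
      using assms(3) by (simp add: slots.tensors_expand[OF assms(1) slot_bases]
          slots.tensors_expand[OF assms(2) slot_bases])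
  next
    case False
    then show ?thesis using multilinear_forms_outside assms(1,2) by metis
  qed
qed

text \<open>Under the torus \<open>t\<close> acting by \<open>t\<close> on the second basis vectors, a polynomial of degree \<open>d\<close>
  restricted to the orbit of a tangent form is a combination of the weights \<open>t\<^sup>k\<close> with \<open>k \<le> d\<close>,
  whereas only larger weights occur in the Schur tensors.\<close>

lemma isotypic_zero_on_tangent_forms:
  assumes weights: "\<And>T N. T \<in> schur_tensor scale I V \<pi> \<Longrightarrow> N \<subseteq> slots \<Longrightarrow>
      slots.coord (\<lambda>k. D (fst k)) T N \<noteq> 0 \<Longrightarrow> d < card N"
    and A: "A \<in> tangent_forms E" and p: "p \<in> isotypic_component scale I V d \<pi>"
  shows "p A = 0"
proof -
  let ?M = "schur_tensor scale I V \<pi>"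
  have AF: "A \<in> forms" using A by (simp add: tangent_forms_def)
  have M: "fs.subspace ?M" unfolding schur_tensor_def by (rule fs.subspace_span)
  \<comment> \<open>\<open>A\<close> splits into its parts of weight 0 and 1. The torus element
    \<open>t\<close> multiplies the second part by \<open>t\<close>, so the orbit of
    \<open>A\<close> lies on a line.\<close>
  obtain W0 where W0: "W0 \<in> forms" "\<And>N. N \<subseteq> I \<Longrightarrow> coord E W0 N = (if N = {} then coord E A N else 0)"
    using form_with_coord[OF ref_bases, of "\<lambda>N. if N = {} then coord E A N else 0"] by blast
  obtain W1 where W1: "W1 \<in> forms" "\<And>N. N \<subseteq> I \<Longrightarrow> coord E W1 N = (if card N = 1 then coord E A N else 0)"
    using form_with_coord[OF ref_bases, of "\<lambda>N. if card N = 1 then coord E A N else 0"] by blast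
  define At where "At = (\<lambda>t x. if x \<in> Pi\<^sub>E I V then A (\<lambda>i\<in>I. torus t i (x i)) else 0)"
  have At: "At t = W0 + fscale t W1" for t
  proof (rule forms_eqI[OF _ _ ref_bases])
    show "At t \<in> forms"
      unfolding At_def using torus_linear torus_D(1) by (intro pullback_form[OF AF]) auto
    show "W0 + fscale t W1 \<in> forms"
      using W0(1) W1(1) by (simp only: fs.subspace_add[OF subspace_multilinear_forms]
          fs.subspace_scale[OF subspace_multilinear_forms])
    fix N assume N: "N \<subseteq> I"
    have E: "(\<lambda>i\<in>I. E i (i \<in> N)) \<in> Pi\<^sub>E I V" using basesD(1)[OF ref_bases] by auto
    have x: "(\<lambda>i\<in>I. torus t i (E i (i \<in> N))) \<in> Pi\<^sub>E I V"
      using basesD(1)[OF ref_bases] torus_D(1) by auto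
    have "coord E (At t) N = A (\<lambda>i\<in>I. torus t i ((\<lambda>i\<in>I. E i (i \<in> N)) i))"
      unfolding coord_def At_def using E by simp
    also have "(\<lambda>i\<in>I. torus t i ((\<lambda>i\<in>I. E i (i \<in> N)) i)) = (\<lambda>i\<in>I. torus t i (E i (i \<in> N)))"
      by (auto simp: fun_eq_iff)
    also have "A \<dots> = (\<Sum>M\<in>Pow I. (\<Prod>i\<in>I. D i (i \<in> M) (torus t i (E i (i \<in> N)))) * coord E A M)"
      unfolding forms_expand[OF AF ref_bases x]
      by (intro sum.cong arg_cong2[of _ _ _ _ "(*)"] prod.cong refl) simp
    also have "\<dots> = (\<Sum>M\<in>Pow I. if M = N then t ^ card N * coord E A N else 0)"
    proof (rule sum.cong[OF refl])
      fix M assume M: "M \<in> Pow I"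
      have "(\<Prod>i\<in>I. D i (i \<in> M) (torus t i (E i (i \<in> N)))) =
          (\<Prod>i\<in>I. (if i \<in> M then t else 1) * of_bool ((i \<in> M) = (i \<in> N)))"
        using basesD(1,3)[OF ref_bases] torus_D(2) by (intro prod.cong) auto
      also have "\<dots> = (if M = N then t ^ card N else 0)"
      proof (cases "M = N")
        case True
        then show ?thesis using N finite_slots by (simp add: prod.If_cases Int_absorb1)
      next
        case False
        then obtain k where "k \<in> I" "(k \<in> M) \<noteq> (k \<in> N)" using N M by blast
        then show ?thesis using False finite_slots by (auto intro!: prod_zero)
      qed
      finally show "(\<Prod>i\<in>I. D i (i \<in> M) (torus t i (E i (i \<in> N)))) * coord E A M =
        (if M = N then t ^ card N * coord E A N else 0)" by simp
    qed
    also have "\<dots> = t ^ card N * coord E A N" using N finite_slots by simp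
    also have "\<dots> = coord E W0 N + t * coord E W1 N"
    proof -
      have "finite N" using N finite_slots finite_subset by blast
      then consider "N = {}" | "card N = 1" | "2 \<le> card N" "N \<noteq> {}"
        by (metis Suc_1 card_0_eq le_less_Suc_eq less_one not_less_eq_eq not_less)
      then show ?thesis
        using A N W0(2)[OF N] W1(2)[OF N] by cases (auto simp: tangent_forms_def)
    qed
    also have "\<dots> = coord E (W0 + fscale t W1) N" by (simp add: coord_def)
    finally show "coord E (At t) N = coord E (W0 + fscale t W1) N" .
  qed
  have A1: "At 1 = A"
  proof (rule ext)
    fix x
    have "torus 1 i v = v" if "i \<in> I" "v \<in> V i" for i v
      using that basesD(4)[OF ref_bases that] by (simp add: torus_def)
    then have "(\<lambda>i\<in>I. torus 1 i (x i)) = x" if "x \<in> Pi\<^sub>E I V"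
      using that by (auto simp: fun_eq_iff PiE_iff extensional_def)
    then show "At 1 x = A x"
      using multilinear_forms_outside[OF AF] by (auto simp: At_def)
  qed
  \<comment> \<open>\<open>N\<close> is an arbitrary copy of the Schur tensors, and the isomorphism
    \<open>h\<close> is the only handle on it: relations between torus translates of
    \<open>T\<close> are carried over to those of \<open>q\<close>.\<close>
  have orbit: "q A = 0" if N: "submodule fscale (GL_prod scale I V) (act_poly scale I V) N (hom_polys fscale forms d)"
    and iso: "module_isomorphic fscale fscale (GL_prod scale I V) (act_tensor scale I V \<pi>) (act_poly scale I V) ?M N"
    and q: "q \<in> N" for N q
  proof -
    obtain h where h: "bij_betw h ?M N" "linear_on fscale fscale ?M h"
      "\<And>g T. g \<in> GL_prod scale I V \<Longrightarrow> T \<in> ?M \<Longrightarrow> h (act_tensor scale I V \<pi> g T) = act_poly scale I V g (h T)"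
      using iso by (auto simp: module_isomorphic_def)
    obtain T where T: "T \<in> ?M" "h T = q" using h(1) q by (auto simp: bij_betw_def)
    have TT: "T \<in> slots.tensors" using T schur_tensor_tensors by blast
    obtain B where B: "B \<in> multilinear_forms fscale {..<d} (\<lambda>_. forms)"
      and qB: "q = (\<lambda>w. if w \<in> forms then B (\<lambda>j\<in>{..<d}. w) else 0)"
      using N q by (auto simp: submodule_def hom_polys_def)
    let ?b = "\<lambda>P. B (\<lambda>j\<in>{..<d}. if j \<in> P then W1 else W0)"
    have q_orbit: "q (At t) = (\<Sum>P\<in>Pow {..<d}. t ^ card P * ?b P)" for t
    proof -
      have "At t \<in> forms"
        unfolding At using W0(1) W1(1) by (simp only: fs.subspace_add[OF subspace_multilinear_forms]
          fs.subspace_scale[OF subspace_multilinear_forms])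
      then have "q (At t) = B (\<lambda>j\<in>{..<d}. W0 + fscale t W1)" by (simp only: qB At if_True)
      also have "\<dots> = (\<Sum>P\<in>Pow {..<d}. t ^ card P * ?b P)"
        by (rule multilinear_pencil[OF B vector_space_fscale])
          (auto intro: W0(1) W1(1) subspace_multilinear_forms)
      finally show ?thesis .
    qed
    let ?c = "\<lambda>m. \<Sum>P\<in>{P \<in> Pow {..<d}. card P = m}. ?b P"
    have cardP: "card P \<le> d" if "P \<in> Pow {..<d}" for P
      using that card_mono[of "{..<d}" P] by simp
    have coeff: "?c m = 0" if m: "m \<le> d" for m
    proof -
      \<comment> \<open>Bounds the exponents on both sides: at most \<open>d\<close> on the orbit
        and at most \<open>card slots\<close> on the tensor.\<close>
      define L where "L = d + card slots"
      have mL: "m \<le> L" using m by (simp add: L_def)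
      obtain a :: "nat \<Rightarrow> complex" and J where
        a: "\<And>k. k \<le> L \<Longrightarrow> (\<Sum>j\<le>J. a j * ((2 ^ j) ^ k)) = 0 \<longleftrightarrow> k \<noteq> m"
        using geometric_interpolation[OF mL] by blast
      let ?g = "\<lambda>j. torus (2 ^ j)"
      have g: "?g j \<in> GL_prod scale I V" for j :: nat by (rule torus_GL) simp
      \<comment> \<open>The combination extracts the part of weight \<open>m \<le> d\<close> from
        \<open>T\<close>, which is zero because all weights of \<open>T\<close> exceed
        \<open>d\<close>.\<close>
      have "(\<Sum>j\<in>{..J}. fscale (a j) (act_tensor scale I V \<pi> (?g j) T)) = 0"
      proof (rule tensors_eqI)
        show "(\<Sum>j\<in>{..J}. fscale (a j) (act_tensor scale I V \<pi> (?g j) T)) \<in> slots.tensors"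
          using schur_tensor_act[OF g T(1)] schur_tensor_tensors
          by (intro fs.subspace_sum fs.subspace_scale subspace_multilinear_forms) blast
        show "0 \<in> slots.tensors" by (rule fs.subspace_0[OF subspace_multilinear_forms])
        fix N assume N: "N \<subseteq> slots"
        have "slots.coord (\<lambda>k. D (fst k)) (\<Sum>j\<in>{..J}. fscale (a j) (act_tensor scale I V \<pi> (?g j) T)) N =
          (\<Sum>j\<le>J. a j * slots.coord (\<lambda>k. D (fst k)) (act_tensor scale I V \<pi> (?g j) T) N)"
          by (simp add: slots.coord_def sum_fun_apply)
        also have "\<dots> = (\<Sum>j\<le>J. a j * ((2 ^ j) ^ card N)) * slots.coord (\<lambda>k. D (fst k)) T N"
          by (simp add: coord_act_torus[OF TT N] sum_distrib_right mult.assoc)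
        also have "\<dots> = 0"
        proof (cases "slots.coord (\<lambda>k. D (fst k)) T N = 0")
          case False
          then have "card N \<noteq> m" using weights[OF T(1) N] m by simp
          moreover have "card N \<le> L" using card_mono[OF slots.finite_slots N] by (simp add: L_def)
          ultimately show ?thesis using a by simp
        qed simp
        finally show "slots.coord (\<lambda>k. D (fst k)) (\<Sum>j\<in>{..J}. fscale (a j) (act_tensor scale I V \<pi> (?g j) T)) N =
          slots.coord (\<lambda>k. D (fst k)) 0 N" by (simp add: slots.coord_def)
      qed
      moreover have "h (\<Sum>j\<in>{..J}. fscale (a j) (act_tensor scale I V \<pi> (?g j) T)) =
          (\<Sum>j\<in>{..J}. fscale (a j) (h (act_tensor scale I V \<pi> (?g j) T)))"
        using schur_tensor_act[OF g T(1)]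
        by (intro linear_on_sum[OF vector_space_fscale vector_space_fscale M h(2)]) auto
      moreover have "h 0 = 0"
        using linear_on_scale[OF h(2) fs.subspace_0[OF M], of 0] by (simp only: fs.scale_zero_left)
      ultimately have "(\<Sum>j\<in>{..J}. fscale (a j) (act_poly scale I V (?g j) q)) = 0"
        using h(3)[OF g T(1)] T(2) by simp
      then have "(\<Sum>j\<in>{..J}. fscale (a j) (act_poly scale I V (?g j) q)) A = 0" by simp
      \<comment> \<open>The same combination of translates of \<open>q\<close>, evaluated at
        \<open>A\<close>, isolates the coefficient of \<open>t ^ m\<close> of \<open>q\<close> along
        the orbit.\<close>
      then have "0 = (\<Sum>j\<le>J. a j * q (At (2 ^ j)))"
        using AF by (simp add: sum_fun_apply act_poly_def At_def)
      also have "\<dots> = (\<Sum>P\<in>Pow {..<d}. (\<Sum>j\<le>J. a j * ((2 ^ j) ^ card P)) * ?b P)"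
        unfolding q_orbit sum_distrib_left sum_distrib_right by (subst sum.swap) (simp add: mult.assoc)
      also have "\<dots> = (\<Sum>P\<in>{P \<in> Pow {..<d}. card P = m}. (\<Sum>j\<le>J. a j * ((2 ^ j) ^ card P)) * ?b P)"
      proof (rule sum.mono_neutral_right)
        show "\<forall>P\<in>Pow {..<d} - {P \<in> Pow {..<d}. card P = m}. (\<Sum>j\<le>J. a j * ((2 ^ j) ^ card P)) * ?b P = 0"
          using a cardP by (auto simp: L_def trans_le_add1)
      qed auto
      also have "\<dots> = (\<Sum>j\<le>J. a j * ((2 ^ j) ^ m)) * ?c m"
        by (simp add: sum_distrib_left)
      finally show ?thesis using a[OF mL] by simp
    qed
    have "q A = (\<Sum>P\<in>Pow {..<d}. ?b P)" using q_orbit[of 1] A1 by simp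
    also have "\<dots> = (\<Sum>m\<in>{..d}. ?c m)"
      using cardP by (intro sum.group[symmetric]) auto
    also have "\<dots> = 0" using coeff by simp
    finally show ?thesis .
  qed
  show ?thesis
    using p unfolding isotypic_component_def
  proof (induction rule: fs.span_induct_alt)
    case base
    then show ?case by simp
  next
    case (step c x y)
    then have "x A = 0" using orbit by blast
    then show ?case using step.IH by simp
  qed
qed

end

section \<open>Injectivity of the contraction\<close>

context tensor_type
begin

text \<open>Pigeonhole: with fewer than \<open>r * card Q\<close> marked cells, some factor in
  \<open>Q\<close> has fewer than \<open>r\<close> of them, and there every outer product has a
  vanishing factor.\<close>

lemma coord_schur_tensor_weight:
  assumes Q: "Q \<subseteq> I"
    and small: "\<And>i T C. i \<in> Q \<Longrightarrow> T \<in> schur_module scale (\<pi> i) (V i) \<Longrightarrow> C \<subseteq> cells (\<pi> i) \<Longrightarrow> card C < r \<Longrightarrow>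
      T (\<lambda>c\<in>cells (\<pi> i). D i (c \<in> C)) = 0"
    and T: "T \<in> schur_tensor scale I V \<pi>" and N: "N \<subseteq> slots"
    and nz: "slots.coord (\<lambda>k. D (fst k)) T N \<noteq> 0"
  shows "r * card Q \<le> card N"
proof (rule ccontr)
  assume less: "\<not> r * card Q \<le> card N"
  let ?N = "\<lambda>i. {c \<in> cells (\<pi> i). (i, c) \<in> N}"
  have fin: "finite Q" "finite N" "finite (?N i)" for i
    using Q N finite_slots slots.finite_slots finite_cells by (auto intro: finite_subset)
  have "\<exists>i\<in>Q. card (?N i) < r"
  proof (rule ccontr)
    assume "\<not> (\<exists>i\<in>Q. card (?N i) < r)"
    then have "r * card Q \<le> (\<Sum>i\<in>Q. card (?N i))"
      using sum_bounded_below[of Q r "\<lambda>i. card (?N i)"] by (simp add: mult.commute not_less)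
    also have "\<dots> = card (Sigma Q ?N)" using fin by simp
    also have "\<dots> \<le> card N" using fin by (intro card_mono) auto
    finally show False using less by simp
  qed
  then obtain i where i: "i \<in> Q" "card (?N i) < r" by blast
  have "slots.coord (\<lambda>k. D (fst k)) T N = 0"
    using T unfolding schur_tensor_def
  proof (induction rule: fs.span_induct_alt)
    case base
    then show ?case by (simp add: slots.coord_def)
  next
    case (step c T S)
    then obtain Ti where Ti: "\<And>i. i \<in> I \<Longrightarrow> Ti i \<in> schur_module scale (\<pi> i) (V i)"
      and T: "T = outer_product scale I V \<pi> Ti" by auto
    have "(\<lambda>c\<in>cells (\<pi> i). (\<lambda>k\<in>slots. D (fst k) (k \<in> N)) (i, c)) = (\<lambda>c\<in>cells (\<pi> i). D i (c \<in> ?N i))"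
      using i Q by (auto simp: fun_eq_iff)
    then have "Ti i (\<lambda>c\<in>cells (\<pi> i). (\<lambda>k\<in>slots. D (fst k) (k \<in> N)) (i, c)) = 0"
      using small[OF i(1) Ti, of "?N i"] i Q by auto
    then have "(\<Prod>i\<in>I. Ti i (\<lambda>c\<in>cells (\<pi> i). (\<lambda>k\<in>slots. D (fst k) (k \<in> N)) (i, c))) = 0"
      using i Q by (intro prod_zero[OF finite_slots]) blast
    then have "slots.coord (\<lambda>k. D (fst k)) T N = 0"
      unfolding slots.coord_def T outer_product_def by (simp only: if_cancel)
    then show ?case using step.IH by (simp add: slots.coord_def)
  qed
  then show False using nz by simp
qed

lemma schur_tensor_row_symmetric:
  assumes T: "T \<in> schur_tensor scale I V \<pi>" and \<phi>: "\<phi> \<in> covectors scale I V \<pi>"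
    and ab: "a \<in> slots" "b \<in> slots" "fst a = fst b" "fst (snd a) = fst (snd b)"
  shows "T (\<phi> \<circ> transpose a b) = T \<phi>"
  using T unfolding schur_tensor_def
proof (induction rule: fs.span_induct_alt)
  case base
  then show ?case by simp
next
  case (step z T S)
  then obtain Ti where Ti: "\<And>i. i \<in> I \<Longrightarrow> Ti i \<in> schur_module scale (\<pi> i) (V i)"
    and T: "T = outer_product scale I V \<pi> Ti" by auto
  obtain i c c' where abc: "a = (i, c)" "b = (i, c')" "i \<in> I" "c \<in> cells (\<pi> i)" "c' \<in> cells (\<pi> i)" "fst c = fst c'"
    using ab by (cases a; cases b) auto
  have "\<phi> \<circ> transpose a b \<in> covectors scale I V \<pi>"
    using \<phi> abc by (auto simp: covectors_eq PiE_iff extensional_def transpose_def)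
  moreover have "Ti l (\<lambda>x\<in>cells (\<pi> l). (\<phi> \<circ> transpose a b) (l, x)) = Ti l (\<lambda>x\<in>cells (\<pi> l). \<phi> (l, x))"
    if l: "l \<in> I" for l
  proof (cases "l = i")
    case True
    have "(\<lambda>x\<in>cells (\<pi> i). (\<phi> \<circ> transpose a b) (i, x)) = (\<lambda>x\<in>cells (\<pi> i). \<phi> (i, x)) \<circ> transpose c c'"
      using abc by (auto simp: fun_eq_iff transpose_def)
    then show ?thesis
      using schur_module_row_symmetric[OF Ti[OF abc(3)] transpose_row_group[OF abc(4,5,6)]] True by simp
  next
    case False
    then have "(\<lambda>x\<in>cells (\<pi> l). (\<phi> \<circ> transpose a b) (l, x)) = (\<lambda>x\<in>cells (\<pi> l). \<phi> (l, x))"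
      using abc by (auto simp: fun_eq_iff transpose_def)
    then show ?thesis by simp
  qed
  ultimately have "T (\<phi> \<circ> transpose a b) = T \<phi>"
    using \<phi> by (simp add: T outer_product_def)
  then show ?case using step.IH by (simp only: plus_fun_apply fscale_apply)
qed

text \<open>The coefficients of the polynomial of \<open>T\<close> on a pencil of two decomposable forms are, up to the
  factor in the assumption \<open>scalar\<close>, the values of \<open>T\<close> at arguments that are constant on rows. By
  polarization along the rows, these values determine \<open>T\<close>.\<close>

lemma contraction_poly_injective:
  assumes Q: "\<And>i. i \<in> I \<Longrightarrow> (0, 0) \<in> cells (\<pi> i)" "\<And>i. i \<in> I \<inter> Q \<Longrightarrow> (1, 0) \<in> cells (\<pi> i)"
    "\<And>i c. i \<in> I \<Longrightarrow> c \<in> cells (\<pi> i) \<Longrightarrow> fst c = 0 \<or> fst c = 1 \<and> i \<in> Q"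
    and fill: "\<And>i f P S. i \<in> I \<Longrightarrow> P \<subseteq> {..<d} \<Longrightarrow> card P = r \<Longrightarrow> S \<in> schur_module scale (\<pi> i) (V i) \<Longrightarrow>
      (i \<notin> Q \<Longrightarrow> f True = f False) \<Longrightarrow>
      S (\<lambda>c\<in>cells (\<pi> i). f (c \<in> \<gamma> i ` P)) = \<omega> i P * S (\<lambda>c\<in>cells (\<pi> i). f (fst c = 1))"
    and scalar: "(\<Sum>P\<in>{P \<in> Pow {..<d}. card P = r}. \<Prod>i\<in>I. \<omega> i P) \<noteq> 0"
    and T: "T \<in> schur_tensor scale I V \<pi>" and z: "contraction_poly T = 0"
  shows "T = 0"
proof -
  have TT: "T \<in> slots.tensors" using T schur_tensor_tensors by blast
  have std: "T (\<lambda>(i, c)\<in>slots. f i (fst c = 1)) = 0"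
    if f: "\<And>i b. i \<in> I \<Longrightarrow> f i b \<in> dual_space scale (V i)" "\<And>i. i \<in> I \<Longrightarrow> i \<notin> Q \<Longrightarrow> f i True = f i False" for f
  proof -
    \<comment> \<open>Each factor contributes its own \<open>\<omega> i P\<close>, so every set
      \<open>P\<close> of copies yields a multiple of the same value, and the vanishing sum over
      \<open>P\<close> becomes a nonzero scalar times that value.\<close>
    have "T (\<lambda>(i, c)\<in>slots. f i (label i c \<in> P)) = (\<Prod>i\<in>I. \<omega> i P) * T (\<lambda>(i, c)\<in>slots. f i (fst c = 1))"
      if P: "P \<subseteq> {..<d}" "card P = r" for P
      using T unfolding schur_tensor_def
    proof (induction rule: fs.span_induct_alt)
      case base
      then show ?case by simp
    next
      case (step z T S)
      then obtain Ti where Ti: "\<And>i. i \<in> I \<Longrightarrow> Ti i \<in> schur_module scale (\<pi> i) (V i)"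
        and T: "T = outer_product scale I V \<pi> Ti" by auto
      have cov: "(\<lambda>(i, c)\<in>slots. f i (g i c)) \<in> covectors scale I V \<pi>" for g
        using f(1) by (auto simp: covectors_eq)
      have "Ti i (\<lambda>c\<in>cells (\<pi> i). (\<lambda>(i, c)\<in>slots. f i (label i c \<in> P)) (i, c)) =
        \<omega> i P * Ti i (\<lambda>c\<in>cells (\<pi> i). (\<lambda>(i, c)\<in>slots. f i (fst c = 1)) (i, c))" if i: "i \<in> I" for i
      proof -
        have "label i c \<in> P \<longleftrightarrow> c \<in> \<gamma> i ` P" if "c \<in> cells (\<pi> i)" for c
          using that i P cell_label[OF i that] label_cell[OF i] by (metis imageE imageI lessThan_iff subsetD)
        then have "(\<lambda>c\<in>cells (\<pi> i). (\<lambda>(i, c)\<in>slots. f i (label i c \<in> P)) (i, c)) =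
            (\<lambda>c\<in>cells (\<pi> i). f i (c \<in> \<gamma> i ` P))"
          and "(\<lambda>c\<in>cells (\<pi> i). (\<lambda>(i, c)\<in>slots. f i (fst c = 1)) (i, c)) =
            (\<lambda>c\<in>cells (\<pi> i). f i (fst c = 1))" using i by (auto simp: fun_eq_iff)
        then show ?thesis using fill[OF i P Ti[OF i], of "f i"] f(2)[OF i] by simp
      qed
      then have "T (\<lambda>(i, c)\<in>slots. f i (label i c \<in> P)) = (\<Prod>i\<in>I. \<omega> i P) * T (\<lambda>(i, c)\<in>slots. f i (fst c = 1))"
        by (simp add: T outer_product_def cov prod.distrib)
      then show ?case
        using step.IH by (simp only: plus_fun_apply fscale_apply distrib_left mult.left_commute)
    qed
    then have "(\<Sum>P\<in>{P \<in> Pow {..<d}. card P = r}. \<Prod>i\<in>I. \<omega> i P) * T (\<lambda>(i, c)\<in>slots. f i (fst c = 1)) =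
      (\<Sum>P\<in>{P \<in> Pow {..<d}. card P = r}. T (\<lambda>(i, c)\<in>slots. f i (label i c \<in> P)))"
      by (simp add: sum_distrib_right)
    also have "\<dots> = 0" by (rule contraction_poly_pencil[OF TT z f(1)])
    finally show ?thesis using scalar by simp
  qed
  let ?\<rho> = "\<lambda>k::'i \<times> nat \<times> nat. (fst k, fst (snd k))"
  show ?thesis
  proof
    fix \<phi>
    show "T \<phi> = 0 \<phi>"
    proof (cases "\<phi> \<in> Pi\<^sub>E slots (\<lambda>k. dual_space scale (V (fst k)))")
      case True
      have "T \<phi> = 0"
      proof (rule symmetric_zero_on_blocks[OF TT vector_space_fscale subspace_dual_space slots.finite_slots,
            where \<rho> = ?\<rho> and J = "?\<rho> ` slots"])
        show "dual_space scale (V (fst k)) = dual_space scale (V (fst l))" if "?\<rho> k = ?\<rho> l" for k l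
          using that by simp
        show "T (x \<circ> transpose a b) = T x" if "a \<in> slots" "b \<in> slots" "?\<rho> a = ?\<rho> b"
            "x \<in> Pi\<^sub>E slots (\<lambda>k. dual_space scale (V (fst k)))" for a b x
          using that by (intro schur_tensor_row_symmetric[OF T]) (auto simp: covectors_eq)
        show "finite (?\<rho> ` slots)" using slots.finite_slots by simp
        show "\<phi> \<in> Pi\<^sub>E slots (\<lambda>k. dual_space scale (V (fst k)))" by fact
        fix x assume x: "x \<in> Pi\<^sub>E slots (\<lambda>k. dual_space scale (V (fst k)))"
          "\<And>a b. a \<in> slots \<Longrightarrow> b \<in> slots \<Longrightarrow> ?\<rho> a = ?\<rho> b \<Longrightarrow> ?\<rho> a \<in> ?\<rho> ` slots \<Longrightarrow> x a = x b"
        have x2: "x a = x b" if "a \<in> slots" "b \<in> slots" "?\<rho> a = ?\<rho> b" for a b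
          by (rule x(2)[OF that imageI[OF that(1)]])
        \<comment> \<open>\<open>x\<close> is constant on rows, so its values at the first cells of
          the rows determine it. A factor outside \<open>Q\<close> has one row only, and both values
          of \<open>f i\<close> are taken from it.\<close>
        define f where "f = (\<lambda>i b. x (i, if b \<and> i \<in> Q then (1, 0) else (0, 0)))"
        have "x = (\<lambda>(i, c)\<in>slots. f i (fst c = 1))"
        proof
          fix k :: "'i \<times> nat \<times> nat"
          obtain i c where k: "k = (i, c)" by (cases k)
          show "x k = (\<lambda>(i, c)\<in>slots. f i (fst c = 1)) k"
          proof (cases "k \<in> slots")
            case True
            then have ic: "i \<in> I" "c \<in> cells (\<pi> i)" by (auto simp: k)
            have "x (i, c) = x (i, if fst c = 1 \<and> i \<in> Q then (1, 0) else (0, 0))"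
              by (rule x2) (use ic Q(1)[OF ic(1)] Q(2)[of i] Q(3)[OF ic] in \<open>auto split: if_splits\<close>)
            then show ?thesis using True by (simp add: k f_def)
          next
            case False
            then show ?thesis using PiE_arb[OF x(1) False] by simp
          qed
        qed
        moreover have "f i b \<in> dual_space scale (V i)" if "i \<in> I" for i b
        proof -
          have "(i, if b \<and> i \<in> Q then (1, 0) else (0, 0)) \<in> slots"
            using that Q(1)[OF that] Q(2)[of i] by auto
          from PiE_mem[OF x(1) this] show ?thesis by (simp add: f_def)
        qed
        ultimately show "T x = 0" using std[of f] by (auto simp: f_def)
      qed
      then show ?thesis by simp
    next
      case False
      then show ?thesis using multilinear_forms_outside[OF TT] by simp
    qed
  qed
qed

end

section \<open>Explicit elements of the Schur modules\<close>

lemma evaluation_tensor_power: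
  assumes y: "\<And>c. c \<in> C \<Longrightarrow> y c \<in> W" and C: "finite C"
  shows "rank_one C (\<lambda>_. dual_space s W) (\<lambda>c u. if u \<in> dual_space s W then u (y c) else 0)
    \<in> tensor_power s C W"
  unfolding tensor_power_def
proof (rule rank_one_multilinear[OF vector_space_fscale subspace_dual_space C])
  fix c assume "c \<in> C"
  show "(\<lambda>u. if u \<in> dual_space s W then u (y c) else 0) \<in> dual_space fscale (dual_space s W)"
    by (intro dual_spaceI)
      (simp_all add: fs.subspace_add[OF subspace_dual_space] fs.subspace_scale[OF subspace_dual_space])
qed

lemma fill21_in: "x \<in> X \<Longrightarrow> y \<in> X \<Longrightarrow> z \<in> X \<Longrightarrow> fill21 x y z \<in> Pi\<^sub>E (cells [2, 1]) (\<lambda>_. X)"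
  by (simp add: fill21_def)

lemma fill22_in:
  "x \<in> X \<Longrightarrow> y \<in> X \<Longrightarrow> z \<in> X \<Longrightarrow> w \<in> X \<Longrightarrow> fill22 x y z w \<in> Pi\<^sub>E (cells [2, 2]) (\<lambda>_. X)"
  by (simp add: fill22_def)

text \<open>The Young symmetrizer is applied to the decomposable tensor with \<open>e\<close> in the
  first row and \<open>f\<close> in the second. Both vectors are arbitrary, so that the base point
  of the coordinates can be moved later.\<close>

lemma schur_module_21_highest_weight:
  assumes "e \<in> W" "f \<in> W"
  obtains T where "T \<in> schur_module s [2, 1] W"
    "\<And>x y z. x \<in> dual_space s W \<Longrightarrow> y \<in> dual_space s W \<Longrightarrow> z \<in> dual_space s W \<Longrightarrow>
      T (fill21 x y z) = 2 * x e * y e * z f - x f * y e * z e - x e * y f * z e"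
proof
  let ?S = "rank_one (cells [2, 1]) (\<lambda>_. dual_space s W)
    (\<lambda>c u. if u \<in> dual_space s W then u (if fst c = 1 then f else e) else 0)"
  show "young_symmetrizer [2, 1] ?S \<in> schur_module s [2, 1] W"
    unfolding schur_module_def using assms by (intro imageI evaluation_tensor_power finite_cells) auto
  fix x y z assume xyz: "x \<in> dual_space s W" "y \<in> dual_space s W" "z \<in> dual_space s W"
  have S: "?S (fill21 u v w) = u e * v e * w f"
    if "u \<in> dual_space s W" "v \<in> dual_space s W" "w \<in> dual_space s W" for u v w
    using that fill21_in[OF that] unfolding rank_one_def
    by (simp only: if_True) (simp add: fill21_def cells_21_Suc)
  show "young_symmetrizer [2, 1] ?S (fill21 x y z) = 2 * x e * y e * z f - x f * y e * z e - x e * y f * z e"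
    unfolding young_symmetrizer_21 by (simp add: S xyz del: One_nat_def)
qed

lemma schur_module_22_highest_weight:
  assumes "e \<in> W" "f \<in> W"
  obtains T where "T \<in> schur_module s [2, 2] W"
    "\<And>x y z w. x \<in> dual_space s W \<Longrightarrow> y \<in> dual_space s W \<Longrightarrow> z \<in> dual_space s W \<Longrightarrow> w \<in> dual_space s W \<Longrightarrow>
      T (fill22 x y z w) = 4 * x e * y e * z f * w f + 4 * x f * y f * z e * w e - 2 * x e * y f * z f * w e
        - 2 * x f * y e * z e * w f - 2 * x e * y f * z e * w f - 2 * x f * y e * z f * w e"
proof
  let ?S = "rank_one (cells [2, 2]) (\<lambda>_. dual_space s W)
    (\<lambda>c u. if u \<in> dual_space s W then u (if fst c = 1 then f else e) else 0)"
  show "young_symmetrizer [2, 2] ?S \<in> schur_module s [2, 2] W"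
    unfolding schur_module_def using assms by (intro imageI evaluation_tensor_power finite_cells) auto
  fix x y z w assume xyz: "x \<in> dual_space s W" "y \<in> dual_space s W" "z \<in> dual_space s W" "w \<in> dual_space s W"
  have S: "?S (fill22 u v t r) = u e * v e * t f * r f"
    if "u \<in> dual_space s W" "v \<in> dual_space s W" "t \<in> dual_space s W" "r \<in> dual_space s W" for u v t r
    using that fill22_in[OF that] unfolding rank_one_def
    by (simp only: if_True) (simp add: fill22_def cells_22)
  show "young_symmetrizer [2, 2] ?S (fill22 x y z w) =
    4 * x e * y e * z f * w f + 4 * x f * y f * z e * w e - 2 * x e * y f * z f * w e
        - 2 * x f * y e * z e * w f - 2 * x e * y f * z e * w f - 2 * x f * y e * z f * w e"
    unfolding young_symmetrizer_22 by (simp add: S xyz)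
qed

text \<open>For a single row the symmetrizer only multiplies the power of \<open>e\<close> by the
  number of row permutations, which is the nonzero \<rho>.\<close>

lemma schur_module_row_highest_weight:
  assumes "e \<in> W"
  obtains T and \<rho> :: complex where "T \<in> schur_module s [m, 0] W" "\<rho> \<noteq> 0"
    "\<And>\<phi>. \<phi> \<in> Pi\<^sub>E (cells [m, 0]) (\<lambda>_. dual_space s W) \<Longrightarrow> T \<phi> = \<rho> * (\<Prod>c\<in>cells [m, 0]. \<phi> c e)"
proof
  let ?S = "rank_one (cells [m, 0]) (\<lambda>_. dual_space s W) (\<lambda>c u. if u \<in> dual_space s W then u e else 0)"
  show "young_symmetrizer [m, 0] ?S \<in> schur_module s [m, 0] W"
    unfolding schur_module_def using assms by (intro imageI evaluation_tensor_power finite_cells)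
  have "finite (row_group [m, 0])"
    by (rule finite_subset[OF _ finite_permutations[OF finite_cells[of "[m, 0]"]]]) (auto simp: row_group_def)
  moreover have "id \<in> row_group [m, 0]" by (simp add: row_group_def permutes_id)
  ultimately show "(of_nat (card (row_group [m, 0])) :: complex) \<noteq> 0" by auto
  fix \<phi> assume \<phi>: "\<phi> \<in> Pi\<^sub>E (cells [m, 0]) (\<lambda>_. dual_space s W)"
  have "?S (\<phi> \<circ> \<sigma>) = (\<Prod>c\<in>cells [m, 0]. \<phi> c e)" if "\<sigma> \<in> row_group [m, 0]" for \<sigma>
  proof -
    have p: "\<sigma> permutes cells [m, 0]" using that by (simp add: row_group_def)
    have in': "\<phi> \<circ> \<sigma> \<in> Pi\<^sub>E (cells [m, 0]) (\<lambda>_. dual_space s W)"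
      by (simp only: permute_PiE_iff[OF p] \<phi>)
    then have "?S (\<phi> \<circ> \<sigma>) = (\<Prod>c\<in>cells [m, 0]. (\<phi> \<circ> \<sigma>) c e)"
      unfolding rank_one_def by (simp only: if_True) (auto intro!: prod.cong)
    also have "\<dots> = (\<Prod>c\<in>cells [m, 0]. \<phi> c e)"
      using prod.permute[OF p, of "\<lambda>c. \<phi> c e"] by (simp add: o_def)
    finally show ?thesis .
  qed
  then show "young_symmetrizer [m, 0] ?S \<phi> = of_nat (card (row_group [m, 0])) * (\<Prod>c\<in>cells [m, 0]. \<phi> c e)"
    by (simp add: young_symmetrizer_def col_group_row)
qed

lemma sum_PiE_insert:
  fixes g :: "('i \<Rightarrow> 'b) \<Rightarrow> 'c::comm_monoid_add"
  assumes "q \<notin> X"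
  shows "(\<Sum>f\<in>Pi\<^sub>E (insert q X) S. g f) = (\<Sum>y\<in>S q. \<Sum>f\<in>Pi\<^sub>E X S. g (f(q := y)))"
proof -
  have "(\<Sum>f\<in>Pi\<^sub>E (insert q X) S. g f) = (\<Sum>(y, f)\<in>S q \<times> Pi\<^sub>E X S. g (f(q := y)))"
    unfolding PiE_insert_eq by (subst sum.reindex[OF inj_combinator[OF assms]]) (simp add: case_prod_beta o_def)
  then show ?thesis by (simp add: sum.cartesian_product)
qed

section \<open>The cubics and quartics in coordinates\<close>

text \<open>In the cubic for four factors, the cell in the second row is matched with the third copy of the
  form for two of the factors, and with the second copy for the other two.\<close>

definition cell_list :: "bool \<Rightarrow> nat \<Rightarrow> nat \<times> nat" where
  "cell_list b j = (if b then [(0, 0), (1, 0), (0, 1)] else [(0, 0), (0, 1), (1, 0)]) ! j"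

definition cell_square :: "nat \<Rightarrow> nat \<times> nat" where
  "cell_square j = [(0, 0), (0, 1), (1, 0), (1, 1)] ! j"

lemma lessThan_3: "{..<3} = {0, 1, 2 :: nat}"
  by auto

lemma lessThan_4: "{..<4} = {0, 1, 2, 3 :: nat}"
  by auto

lemma bij_cell_list: "bij_betw (cell_list b) {..<3} (cells [2, 1])"
  unfolding lessThan_3 cells_21 by (cases b) (auto simp: bij_betw_def inj_on_def cell_list_def)

lemma bij_cell_square: "bij_betw cell_square {..<4} (cells [2, 2])"
  unfolding lessThan_4 cells_22 by (auto simp: bij_betw_def inj_on_def cell_square_def)

lemma bij_cell_row: "bij_betw (Pair 0) {..<m} (cells [m, 0])"
  unfolding cells_row by (auto simp: bij_betw_def inj_on_def)

lemma singletons_3: "{P \<in> Pow {..<3}. card P = 1} = {{0}, {1}, {2 :: nat}}"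
  by (auto simp: card_1_singleton_iff)

lemma pairs_4: "{P \<in> Pow {..<4}. card P = 2} = {{0, 1}, {2, 3}, {0, 2}, {0, 3}, {1, 2}, {1, 3 :: nat}}"
proof (intro equalityI subsetI)
  fix P :: "nat set" assume "P \<in> {P \<in> Pow {..<4}. card P = 2}"
  then obtain a b where P: "P = {a, b}" "a \<noteq> b" "a \<in> {0, 1, 2, 3}" "b \<in> {0, 1, 2, 3}"
    unfolding lessThan_4 by (auto simp: card_2_iff)
  from P(3,4,2) show "P \<in> {{0, 1}, {2, 3}, {0, 2}, {0, 3}, {1, 2}, {1, 3}}"
    unfolding P(1) by (elim insertE emptyE) (simp_all add: doubleton_eq_iff)
qed auto

lemma types_withD:
  assumes "\<pi> \<in> types_with I k \<mu> \<nu>" "i \<in> I"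
  shows "\<pi> i = \<mu> \<or> \<pi> i = \<nu>" "card {i \<in> I. \<pi> i = \<mu>} = k"
  using assms by (auto simp: types_with_def PiE_iff)

lemma tensor_type_cubic:
  assumes "planes scale I V" "planes.bases scale I V E D" "\<pi> \<in> types_with I 4 [2, 1] [3, 0]"
  shows "tensor_type scale I V \<pi> 3 (\<lambda>i. if \<pi> i = [2, 1] then cell_list False else Pair 0) E D"
proof -
  interpret planes scale I V by fact
  show ?thesis
  proof (rule tensor_type.intro[OF assms(1)], unfold_locales)
    fix i assume "i \<in> I"
    with types_withD(1)[OF assms(3)] have "\<pi> i = [2, 1] \<or> \<pi> i = [3, 0]" .
    then show "bij_betw (if \<pi> i = [2, 1] then cell_list False else Pair 0) {..<3} (cells (\<pi> i))"
      using bij_cell_list bij_cell_row[of 3] by auto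
  qed fact
qed

lemma tensor_type_quartic:
  assumes "planes scale I V" "planes.bases scale I V E D" "\<pi> \<in> types_with I 3 [2, 2] [4, 0]"
  shows "tensor_type scale I V \<pi> 4 (\<lambda>i. if \<pi> i = [2, 2] then cell_square else Pair 0) E D"
proof -
  interpret planes scale I V by fact
  show ?thesis
  proof (rule tensor_type.intro[OF assms(1)], unfold_locales)
    fix i assume "i \<in> I"
    with types_withD(1)[OF assms(3)] have "\<pi> i = [2, 2] \<or> \<pi> i = [4, 0]" .
    then show "bij_betw (if \<pi> i = [2, 2] then cell_square else Pair 0) {..<4} (cells (\<pi> i))"
      using bij_cell_square bij_cell_row[of 4] by auto
  qed fact
qed

section \<open>Relations between the coordinates of a common zero\<close>

context planes
begin

definition isotypic_zeros where
  "isotypic_zeros = {A \<in> forms.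
     (\<forall>\<pi>\<in>types_with K 4 [2, 1] [3, 0]. \<forall>p\<in>isotypic_component scale K U 3 \<pi>. p A = 0) \<and>
     (\<forall>\<pi>\<in>types_with K 3 [2, 2] [4, 0]. \<forall>p\<in>isotypic_component scale K U 4 \<pi>. p A = 0)}"

text \<open>A constant filling of \<open>[2, 1]\<close> gives zero, so each such factor has a marked
  cell; a factor \<open>[2, 2]\<close> has at least two, since three equal entries give zero. Four
  and three such factors push the weights beyond the degrees 3 and 4.\<close>

lemma tangent_forms_isotypic_zeros:
  assumes B: "bases E D" and A: "A \<in> tangent_forms E"
  shows "A \<in> isotypic_zeros"
  unfolding isotypic_zeros_def
proof (intro CollectI conjI ballI)
  show "A \<in> forms" using A by (simp add: tangent_forms_def)
next
  fix \<pi> p assume \<pi>: "\<pi> \<in> types_with K 4 [2, 1] [3, 0]" and p: "p \<in> isotypic_component scale K U 3 \<pi>"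
  interpret t: tensor_type scale K U \<pi> 3 "\<lambda>i. if \<pi> i = [2, 1] then cell_list False else Pair 0" E D
    by (rule tensor_type_cubic[OF planes_axioms B \<pi>])
  have "T (\<lambda>c\<in>cells (\<pi> i). D i (c \<in> C)) = 0"
    if "i \<in> {i \<in> K. \<pi> i = [2, 1]}" "T \<in> schur_module scale (\<pi> i) (U i)" "C \<subseteq> cells (\<pi> i)" "card C < 1" for i T C
  proof -
    have "C = {}" using that finite_cells[of "\<pi> i"] finite_subset[of C] by auto
    then show ?thesis using that schur_module_21_constant by auto
  qed
  note small = this
  have w: "4 \<le> card N" if "T \<in> schur_tensor scale K U \<pi>" "N \<subseteq> t.slots"
    "t.slots.coord (\<lambda>k. D (fst k)) T N \<noteq> 0" for T N
  proof -
    have "1 * card {i \<in> K. \<pi> i = [2, 1]} \<le> card N"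
      by (rule t.coord_schur_tensor_weight[OF _ _ that]) (use small in auto)
    then show ?thesis using \<pi> by (simp add: types_with_def)
  qed
  show "p A = 0"
  proof (rule t.isotypic_zero_on_tangent_forms[OF _ A p])
    show "3 < card N" if "T \<in> schur_tensor scale K U \<pi>" "N \<subseteq> t.slots"
      "t.slots.coord (\<lambda>k. D (fst k)) T N \<noteq> 0" for T N
      using w[OF that] by simp
  qed
next
  fix \<pi> p assume \<pi>: "\<pi> \<in> types_with K 3 [2, 2] [4, 0]" and p: "p \<in> isotypic_component scale K U 4 \<pi>"
  interpret t: tensor_type scale K U \<pi> 4 "\<lambda>i. if \<pi> i = [2, 2] then cell_square else Pair 0" E D
    by (rule tensor_type_quartic[OF planes_axioms B \<pi>])
  have "T (\<lambda>c\<in>cells (\<pi> i). D i (c \<in> C)) = 0"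
    if "i \<in> {i \<in> K. \<pi> i = [2, 2]}" "T \<in> schur_module scale (\<pi> i) (U i)" "C \<subseteq> cells (\<pi> i)" "card C < 2" for i T C
  proof -
    have T: "T \<in> schur_module scale [2, 2] (U i)" and \<pi>i: "\<pi> i = [2, 2]" using that by auto
    have "finite C" using that finite_cells[of "\<pi> i"] finite_subset[of C] by auto
    moreover have "card C < 2" using that by simp
    ultimately consider "C = {}" | c where "C = {c}"
      by (metis card_1_singletonE card_0_eq less_2_cases One_nat_def)
    then show ?thesis
    proof cases
      case 1
      then show ?thesis
        unfolding \<pi>i fill22_cells using schur_module_22_three_equal(1)[OF T] by simp
    next
      case 2
      then have "c \<in> {(0, 0), (0, 1), (1, 0), (1, 1)}" using that(3) \<pi>i by (auto simp: cells_22)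
      then show ?thesis
        unfolding \<pi>i fill22_cells 2 using schur_module_22_three_equal[OF T]
        by (elim insertE emptyE) simp_all
    qed
  qed
  note small = this
  have w: "6 \<le> card N" if "T \<in> schur_tensor scale K U \<pi>" "N \<subseteq> t.slots"
    "t.slots.coord (\<lambda>k. D (fst k)) T N \<noteq> 0" for T N
  proof -
    have "2 * card {i \<in> K. \<pi> i = [2, 2]} \<le> card N"
      by (rule t.coord_schur_tensor_weight[OF _ _ that]) (use small in auto)
    then show ?thesis using \<pi> by (simp add: types_with_def)
  qed
  show "p A = 0"
  proof (rule t.isotypic_zero_on_tangent_forms[OF _ A p])
    show "4 < card N" if "T \<in> schur_tensor scale K U \<pi>" "N \<subseteq> t.slots"
      "t.slots.coord (\<lambda>k. D (fst k)) T N \<noteq> 0" for T N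
      using w[OF that] by simp
  qed
qed

text \<open>Factors outside \<open>Q\<close> can only choose the empty set, that is the vector
  \<open>y k False\<close> in all copies, and so never enter the index sets of the
  coordinates.\<close>

lemma sum_PiE_support:
  assumes Q: "Q \<subseteq> K"
  shows "(\<Sum>P\<in>Pi\<^sub>E K (\<lambda>k. if k \<in> Q then \<S> else {{}}). (\<Prod>k\<in>Q. w k (P k)) * (\<Prod>j<d. coord y A {k \<in> K. j \<in> P k})) =
    (\<Sum>P\<in>Pi\<^sub>E Q (\<lambda>_. \<S>). (\<Prod>k\<in>Q. w k (P k)) * (\<Prod>j<d. coord y A {k \<in> Q. j \<in> P k}))"
proof (rule sum.reindex_bij_witness[where j = "\<lambda>P. restrict P Q" and
      i = "\<lambda>P. \<lambda>k\<in>K. if k \<in> Q then P k else {}"])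
  fix P assume P: "P \<in> Pi\<^sub>E K (\<lambda>k. if k \<in> Q then \<S> else {{}})"
  then have P': "P k = {}" if "k \<in> K" "k \<notin> Q" for k using that PiE_mem[OF P that(1)] by simp
  show "(\<lambda>k\<in>K. if k \<in> Q then restrict P Q k else {}) = P"
    using P P' by (auto simp: fun_eq_iff PiE_iff extensional_def restrict_def)
  show "restrict P Q \<in> Pi\<^sub>E Q (\<lambda>_. \<S>)" using P Q by (fastforce simp: PiE_iff)
  have "{k \<in> K. j \<in> P k} = {k \<in> Q. j \<in> restrict P Q k}" for j using P' Q by auto
  then show "(\<Prod>k\<in>Q. w k (restrict P Q k)) * (\<Prod>j<d. coord y A {k \<in> Q. j \<in> restrict P Q k}) =
      (\<Prod>k\<in>Q. w k (P k)) * (\<Prod>j<d. coord y A {k \<in> K. j \<in> P k})" by simp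
next
  fix P assume P: "P \<in> Pi\<^sub>E Q (\<lambda>_. \<S>)"
  then show "restrict (\<lambda>k\<in>K. if k \<in> Q then P k else {}) Q = P"
    using Q by (auto simp: fun_eq_iff PiE_iff extensional_def restrict_def)
  show "(\<lambda>k\<in>K. if k \<in> Q then P k else {}) \<in> Pi\<^sub>E K (\<lambda>k. if k \<in> Q then \<S> else {{}})"
    using P by (auto simp: PiE_iff)
qed

text \<open>The chosen elements of the Schur modules at the factors in \<open>Q\<close> are
  completed by powers of \<open>y k False\<close> elsewhere to a Schur tensor; its contraction lies
  in the isotypic component and so vanishes at \<open>A\<close>. The assumptions \<open>fill\<close>
  and \<open>scalar\<close> make the contraction injective.\<close>

lemma isotypic_relation:
  assumes B: "bases E D" and A: "A \<in> forms" and Q: "Q \<subseteq> K" and d: "0 < d"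
    and y: "\<And>k b. k \<in> K \<Longrightarrow> y k b \<in> U k"
    and p: "\<And>\<pi> p. \<pi> \<in> types_with K (card Q) \<mu> [d, 0] \<Longrightarrow> p \<in> isotypic_component scale K U d \<pi> \<Longrightarrow> p A = 0"
    and \<mu>: "\<mu> \<noteq> [d, 0]" "(0, 0) \<in> cells \<mu>" "(1, 0) \<in> cells \<mu>" "\<And>c. c \<in> cells \<mu> \<Longrightarrow> fst c = 0 \<or> fst c = 1"
    and \<gamma>: "\<And>k. k \<in> Q \<Longrightarrow> bij_betw (\<gamma> k) {..<d} (cells \<mu>)"
    and fill: "\<And>k f P S. k \<in> Q \<Longrightarrow> P \<subseteq> {..<d} \<Longrightarrow> card P = r \<Longrightarrow> S \<in> schur_module scale \<mu> (U k) \<Longrightarrow>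
      S (\<lambda>c\<in>cells \<mu>. f (c \<in> \<gamma> k ` P)) = \<omega> k P * S (\<lambda>c\<in>cells \<mu>. f (fst c = 1))"
    and scalar: "(\<Sum>P\<in>{P \<in> Pow {..<d}. card P = r}. \<Prod>k\<in>Q. \<omega> k P) \<noteq> 0"
    and fin: "finite \<S>"
    and T: "\<And>k. k \<in> Q \<Longrightarrow> T k \<in> schur_module scale \<mu> (U k)"
    and eval: "\<And>k \<phi>. k \<in> Q \<Longrightarrow> \<phi> \<in> Pi\<^sub>E (cells \<mu>) (\<lambda>_. dual_space scale (U k)) \<Longrightarrow>
      T k \<phi> = (\<Sum>P\<in>\<S>. w k P * (\<Prod>j<d. \<phi> (\<gamma> k j) (y k (j \<in> P))))"
  shows "(\<Sum>P\<in>Pi\<^sub>E Q (\<lambda>_. \<S>). (\<Prod>k\<in>Q. w k (P k)) * (\<Prod>j<d. coord y A {k \<in> Q. j \<in> P k})) = 0"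
proof -
  define \<pi> where "\<pi> = (\<lambda>k\<in>K. if k \<in> Q then \<mu> else [d, 0])"
  have "{k \<in> K. \<pi> k = \<mu>} = Q" using Q \<mu>(1) by (auto simp: \<pi>_def)
  then have \<pi>: "\<pi> \<in> types_with K (card Q) \<mu> [d, 0]"
    unfolding types_with_def mem_Collect_eq by (auto simp: \<pi>_def)
  define \<gamma>' where "\<gamma>' = (\<lambda>k. if k \<in> Q then \<gamma> k else Pair 0)"
  have \<pi>Q: "\<pi> k = \<mu>" "\<gamma>' k = \<gamma> k" if "k \<in> Q" for k using that Q by (auto simp: \<pi>_def \<gamma>'_def)
  have \<pi>R: "\<pi> k = [d, 0]" "\<gamma>' k = Pair 0" if "k \<in> K" "k \<notin> Q" for k
    using that by (auto simp: \<pi>_def \<gamma>'_def)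
  interpret t: tensor_type scale K U \<pi> d \<gamma>' E D
  proof (rule tensor_type.intro[OF planes_axioms], unfold_locales)
    fix k assume "k \<in> K"
    then show "bij_betw (\<gamma>' k) {..<d} (cells (\<pi> k))"
      using \<gamma> bij_cell_row \<pi>Q \<pi>R by (cases "k \<in> Q") auto
  qed (rule B)
  have inj: "S = 0" if "S \<in> schur_tensor scale K U \<pi>" "t.contraction_poly S = 0" for S
  proof (rule t.contraction_poly_injective[where Q = Q and r = r and
        \<omega> = "\<lambda>k P. if k \<in> Q then \<omega> k P else 1", OF _ _ _ _ _ that])
    show "(0, 0) \<in> cells (\<pi> k)" if "k \<in> K" for k
      using \<pi>Q(1)[of k] \<pi>R(1)[OF that] \<mu>(2) d by (cases "k \<in> Q") (auto simp: cells_row)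
    show "(1, 0) \<in> cells (\<pi> k)" if "k \<in> K \<inter> Q" for k
      using \<pi>Q(1)[of k] that \<mu>(3) by auto
    show "fst c = 0 \<or> fst c = 1 \<and> k \<in> Q" if "k \<in> K" "c \<in> cells (\<pi> k)" for k c
      using that \<pi>Q(1)[of k] \<pi>R(1)[of k] \<mu>(4)[of c] by (cases "k \<in> Q") (auto simp: cells_row)
  next
    fix k S and P :: "nat set" and f :: "bool \<Rightarrow> 'a \<Rightarrow> complex"
    assume k: "k \<in> K" and P: "P \<subseteq> {..<d}" "card P = r" and S: "S \<in> schur_module scale (\<pi> k) (U k)"
      and f: "k \<notin> Q \<Longrightarrow> f True = f False"
    show "S (\<lambda>c\<in>cells (\<pi> k). f (c \<in> \<gamma>' k ` P)) =
        (if k \<in> Q then \<omega> k P else 1) * S (\<lambda>c\<in>cells (\<pi> k). f (fst c = 1))"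
    proof (cases "k \<in> Q")
      case True
      have "S \<in> schur_module scale \<mu> (U k)" using S \<pi>Q(1)[OF True] by simp
      from fill[OF True P this] show ?thesis using \<pi>Q[OF True] True by simp
    next
      case False
      then have "f b = f False" for b using f by (cases b) auto
      then have "(\<lambda>c\<in>cells (\<pi> k). f (g c)) = (\<lambda>c\<in>cells (\<pi> k). f (g' c))" for g g' by (metis restrict_ext)
      then have "S (\<lambda>c\<in>cells (\<pi> k). f (c \<in> \<gamma>' k ` P)) = S (\<lambda>c\<in>cells (\<pi> k). f (fst c = 1))"
        by (rule arg_cong)
      then show ?thesis using False by simp
    qed
  next
    have "(\<Prod>k\<in>K. if k \<in> Q then \<omega> k P else 1) = (\<Prod>k\<in>Q. \<omega> k P)" for P
      using Q finite_slots by (simp add: prod.If_cases Int_absorb1)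
    then show "(\<Sum>P\<in>{P \<in> Pow {..<d}. card P = r}. \<Prod>k\<in>K. if k \<in> Q then \<omega> k P else 1) \<noteq> 0"
      using scalar by simp
  qed
  let ?S = "\<lambda>k. if k \<in> Q then \<S> else {{}}"
  \<comment> \<open>The scalar \<rho> is the multiple of the pure power at a factor outside
    \<open>Q\<close>; at a factor in \<open>Q\<close> it is a dummy.\<close>
  let ?P = "\<lambda>k T' \<rho>. T' \<in> schur_module scale (\<pi> k) (U k) \<and> \<rho> \<noteq> 0 \<and>
      (\<forall>\<phi>\<in>Pi\<^sub>E (cells (\<pi> k)) (\<lambda>_. dual_space scale (U k)). T' \<phi> = (\<Sum>P\<in>?S k. (if k \<in> Q then w k P else \<rho>) *
        (\<Prod>j<d. \<phi> (\<gamma>' k j) (y k (j \<in> P)))))"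
  have "\<exists>T' \<rho>. ?P k T' \<rho>" if k: "k \<in> K" for k
  proof (cases "k \<in> Q")
    case True
    then show ?thesis
      using T[OF True] eval[OF True] \<pi>Q[OF True] by (intro exI[of _ "T k"] exI[of _ 1]) auto
  next
    case False
    obtain T' and \<rho> :: complex where T': "T' \<in> schur_module scale [d, 0] (U k)" "\<rho> \<noteq> 0"
      "\<And>\<phi>. \<phi> \<in> Pi\<^sub>E (cells [d, 0]) (\<lambda>_. dual_space scale (U k)) \<Longrightarrow> T' \<phi> = \<rho> * (\<Prod>c\<in>cells [d, 0]. \<phi> c (y k False))"
      using schur_module_row_highest_weight[OF y[OF k]] by blast
    have "(\<Prod>c\<in>cells [d, 0]. \<phi> c (y k False)) = (\<Prod>j<d. \<phi> (0, j) (y k False))" for \<phi> :: "nat \<times> nat \<Rightarrow> 'a \<Rightarrow> complex"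
      by (rule prod.reindex_bij_betw[OF bij_cell_row, symmetric])
    then show ?thesis
      using T' False unfolding \<pi>R[OF k False] by (intro exI[of _ T'] exI[of _ \<rho>]) auto
  qed
  then have "\<forall>k\<in>K. \<exists>z. ?P k (fst z) (snd z)" by (simp only: split_paired_Ex fst_conv snd_conv) blast
  from bchoice[OF this] obtain z where z: "\<forall>k\<in>K. ?P k (fst (z k)) (snd (z k))" ..
  define T' \<rho> where "T' = (\<lambda>k. fst (z k))" and "\<rho> = (\<lambda>k. snd (z k))"
  have z': "?P k (T' k) (\<rho> k)" if "k \<in> K" for k
    unfolding T'_def \<rho>_def by (rule bspec[OF z that])
  have T': "T' k \<in> schur_module scale (\<pi> k) (U k)" if "k \<in> K" for k
    by (rule conjunct1[OF z'[OF that]])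
  have \<rho>: "\<rho> k \<noteq> 0" if "k \<in> K" for k
    by (rule conjunct1[OF conjunct2[OF z'[OF that]]])
  have eval': "T' k \<phi> = (\<Sum>P\<in>?S k. (if k \<in> Q then w k P else \<rho> k) * (\<Prod>j<d. \<phi> (\<gamma>' k j) (y k (j \<in> P))))"
    if "k \<in> K" "\<phi> \<in> Pi\<^sub>E (cells (\<pi> k)) (\<lambda>_. dual_space scale (U k))" for k \<phi>
    by (rule bspec[OF conjunct2[OF conjunct2[OF z'[OF that(1)]]] that(2)])
  let ?T = "outer_product scale K U \<pi> T'"
  have M: "?T \<in> schur_tensor scale K U \<pi>"
    unfolding schur_tensor_def using T' by (intro fs.span_base) blast
  have "0 = t.contraction_poly ?T A"
    using p[OF \<pi> t.contraction_poly_isotypic[OF inj M]] by simp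
  also have "\<dots> = (\<Sum>P\<in>Pi\<^sub>E K ?S. (\<Prod>k\<in>K. if k \<in> Q then w k (P k) else \<rho> k) *
      (\<Prod>j<d. A (\<lambda>k\<in>K. y k (j \<in> P k))))"
  proof (rule t.contraction_poly_outer_product[where T = T' and Q = ?S and y = y and A = A and
        w = "\<lambda>k P. if k \<in> Q then w k P else \<rho> k"])
    show "finite (?S k)" for k using fin by simp
  qed (fact eval' y A)+
  \<comment> \<open>The scalars of the remaining factors come out in front and, being nonzero, can
    be cancelled.\<close>
  also have "\<dots> = (\<Prod>k\<in>K - Q. \<rho> k) *
      (\<Sum>P\<in>Pi\<^sub>E K ?S. (\<Prod>k\<in>Q. w k (P k)) * (\<Prod>j<d. coord y A {k \<in> K. j \<in> P k}))"
    unfolding sum_distrib_left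
  proof (rule sum.cong[OF refl])
    fix P
    have "(\<Prod>k\<in>K. if k \<in> Q then w k (P k) else \<rho> k) =
      (\<Prod>k\<in>K - Q. if k \<in> Q then w k (P k) else \<rho> k) * (\<Prod>k\<in>Q. if k \<in> Q then w k (P k) else \<rho> k)"
      by (rule prod.subset_diff[OF Q finite_slots])
    also have "(\<Prod>k\<in>K - Q. if k \<in> Q then w k (P k) else \<rho> k) = (\<Prod>k\<in>K - Q. \<rho> k)"
      by (rule prod.cong) auto
    also have "(\<Prod>k\<in>Q. if k \<in> Q then w k (P k) else \<rho> k) = (\<Prod>k\<in>Q. w k (P k))"
      by (rule prod.cong) auto
    finally have 1: "(\<Prod>k\<in>K. if k \<in> Q then w k (P k) else \<rho> k) = (\<Prod>k\<in>K - Q. \<rho> k) * (\<Prod>k\<in>Q. w k (P k))" .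
    have 2: "(\<Prod>j<d. A (\<lambda>k\<in>K. y k (j \<in> P k))) = (\<Prod>j<d. coord y A {k \<in> K. j \<in> P k})"
      unfolding coord_def by (intro prod.cong refl arg_cong[of _ _ A]) (auto simp: fun_eq_iff)
    show "(\<Prod>k\<in>K. if k \<in> Q then w k (P k) else \<rho> k) * (\<Prod>j<d. A (\<lambda>k\<in>K. y k (j \<in> P k))) =
      (\<Prod>k\<in>K - Q. \<rho> k) * ((\<Prod>k\<in>Q. w k (P k)) * (\<Prod>j<d. coord y A {k \<in> K. j \<in> P k}))"
      by (simp only: 1 2 mult.assoc)
  qed
  finally show ?thesis
    using \<rho> finite_slots unfolding sum_PiE_support[OF Q] by (auto simp: prod_zero_iff)
qed

text \<open>\<open>P = {j}\<close> means that copy \<open>j\<close> receives the second vector. Its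
  coefficient is 2 if the cell matched with copy \<open>j\<close> lies in the second row, which
  happens at \<open>j = 2\<close> for \<open>q1\<close>, \<open>q2\<close> and at
  \<open>j = 1\<close> for \<open>q3\<close>, \<open>q4\<close>; otherwise it is -1.\<close>

lemma cubic_relation:
  assumes B: "bases E D" and A: "A \<in> isotypic_zeros" and Q: "{q1, q2, q3, q4} \<subseteq> K" "distinct [q1, q2, q3, q4]"
    and y: "\<And>k b. k \<in> K \<Longrightarrow> y k b \<in> U k"
  defines "w \<equiv> \<lambda>k P. if k \<in> {q3, q4} then (if P = {1 :: nat} then 2 else - 1) else (if P = {2} then 2 else - 1 :: complex)"
  shows "(\<Sum>P\<in>Pi\<^sub>E {q1, q2, q3, q4} (\<lambda>_. {{0}, {1}, {2}}). (\<Prod>k\<in>{q1, q2, q3, q4}. w k (P k)) *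
    (\<Prod>j<3. coord y A {k \<in> {q1, q2, q3, q4}. j \<in> P k})) = 0"
proof -
  define \<gamma> where "\<gamma> = (\<lambda>k. cell_list (k \<in> {q3, q4}))"
  define \<omega> where "\<omega> = (\<lambda>k P. if \<gamma> k ` P = {(1, 0)} then 1 else - 1 / 2 :: complex)"
  let ?P = "\<lambda>k T. T \<in> schur_module scale [2, 1] (U k) \<and> (\<forall>\<phi>\<in>Pi\<^sub>E (cells [2, 1]) (\<lambda>_. dual_space scale (U k)).
      T \<phi> = (\<Sum>P\<in>{{0}, {1}, {2}}. w k P * (\<Prod>j<3. \<phi> (\<gamma> k j) (y k (j \<in> P)))))"
  have "\<exists>T. ?P k T"
    if kQ: "k \<in> {q1, q2, q3, q4}" for k
  proof -
    have k: "k \<in> K" using kQ Q by auto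
    obtain T where T: "T \<in> schur_module scale [2, 1] (U k)"
      "\<And>u v r. u \<in> dual_space scale (U k) \<Longrightarrow> v \<in> dual_space scale (U k) \<Longrightarrow> r \<in> dual_space scale (U k) \<Longrightarrow>
      T (fill21 u v r) = 2 * u (y k False) * v (y k False) * r (y k True) - u (y k True) * v (y k False) * r (y k False)
        - u (y k False) * v (y k True) * r (y k False)"
      using schur_module_21_highest_weight[OF y[OF k] y[OF k]] by blast
    have "T \<phi> = (\<Sum>P\<in>{{0}, {1}, {2}}. w k P * (\<Prod>j<3. \<phi> (\<gamma> k j) (y k (j \<in> P))))"
      if \<phi>: "\<phi> \<in> Pi\<^sub>E (cells [2, 1]) (\<lambda>_. dual_space scale (U k))" for \<phi>
    proof -
      have "\<phi> = fill21 (\<phi> (0, 0)) (\<phi> (0, 1)) (\<phi> (1, 0))"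
        using PiE_restrict[OF \<phi>] unfolding fill21_cells[of \<phi>] by simp
      moreover have "\<phi> (0, 0) \<in> dual_space scale (U k)" "\<phi> (0, 1) \<in> dual_space scale (U k)"
        "\<phi> (1, 0) \<in> dual_space scale (U k)" using \<phi> by (auto simp: PiE_iff cells_def)
      ultimately have "T \<phi> = 2 * \<phi> (0, 0) (y k False) * \<phi> (0, 1) (y k False) * \<phi> (1, 0) (y k True) -
        \<phi> (0, 0) (y k True) * \<phi> (0, 1) (y k False) * \<phi> (1, 0) (y k False)
        - \<phi> (0, 0) (y k False) * \<phi> (0, 1) (y k True) * \<phi> (1, 0) (y k False)"
        using T(2) by metis
      then show ?thesis
        by (cases "k \<in> {q3, q4}") (simp_all add: w_def \<gamma>_def lessThan_3 cell_list_def algebra_simps)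
    qed
    then show ?thesis using T(1) by auto
  qed
  then have "\<forall>k\<in>{q1, q2, q3, q4}. \<exists>T. ?P k T" by blast
  from bchoice[OF this] obtain T where T: "\<And>k. k \<in> {q1, q2, q3, q4} \<Longrightarrow> T k \<in> schur_module scale [2, 1] (U k)"
    "\<And>k \<phi>. k \<in> {q1, q2, q3, q4} \<Longrightarrow> \<phi> \<in> Pi\<^sub>E (cells [2, 1]) (\<lambda>_. dual_space scale (U k)) \<Longrightarrow>
      T k \<phi> = (\<Sum>P\<in>{{0}, {1}, {2}}. w k P * (\<Prod>j<3. \<phi> (\<gamma> k j) (y k (j \<in> P))))"
    by blast
  show ?thesis
  proof (rule isotypic_relation[OF B _ Q(1) _ y, where \<mu> = "[2, 1]" and r = 1 and \<gamma> = \<gamma> and \<omega> = \<omega> and T = T])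
    show "p A = 0" if "\<pi> \<in> types_with K (card {q1, q2, q3, q4}) [2, 1] [3, 0]" "p \<in> isotypic_component scale K U 3 \<pi>" for \<pi> p
    proof -
      have "card {q1, q2, q3, q4} = 4" using Q(2) by simp
      then show ?thesis using A that unfolding isotypic_zeros_def by simp
    qed
    show "S (\<lambda>c\<in>cells [2, 1]. f (c \<in> \<gamma> k ` P)) = \<omega> k P * S (\<lambda>c\<in>cells [2, 1]. f (fst c = 1))"
      if P: "P \<subseteq> {..<3}" "card P = 1" and S: "S \<in> schur_module scale [2, 1] (U k)" for k f P S
    proof -
      obtain j where j: "P = {j}" "j < 3" using P by (auto simp: card_1_singleton_iff)
      have "\<gamma> k j \<in> cells [2, 1]" using bij_betwE[OF bij_cell_list] j by (simp add: \<gamma>_def)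
      from schur_module_21_filling[OF S this, of f]
      show ?thesis by (simp add: j \<omega>_def del: One_nat_def)
    qed
    have "(\<Prod>k\<in>{q1, q2, q3, q4}. \<omega> k P) = \<omega> q1 P * \<omega> q2 P * \<omega> q3 P * \<omega> q4 P" for P
      using Q(2) by simp
    \<comment> \<open>The sum is 1/16 + 1/4 + 1/4 = 9/16: the three singletons hit the second row in
      none, in two and in two of the factors.\<close>
    then show "(\<Sum>P\<in>{P \<in> Pow {..<3}. card P = 1}. \<Prod>k\<in>{q1, q2, q3, q4}. \<omega> k P) \<noteq> 0"
      unfolding singletons_3 using Q(2) by (simp add: \<omega>_def \<gamma>_def cell_list_def)
    show "fst c = 0 \<or> fst c = 1" if "c \<in> cells [2, 1]" for c using that unfolding cells_21 by auto
  qed (use A T bij_cell_list in \<open>auto simp: isotypic_zeros_def cells_def \<gamma>_def\<close>)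
qed

text \<open>All three factors are matched with the copies in the same way. \<open>P k\<close> is the
  pair of copies receiving the second vector; the coefficient is 4 if their cells form a row, and -2
  otherwise.\<close>

lemma quartic_relation:
  assumes B: "bases E D" and A: "A \<in> isotypic_zeros" and Q: "{q1, q2, q3} \<subseteq> K" "distinct [q1, q2, q3]"
    and y: "\<And>k b. k \<in> K \<Longrightarrow> y k b \<in> U k"
  shows "(\<Sum>P\<in>Pi\<^sub>E {q1, q2, q3} (\<lambda>_. {{0, 1}, {2, 3}, {0, 2}, {0, 3}, {1, 2}, {1, 3 :: nat}}).
    (\<Prod>k\<in>{q1, q2, q3}. if P k = {0, 1} \<or> P k = {2, 3} then 4 else - 2) *
    (\<Prod>j<4. coord y A {k \<in> {q1, q2, q3}. j \<in> P k})) = 0"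
proof -
  let ?S = "{{0, 1}, {2, 3}, {0, 2}, {0, 3}, {1, 2}, {1, 3 :: nat}}"
  define w where "w = (\<lambda>P. if P = {0, 1} \<or> P = {2, 3 :: nat} then 4 else - 2 :: complex)"
  define \<omega> where "\<omega> = (\<lambda>P. if P = {0, 1} \<or> P = {2, 3 :: nat} then 1 else - 1 / 2 :: complex)"
  let ?P = "\<lambda>k T. T \<in> schur_module scale [2, 2] (U k) \<and> (\<forall>\<phi>\<in>Pi\<^sub>E (cells [2, 2]) (\<lambda>_. dual_space scale (U k)).
      T \<phi> = (\<Sum>P\<in>?S. w P * (\<Prod>j<4. \<phi> (cell_square j) (y k (j \<in> P)))))"
  have "\<exists>T. ?P k T"
    if kQ: "k \<in> {q1, q2, q3}" for k
  proof -
    have k: "k \<in> K" using kQ Q by auto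
    let ?e = "y k False" and ?f = "y k True"
    obtain T where T: "T \<in> schur_module scale [2, 2] (U k)"
      "\<And>x y z w. x \<in> dual_space scale (U k) \<Longrightarrow> y \<in> dual_space scale (U k) \<Longrightarrow> z \<in> dual_space scale (U k) \<Longrightarrow>
        w \<in> dual_space scale (U k) \<Longrightarrow>
      T (fill22 x y z w) = 4 * x ?e * y ?e * z ?f * w ?f + 4 * x ?f * y ?f * z ?e * w ?e - 2 * x ?e * y ?f * z ?f * w ?e
        - 2 * x ?f * y ?e * z ?e * w ?f - 2 * x ?e * y ?f * z ?e * w ?f - 2 * x ?f * y ?e * z ?f * w ?e"
      using schur_module_22_highest_weight[OF y[OF k] y[OF k]] by blast
    have "T \<phi> = (\<Sum>P\<in>?S. w P * (\<Prod>j<4. \<phi> (cell_square j) (y k (j \<in> P))))"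
      if \<phi>: "\<phi> \<in> Pi\<^sub>E (cells [2, 2]) (\<lambda>_. dual_space scale (U k))" for \<phi>
    proof -
      let ?a = "\<phi> (0, 0)" and ?b = "\<phi> (0, 1)" and ?c = "\<phi> (1, 0)" and ?d = "\<phi> (1, 1)"
      have "\<phi> = fill22 ?a ?b ?c ?d"
        using PiE_restrict[OF \<phi>] unfolding fill22_cells[of \<phi>] by simp
      moreover have "?a \<in> dual_space scale (U k)" "?b \<in> dual_space scale (U k)"
        "?c \<in> dual_space scale (U k)" "?d \<in> dual_space scale (U k)"
        using \<phi> by (auto simp: PiE_iff cells_def)
      ultimately have "T \<phi> = 4 * ?a ?e * ?b ?e * ?c ?f * ?d ?f + 4 * ?a ?f * ?b ?f * ?c ?e * ?d ?e
        - 2 * ?a ?e * ?b ?f * ?c ?f * ?d ?e - 2 * ?a ?f * ?b ?e * ?c ?e * ?d ?f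
        - 2 * ?a ?e * ?b ?f * ?c ?e * ?d ?f - 2 * ?a ?f * ?b ?e * ?c ?f * ?d ?e"
        using T(2) by metis
      then show ?thesis
        by (simp add: w_def lessThan_4 cell_square_def doubleton_eq_iff algebra_simps)
    qed
    then show ?thesis using T(1) by auto
  qed
  then have "\<forall>k\<in>{q1, q2, q3}. \<exists>T. ?P k T" by blast
  from bchoice[OF this] obtain T where T: "\<And>k. k \<in> {q1, q2, q3} \<Longrightarrow> T k \<in> schur_module scale [2, 2] (U k)"
    "\<And>k \<phi>. k \<in> {q1, q2, q3} \<Longrightarrow> \<phi> \<in> Pi\<^sub>E (cells [2, 2]) (\<lambda>_. dual_space scale (U k)) \<Longrightarrow>
      T k \<phi> = (\<Sum>P\<in>?S. w P * (\<Prod>j<4. \<phi> (cell_square j) (y k (j \<in> P))))"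
    by blast
  have "(\<Sum>P\<in>Pi\<^sub>E {q1, q2, q3} (\<lambda>_. ?S). (\<Prod>k\<in>{q1, q2, q3}. w (P k)) *
    (\<Prod>j<4. coord y A {k \<in> {q1, q2, q3}. j \<in> P k})) = 0"
  proof (rule isotypic_relation[OF B _ Q(1) _ y, where \<mu> = "[2, 2]" and r = 2 and \<gamma> = "\<lambda>_. cell_square"
        and \<omega> = "\<lambda>_. \<omega>" and T = T])
    show "p A = 0" if "\<pi> \<in> types_with K (card {q1, q2, q3}) [2, 2] [4, 0]" "p \<in> isotypic_component scale K U 4 \<pi>" for \<pi> p
    proof -
      have "card {q1, q2, q3} = 3" using Q(2) by simp
      then show ?thesis using A that unfolding isotypic_zeros_def by simp
    qed
    show "S (\<lambda>c\<in>cells [2, 2]. f (c \<in> cell_square ` P)) = \<omega> P * S (\<lambda>c\<in>cells [2, 2]. f (fst c = 1))"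
      if P: "P \<subseteq> {..<4}" "card P = 2" and S: "S \<in> schur_module scale [2, 2] (U k)" for k f P S
    proof -
      have inj: "inj_on cell_square {..<4}" and img: "cell_square ` {..<4} = cells [2, 2]"
        using bij_cell_square by (auto simp: bij_betw_def)
      have C: "cell_square ` P \<subseteq> cells [2, 2]" "card (cell_square ` P) = 2"
        using P img card_image[OF inj_on_subset[OF inj P(1)]] by auto
      have "cell_square ` P = cell_square ` R \<longleftrightarrow> P = R" if "R \<subseteq> {..<4}" for R
        using inj_on_image_eq_iff[OF inj P(1) that] .
      from this[of "{0, 1}"] this[of "{2, 3}"]
      have "(cell_square ` P = {(0, 0), (0, 1)} \<or> cell_square ` P = {(1, 0), (1, 1)}) = (P = {0, 1} \<or> P = {2, 3})"
        by (simp add: cell_square_def)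
      then show ?thesis
        using schur_module_22_filling[OF S C, of f] by (simp only: \<omega>_def)
    qed
    have "(\<Prod>k\<in>{q1, q2, q3}. \<omega> P) = \<omega> P * \<omega> P * \<omega> P" for P
      using Q(2) by simp
    \<comment> \<open>The sum is 2 - 4/8 = 3/2: two pairs of copies form rows, the other four
      contribute -1/8 each.\<close>
    then show "(\<Sum>P\<in>{P \<in> Pow {..<4}. card P = 2}. \<Prod>k\<in>{q1, q2, q3}. \<omega> P) \<noteq> 0"
      unfolding pairs_4 by (simp add: \<omega>_def doubleton_eq_iff)
  qed (use A T bij_cell_square in \<open>auto simp: isotypic_zeros_def cells_22\<close>)
  then show ?thesis by (simp only: w_def)
qed

end

section \<open>The cubic and quartic equations written out\<close>

lemma sum_PiE_three:
  fixes g :: "'b \<Rightarrow> 'b \<Rightarrow> 'b \<Rightarrow> 'c::comm_monoid_add"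
  assumes "distinct [i, j, k]"
  shows "(\<Sum>P\<in>Pi\<^sub>E {i, j, k} (\<lambda>_. S). g (P i) (P j) (P k)) = (\<Sum>x\<in>S. \<Sum>y\<in>S. \<Sum>z\<in>S. g x y z)"
  using assms by (auto simp: sum_PiE_insert)

lemma sum_PiE_four:
  fixes g :: "'b \<Rightarrow> 'b \<Rightarrow> 'b \<Rightarrow> 'b \<Rightarrow> 'c::comm_monoid_add"
  assumes "distinct [i, j, k, l]"
  shows "(\<Sum>P\<in>Pi\<^sub>E {i, j, k, l} (\<lambda>_. S). g (P i) (P j) (P k) (P l)) =
    (\<Sum>x\<in>S. \<Sum>y\<in>S. \<Sum>z\<in>S. \<Sum>w\<in>S. g x y z w)"
  using assms by (auto simp: sum_PiE_insert)

context planes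
begin

text \<open>Among the products of two pairs, those for the splittings \<open>{i, k}\<close>,
  \<open>{j, l}\<close> and \<open>{i, l}\<close>, \<open>{j, k}\<close> cancel in the sum over the
  placements of the indices into three copies. Only \<open>a {i, j} * a {k, l}\<close> survives, so
  permuting the indices separates the three products. The vectors \<open>y\<close> are arbitrary, so
  the equation can also be used at other base points.\<close>

lemma cubic_equation:
  assumes B: "bases E D" and A: "A \<in> isotypic_zeros" and Q: "{i, j, k, l} \<subseteq> K" "distinct [i, j, k, l]"
    and y: "\<And>k b. k \<in> K \<Longrightarrow> y k b \<in> U k"
  defines "a \<equiv> coord y A"
  shows "a {} * a {} * a {i, j, k, l} -
    a {} * (a {i} * a {j, k, l} + a {j} * a {i, k, l} + a {k} * a {i, j, l} + a {l} * a {i, j, k}) +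
    a {i} * a {k} * a {j, l} + a {i} * a {l} * a {j, k} + a {j} * a {k} * a {i, l} + a {j} * a {l} * a {i, k} -
    2 * a {i} * a {j} * a {k, l} - 2 * a {k} * a {l} * a {i, j} + 3 * a {} * a {i, j} * a {k, l} = 0"
proof -
  define c where "c = (\<lambda>b1 b2 b3 b4. a {q. q = i \<and> b1 \<or> q = j \<and> b2 \<or> q = k \<and> b3 \<or> q = l \<and> b4})"
  let ?S = "{{0}, {1}, {2}} :: nat set set"
  let ?w = "\<lambda>P. if P = {2 :: nat} then 2 else - 1 :: complex"
  let ?w' = "\<lambda>P. if P = {1 :: nat} then 2 else - 1 :: complex"
  let ?G = "\<lambda>P1 P2 P3 P4. ?w P1 * ?w P2 * ?w' P3 * ?w' P4 *
    (c (0 \<in> P1) (0 \<in> P2) (0 \<in> P3) (0 \<in> P4) * c (1 \<in> P1) (1 \<in> P2) (1 \<in> P3) (1 \<in> P4) *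
      c (2 \<in> P1) (2 \<in> P2) (2 \<in> P3) (2 \<in> P4))"
  \<comment> \<open>The common factor 9 is the weight of
    \<open>a {} * a {} * a {i, j, k, l}\<close>: all four indices in copy 0, 1 or 2 give 1 + 4 +
    4.\<close>
  have nine: "x = 0" if "0 = 9 * x" for x :: complex using that by simp
  have *: "coord y A {q \<in> {i, j, k, l}. m \<in> P q} = c (m \<in> P i) (m \<in> P j) (m \<in> P k) (m \<in> P l)"
    for P :: "'k \<Rightarrow> nat set" and m
    unfolding c_def a_def by (intro arg_cong[of _ _ "coord y A"]) auto
  have "(\<Sum>P\<in>Pi\<^sub>E {i, j, k, l} (\<lambda>_. ?S). ?G (P i) (P j) (P k) (P l)) = 0"
    by (rule trans[OF sum.cong[OF refl] cubic_relation[where y = y, OF B A Q y, unfolded *]])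
      (use Q(2) in \<open>simp_all add: lessThan_3 mult.assoc split del: if_split\<close>)
  then have "0 = (\<Sum>P\<in>Pi\<^sub>E {i, j, k, l} (\<lambda>_. ?S). ?G (P i) (P j) (P k) (P l))" by (rule sym)
  also have "\<dots> = (\<Sum>P1\<in>?S. \<Sum>P2\<in>?S. \<Sum>P3\<in>?S. \<Sum>P4\<in>?S. ?G P1 P2 P3 P4)"
    by (rule sum_PiE_four[OF Q(2)])
  also have "\<dots> = 9 * (c False False False False * c False False False False * c True True True True -
    c False False False False * (c True False False False * c False True True True +
      c False True False False * c True False True True + c False False True False * c True True False True +
      c False False False True * c True True True False) +
    c True False False False * c False False True False * c False True False True +
    c True False False False * c False False False True * c False True True False +
    c False True False False * c False False True False * c True False False True +
    c False True False False * c False False False True * c True False True False -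
    2 * c True False False False * c False True False False * c False False True True -
    2 * c False False True False * c False False False True * c True True False False +
    3 * c False False False False * c True True False False * c False False True True)"
    by (simp add: algebra_simps)
  finally have "c False False False False * c False False False False * c True True True True -
    c False False False False * (c True False False False * c False True True True +
      c False True False False * c True False True True + c False False True False * c True True False True +
      c False False False True * c True True True False) +
    c True False False False * c False False True False * c False True False True +
    c True False False False * c False False False True * c False True True False +
    c False True False False * c False False True False * c True False False True +
    c False True False False * c False False False True * c True False True False -
    2 * c True False False False * c False True False False * c False False True True -
    2 * c False False True False * c False False False True * c True True False False +
    3 * c False False False False * c True True False False * c False False True True = 0"
    by (rule nine)
  moreover have "c b1 b2 b3 b4 = a ((if b1 then {i} else {}) \<union> (if b2 then {j} else {}) \<union>
      (if b3 then {k} else {}) \<union> (if b4 then {l} else {}))" for b1 b2 b3 b4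
    unfolding c_def by (intro arg_cong[of _ _ a]) auto
  ultimately show ?thesis by (simp add: insert_commute)
qed

text \<open>This is Cayley's hyperdeterminant of a 2 x 2 x 2 array, reduced by the normalization to
  two of its monomials.\<close>

lemma quartic_equation:
  assumes B: "bases E D" and A: "A \<in> isotypic_zeros" and Q: "{i, j, k} \<subseteq> K" "distinct [i, j, k]"
    and y: "\<And>k b. k \<in> K \<Longrightarrow> y k b \<in> U k"
  defines "a \<equiv> coord y A"
  assumes norm: "a {} = 1" "a {i} = 0" "a {j} = 0" "a {k} = 0"
  shows "a {i, j, k} ^ 2 + 4 * a {i, j} * a {i, k} * a {j, k} = 0"
proof -
  define c where "c = (\<lambda>b1 b2 b3. a {q. q = i \<and> b1 \<or> q = j \<and> b2 \<or> q = k \<and> b3})"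
  have c: "c b1 b2 b3 = a ((if b1 then {i} else {}) \<union> (if b2 then {j} else {}) \<union>
      (if b3 then {k} else {}))" for b1 b2 b3
    unfolding c_def by (intro arg_cong[of _ _ a]) auto
  have norm': "c False False False = 1" "c True False False = 0" "c False True False = 0" "c False False True = 0"
    using norm by (simp_all add: c)
  let ?S = "{{0, 1}, {2, 3}, {0, 2}, {0, 3}, {1, 2}, {1, 3}} :: nat set set"
  let ?w = "\<lambda>P. if P = {0, 1} \<or> P = {2, 3 :: nat} then 4 else - 2 :: complex"
  let ?G = "\<lambda>P1 P2 P3. ?w P1 * ?w P2 * ?w P3 *
    (c (0 \<in> P1) (0 \<in> P2) (0 \<in> P3) * c (1 \<in> P1) (1 \<in> P2) (1 \<in> P3) *
      c (2 \<in> P1) (2 \<in> P2) (2 \<in> P3) * c (3 \<in> P1) (3 \<in> P2) (3 \<in> P3))"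
  \<comment> \<open>The monomial \<open>a {} ^ 2 * a {i, j, k} ^ 2\<close> arises when all three
    factors choose the same pair of copies or complementary ones; after the normalization its total
    weight is 96.\<close>
  have ninetysix: "x = 0" if "0 = 96 * x" for x :: complex using that by simp
  have *: "coord y A {q \<in> {i, j, k}. m \<in> P q} = c (m \<in> P i) (m \<in> P j) (m \<in> P k)"
    for P :: "'k \<Rightarrow> nat set" and m
    unfolding c_def a_def by (intro arg_cong[of _ _ "coord y A"]) auto
  have "(\<Sum>P\<in>Pi\<^sub>E {i, j, k} (\<lambda>_. ?S). ?G (P i) (P j) (P k)) = 0"
    by (rule trans[OF sum.cong[OF refl] quartic_relation[where y = y, OF B A Q y, unfolded *]])
      (use Q(2) in \<open>simp_all add: lessThan_4 mult.assoc split del: if_split\<close>)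
  then have "0 = (\<Sum>P\<in>Pi\<^sub>E {i, j, k} (\<lambda>_. ?S). ?G (P i) (P j) (P k))" by (rule sym)
  also have "\<dots> = (\<Sum>P1\<in>?S. \<Sum>P2\<in>?S. \<Sum>P3\<in>?S. ?G P1 P2 P3)"
    by (rule sum_PiE_three[OF Q(2)])
  also have "\<dots> = 96 * (c True True True * c True True True +
      4 * c True True False * c True False True * c False True True)"
    by (simp add: norm' doubleton_eq_iff algebra_simps)
  finally have "c True True True * c True True True + 4 * c True True False * c True False True * c False True True = 0"
    by (rule ninetysix)
  then show ?thesis by (simp add: c power2_eq_square insert_commute)
qed

end

section \<open>Common zeros are tangent\<close>

lemma csqrt_exists: "\<exists>w::complex. w ^ 2 = z"
  by (rule exI[of _ "csqrt z"]) simp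

text \<open>In normalized coordinates \<open>s i j\<close> and \<open>t i j k\<close> are the coordinates of a form at two-
  and three-element sets.\<close>

lemma off_diagonal_rank_one:
  fixes s :: "'k \<Rightarrow> 'k \<Rightarrow> complex" and t :: "'k \<Rightarrow> 'k \<Rightarrow> 'k \<Rightarrow> complex"
  assumes sym: "\<And>i j. s i j = s j i" "\<And>i j k. t i j k = t j i k" "\<And>i j k. t i j k = t i k j"
    and pair: "\<And>i j k l. {i, j, k, l} \<subseteq> K \<Longrightarrow> distinct [i, j, k, l] \<Longrightarrow> s i j * s k l = s i k * s j l"
    and sign: "\<And>i j k l. {i, j, k, l} \<subseteq> K \<Longrightarrow> distinct [i, j, k, l] \<Longrightarrow> s i j * t i k l = s i k * t i j l"
    and square: "\<And>i j k. {i, j, k} \<subseteq> K \<Longrightarrow> distinct [i, j, k] \<Longrightarrow> t i j k ^ 2 = - 4 * s i j * s i k * s j k"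
    and pqr: "{p, q, r} \<subseteq> K" "distinct [p, q, r]" "s p q \<noteq> 0" "s p r \<noteq> 0" "s q r \<noteq> 0"
  obtains u where "\<And>i j. {i, j} \<subseteq> K \<Longrightarrow> i \<noteq> j \<Longrightarrow> s i j = - u i * u j"
    "\<And>i j k. {i, j, k} \<subseteq> K \<Longrightarrow> distinct [i, j, k] \<Longrightarrow> t i j k = 2 * u i * u j * u k"
proof -
  \<comment> \<open>If \<open>s i j = - u i * u j\<close>, then \<open>u p ^ 2\<close> must be the
    right hand side; so a square root fixes \<open>u p\<close> up to sign, and \<open>s p i\<close>
    then determines every other entry.\<close>
  obtain w where w: "w ^ 2 = - s p q * s p r / s q r" using csqrt_exists by blast
  then have w0: "w \<noteq> 0" using pqr by auto
  define v where "v = (\<lambda>i. if i = p then w else - s p i / w)"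
  have vp: "v p = w" by (simp add: v_def)
  have sv_p: "s p i = - v p * v i" if "i \<noteq> p" for i using that w0 by (simp add: v_def)
  have vqr: "v q \<noteq> 0" "v r \<noteq> 0" using pqr w0 by (auto simp: v_def)
  have sqr: "s q r = - v q * v r"
  proof -
    have "v q * v r = s p q * s p r / w ^ 2" using pqr by (auto simp: v_def power2_eq_square)
    also have "\<dots> = - s q r" using pqr by (simp add: w)
    finally show ?thesis by simp
  qed
  \<comment> \<open>The relation \<open>pair\<close> extends the formula from pairs containing
    \<open>p\<close> to those containing \<open>q\<close>, and then to all pairs, each time after
    cancelling a nonzero entry of the triangle.\<close>
  have sv_q: "s q l = - v q * v l" if l: "l \<in> K" "l \<noteq> p" "l \<noteq> q" for l
  proof (cases "l = r")
    case True
    then show ?thesis using sqr by simp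
  next
    case False
    have "s p r * s l q = s p l * s r q" using pqr l False by (intro pair) auto
    then have "(- v p * v r) * s q l = (- v p * v l) * (- v q * v r)"
      using sv_p[of r] sv_p[of l] sqr sym(1)[of l q] sym(1)[of r q] pqr l by auto
    then have "(v p * v r) * (s q l + v q * v l) = 0" by algebra
    then show ?thesis using vqr w0 vp by (simp add: eq_neg_iff_add_eq_0)
  qed
  have sv: "s i j = - v i * v j" if ij: "{i, j} \<subseteq> K" "i \<noteq> j" for i j
  proof -
    have main: "s l m = - v l * v m" if lm: "l \<in> K" "m \<in> K" "l \<noteq> m" "l \<notin> {p, q}" "m \<notin> {p, q}" for l m
    proof -
      have "s p q * s l m = s p l * s q m" using pqr lm by (intro pair) auto
      then have "(- v p * v q) * s l m = (- v p * v l) * (- v q * v m)"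
        using sv_p[of q] sv_p[of l] sv_q[of m] pqr lm by auto
      then have "(v p * v q) * (s l m + v l * v m) = 0" by algebra
      then show ?thesis using vqr w0 vp by (simp add: eq_neg_iff_add_eq_0)
    qed
    consider "i = p" | "j = p" | "i = q" "j \<noteq> p" | "j = q" "i \<noteq> p" | "i \<notin> {p, q}" "j \<notin> {p, q}" by blast
    then show ?thesis
    proof cases
      case 1
      then show ?thesis using sv_p ij by auto
    next
      case 2
      then show ?thesis using sv_p[of i] sym(1)[of i j] ij by auto
    next
      case 3
      then show ?thesis using sv_q ij by auto
    next
      case 4
      then show ?thesis using sv_q[of i] sym(1)[of i j] ij by auto
    next
      case 5
      then show ?thesis using main ij by auto
    qed
  qed
  have "t p q r ^ 2 = (2 * v p * v q * v r) ^ 2"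
  proof -
    have "t p q r ^ 2 = - 4 * s p q * s p r * s q r" using pqr by (intro square) auto
    also have "\<dots> = (2 * v p * v q * v r) ^ 2"
      using sv_p[of q] sv_p[of r] sqr pqr by (auto simp: power2_eq_square)
    finally show ?thesis .
  qed
  then have "t p q r = 2 * v p * v q * v r \<or> t p q r = - (2 * v p * v q * v r)"
    by (simp only: power2_eq_iff)
  \<comment> \<open>The quadratic relation fixes \<open>t p q r\<close> only up to sign. Replacing
    \<open>v\<close> by \<open>- v\<close> keeps all products of two entries and negates products of
    three, so the sign can be absorbed.\<close>
  then obtain \<epsilon> :: complex where \<epsilon>: "\<epsilon> * \<epsilon> = 1" "t p q r = \<epsilon> * (2 * v p * v q * v r)"
  proof
    assume "t p q r = 2 * v p * v q * v r"
    then show thesis using that[of 1] by simp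
  next
    assume "t p q r = - (2 * v p * v q * v r)"
    then show thesis using that[of "-1"] by simp
  qed
  define u where "u = (\<lambda>i. \<epsilon> * v i)"
  have su: "s i j = - u i * u j" if "{i, j} \<subseteq> K" "i \<noteq> j" for i j
  proof -
    have "- u i * u j = - (\<epsilon> * \<epsilon>) * v i * v j" by (simp add: u_def)
    then show ?thesis using sv[OF that] \<epsilon>(1) by simp
  qed
  have "u p * u q * u r = (\<epsilon> * \<epsilon>) * \<epsilon> * v p * v q * v r" by (simp add: u_def)
  then have tpqr: "t p q r = 2 * u p * u q * u r" using \<epsilon> by (simp add: mult.assoc)
  have u0: "u p \<noteq> 0" "u q \<noteq> 0" "u r \<noteq> 0" using \<epsilon>(1) vqr w0 vp by (auto simp: u_def)
  have tpq: "t p q l = 2 * u p * u q * u l" if l: "l \<in> K" "l \<noteq> p" "l \<noteq> q" for l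
  proof (cases "l = r")
    case False
    have "s p r * t p l q = s p l * t p r q" using pqr l False by (intro sign) auto
    then have "(- u p * u r) * t p q l = (- u p * u l) * (2 * u p * u q * u r)"
      using su[of p r] su[of p l] sym(3)[of p l q] sym(3)[of p r q] tpqr pqr l by auto
    then have "(u p * u r) * (t p q l - 2 * u p * u q * u l) = 0" by algebra
    then show ?thesis using u0 by simp
  qed (use tpqr in simp)
  have tp: "t p k l = 2 * u p * u k * u l" if kl: "k \<in> K" "l \<in> K" "k \<noteq> l" "k \<noteq> p" "l \<noteq> p" for k l
  proof -
    consider "k = q" | "l = q" | "k \<noteq> q" "l \<noteq> q" by blast
    then show ?thesis
    proof cases
      case 1
      then show ?thesis using tpq kl by auto
    next
      case 2
      then show ?thesis using tpq[of k] sym(3)[of p k l] kl by (simp add: algebra_simps)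
    next
      case 3
      have "s p q * t p k l = s p k * t p q l" using pqr kl 3 by (intro sign) auto
      then have "(- u p * u q) * t p k l = (- u p * u k) * (2 * u p * u q * u l)"
        using su[of p q] su[of p k] tpq[of l] pqr kl 3 by auto
      then have "(u p * u q) * (t p k l - 2 * u p * u k * u l) = 0" by algebra
      then show ?thesis using u0 by simp
    qed
  qed
  have tu: "t i j k = 2 * u i * u j * u k" if ijk: "{i, j, k} \<subseteq> K" "distinct [i, j, k]" for i j k
  proof -
    consider "i = p" | "j = p" | "k = p" | "p \<notin> {i, j, k}" by blast
    then show ?thesis
    proof cases
      case 1
      then show ?thesis using tp ijk by auto
    next
      case 2
      then show ?thesis using tp[of i k] sym(2)[of i j k] ijk by (auto simp: algebra_simps)
    next
      case 3
      then show ?thesis using tp[of i j] sym(3)[of i j k] sym(2)[of i k j] ijk by (auto simp: algebra_simps)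
    next
      case 4
      show ?thesis
      \<comment> \<open>The relation \<open>sign\<close> can be cancelled only when
        \<open>u i\<close> is nonzero; otherwise both sides vanish, \<open>t i j k\<close> because
        its square does.\<close>
      proof (cases "u i = 0")
        case True
        have "t i j k ^ 2 = - 4 * s i j * s i k * s j k" using ijk by (intro square) auto
        then show ?thesis using True su[of i j] ijk by simp
      next
        case False
        have "s i p * t i j k = s i j * t i p k" using pqr ijk 4 by (intro sign) auto
        then have "(- u i * u p) * t i j k = (- u i * u j) * (2 * u p * u i * u k)"
          using su[of i p] su[of i j] tp[of i k] sym(2)[of i p k] pqr ijk 4 by auto
        then have "(u i * u p) * (t i j k - 2 * u i * u j * u k) = 0" by algebra
        then show ?thesis using u0 False by simp
      qed
    qed
  qed
  show thesis using that[of u] su tu by blast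
qed

text \<open>View the nonzero \<open>s i j\<close> as edges of a graph. By \<open>pair\<close>, two
  disjoint edges would make all six pairs among their ends edges, contradicting
  \<open>triangle\<close>. So any two edges meet, and a triangle-free graph whose edges pairwise
  meet is a star.\<close>

lemma triangle_free_star:
  fixes s :: "'k \<Rightarrow> 'k \<Rightarrow> complex"
  assumes sym: "\<And>i j. s i j = s j i"
    and pair: "\<And>i j k l. {i, j, k, l} \<subseteq> K \<Longrightarrow> distinct [i, j, k, l] \<Longrightarrow> s i j * s k l = s i k * s j l"
    and triangle: "\<And>i j k. {i, j, k} \<subseteq> K \<Longrightarrow> distinct [i, j, k] \<Longrightarrow> s i j = 0 \<or> s i k = 0 \<or> s j k = 0"
    and ne: "K \<noteq> {}"
  obtains c where "c \<in> K" "\<And>i j. {i, j} \<subseteq> K - {c} \<Longrightarrow> i \<noteq> j \<Longrightarrow> s i j = 0"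
proof -
  have disj: "s i j = 0 \<or> s k l = 0" if "{i, j, k, l} \<subseteq> K" "distinct [i, j, k, l]" for i j k l
  proof -
    have "s i j * s k l = s i k * s j l" "s i j * s l k = s i l * s j k"
      using that by (intro pair; auto)+
    then show ?thesis using triangle[of i j k] sym[of l k] that by auto
  qed
  show thesis
  proof (cases "\<exists>p q. {p, q} \<subseteq> K \<and> p \<noteq> q \<and> s p q \<noteq> 0")
    case False
    moreover obtain c where "c \<in> K" using ne by blast
    ultimately show thesis using that[of c] by blast
  next
    case True
    then obtain p q where pq: "p \<in> K" "q \<in> K" "p \<noteq> q" "s p q \<noteq> 0" by auto
    show thesis
    \<comment> \<open>A second edge at \<open>q\<close> makes \<open>q\<close> the centre; if there
      is none, every edge still meets the edge from \<open>p\<close> to \<open>q\<close> and so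
      contains \<open>p\<close>.\<close>
    proof (cases "\<exists>j\<in>K - {p, q}. s q j \<noteq> 0")
      case True
      then obtain j where j: "j \<in> K" "j \<noteq> p" "j \<noteq> q" "s q j \<noteq> 0" by auto
      have "s k l = 0" if kl: "{k, l} \<subseteq> K - {q}" "k \<noteq> l" for k l
      proof (rule ccontr)
        assume nz: "s k l \<noteq> 0"
        have "p \<in> {k, l}" using disj[of p q k l] pq nz kl by auto
        then obtain m where m: "s p m \<noteq> 0" "m \<in> K" "m \<noteq> p" "m \<noteq> q"
        proof (cases "k = p")
          case True
          show ?thesis by (rule that[of l]) (use nz kl True in auto)
        next
          case False
          then have "l = p" using \<open>p \<in> {k, l}\<close> by auto
          show ?thesis by (rule that[of k]) (use nz kl \<open>l = p\<close> sym[of k l] in auto)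
        qed
        show False
        proof (cases "m = j")
          case True
          then show False using triangle[of p q j] pq j m by auto
        next
          case False
          then show False using disj[of p m q j] pq j m by auto
        qed
      qed
      then show thesis using that[of q] pq by blast
    next
      case False
      have "s k l = 0" if kl: "{k, l} \<subseteq> K - {p}" "k \<noteq> l" for k l
      proof (rule ccontr)
        assume nz: "s k l \<noteq> 0"
        have "q \<in> {k, l}" using disj[of p q k l] pq nz kl by auto
        then show False using False nz kl sym[of k l] by (cases "k = q") auto
      qed
      then show thesis using that[of p] pq by blast
    qed
  qed
qed

section \<open>Reconstruction of a common zero from its low coordinates\<close>

context planes
begin

lemma coord_shear:
  assumes A: "A \<in> forms" and B: "bases E D" and N: "N \<subseteq> K"
  shows "coord (\<lambda>k. (E k)(True := E k True + scale (c k) (E k False))) A N =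
    (\<Sum>R\<in>Pow N. (\<Prod>k\<in>N. if k \<in> R then 1 else c k) * coord E A R)"
proof -
  let ?x = "\<lambda>k\<in>K. E k False"
  have fin: "finite N" using N finite_slots finite_subset by blast
  have x: "?x \<in> Pi\<^sub>E K U" using basesD(1)[OF B] by auto
  have Nv: "E k b \<in> U k" if "k \<in> N" for k b using basesD(1)[OF B] that N by auto
  have "coord (\<lambda>k. (E k)(True := E k True + scale (c k) (E k False))) A N =
     A (\<lambda>k. if k \<in> N then scale (c k) (E k False) + scale 1 (E k True) else ?x k)"
    unfolding coord_def using N by (intro arg_cong[of _ _ A]) (auto simp: fun_eq_iff add.commute)
  also have "\<dots> = A (\<lambda>k. if k \<in> N then scale ((\<lambda>k b. if b then 1 else c k) k False) (E k False) +
      scale ((\<lambda>k b. if b then 1 else c k) k True) (E k True) else ?x k)"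
    by (intro arg_cong[of _ _ A]) (auto simp: fun_eq_iff)
  also have "\<dots> = (\<Sum>R\<in>Pow N. (\<Prod>k\<in>N. if k \<in> R then 1 else c k) * A (\<lambda>k. if k \<in> N then E k (k \<in> R) else ?x k))"
    by (rule multilinear_expand_on[OF A vector_space_axioms subspace_planes fin N x Nv])
  also have "\<dots> = (\<Sum>R\<in>Pow N. (\<Prod>k\<in>N. if k \<in> R then 1 else c k) * coord E A R)"
  proof (rule sum.cong[OF refl])
    fix R assume "R \<in> Pow N"
    then have "(\<lambda>k. if k \<in> N then E k (k \<in> R) else ?x k) k = (\<lambda>k\<in>K. E k (k \<in> R)) k" for k
      using N by (cases "k \<in> N"; cases "k \<in> R") auto
    then have "(\<lambda>k. if k \<in> N then E k (k \<in> R) else ?x k) = (\<lambda>k\<in>K. E k (k \<in> R))" by (rule ext)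
    then show "(\<Prod>k\<in>N. if k \<in> R then 1 else c k) * A (\<lambda>k. if k \<in> N then E k (k \<in> R) else ?x k) =
        (\<Prod>k\<in>N. if k \<in> R then 1 else c k) * coord E A R" by (simp only: coord_def)
  qed
  finally show ?thesis .
qed

text \<open>The cubics are linear in the coordinate at the four-element set, which is multiplied by the
  square of the coordinate at the empty set. Slicing at \<open>e\<^sub>k + t f\<^sub>k\<close> for the remaining \<open>k \<in> N\<close>,
  the coordinate at \<open>N\<close> enters only there.\<close>

lemma isotypic_zeros_eqI:
  assumes B: "bases E D" and A: "A \<in> isotypic_zeros" "A' \<in> isotypic_zeros"
    and nz: "coord E A {} \<noteq> 0"
    and low: "\<And>N. N \<subseteq> K \<Longrightarrow> card N \<le> 3 \<Longrightarrow> coord E A N = coord E A' N"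
  shows "A = A'"
proof (rule forms_eqI[OF _ _ B])
  show AF: "A \<in> forms" "A' \<in> forms" using A by (auto simp: isotypic_zeros_def)
  fix N assume "N \<subseteq> K"
  then show "coord E A N = coord E A' N"
  proof (induction "card N" arbitrary: N rule: less_induct)
    case less
    show ?case
    proof (cases "card N \<le> 3")
      case True
      then show ?thesis using low less.prems by blast
    next
      case False
      have finN: "finite N" using less.prems finite_slots finite_subset by blast
      obtain Q where Q: "Q \<subseteq> N" "card Q = 4" using obtain_subset_with_card_n[of 4 N] False by auto
      then obtain i j k l where ijkl: "Q = {i, j, k, l}" "distinct [i, j, k, l]"
        by (auto simp: card_Suc_eq numeral_eq_Suc)
      define T where "T = N - Q"
      have T: "finite T" "T \<subseteq> K" "Q \<inter> T = {}" "Q \<union> T = N" using Q finN less.prems by (auto simp: T_def)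
      \<comment> \<open>In the slots of \<open>T\<close> both vectors become \<open>e + t f\<close>,
        so a coordinate at \<open>S \<subseteq> Q\<close> collects those at
        \<open>S \<union> R\<close> for all \<open>R \<subseteq> T\<close>.\<close>
      define y where "y = (\<lambda>t k b. if k \<in> T then E k False + scale t (E k True) else E k b)"
      have slice: "coord (y t) F S = (\<Sum>R\<in>Pow T. t ^ card R * coord E F (S \<union> R))"
        if SQ: "S \<subseteq> Q" and F: "F \<in> forms" for S F t
      proof -
        have TS: "(k \<in> S) = False" if "k \<in> T" for k using that SQ T by blast
        let ?x = "\<lambda>k\<in>K. E k (k \<in> S)"
        have x: "?x \<in> Pi\<^sub>E K U" using basesD(1)[OF B] by auto
        have y: "E k True \<in> U k" if "k \<in> T" for k using basesD(1)[OF B] that T by auto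
        have "coord (y t) F S = F (\<lambda>k. if k \<in> T then ?x k + scale t (E k True) else ?x k)"
          unfolding coord_def y_def using T by (intro arg_cong[of _ _ F]) (auto simp: fun_eq_iff TS)
        also have "\<dots> = (\<Sum>R\<in>Pow T. t ^ card R * F (\<lambda>k. if k \<in> R then E k True else ?x k))"
          by (rule multilinear_pencil_on[OF F vector_space_axioms subspace_planes T(1,2) x y])
        also have "\<dots> = (\<Sum>R\<in>Pow T. t ^ card R * coord E F (S \<union> R))"
          unfolding coord_def using T
          by (intro sum.cong refl arg_cong2[of _ _ _ _ "(*)"] arg_cong[of _ _ F]) (auto simp: fun_eq_iff)
        finally show ?thesis .
      qed
      \<comment> \<open>The extra factor \<open>t\<close> makes the chosen parameter nonzero too:
        the product is a polynomial in \<open>t\<close> whose linear coefficient is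
        \<open>coord E A {}\<close>.\<close>
      have "\<exists>t. t * coord (y t) A {} \<noteq> 0"
      proof (rule ccontr)
        assume "\<not> ?thesis"
        moreover have "(\<Sum>R\<in>Pow T. t ^ Suc (card R) * coord E A R) = t * coord (y t) A {}" for t
          using slice[of "{}" A t] AF by (simp add: sum_distrib_left mult.assoc)
        ultimately have "(\<Sum>R\<in>Pow T. t ^ Suc (card R) * coord E A R) = 0" for t by simp
        from sum_power_coeff_zero[OF _ this, of 1]
        have "(\<Sum>R\<in>{R \<in> Pow T. Suc (card R) = 1}. coord E A R) = 0" using T by simp
        moreover have "{R \<in> Pow T. Suc (card R) = 1} = {{}}" using T finite_subset[OF _ T(1)] by auto
        ultimately show False using nz by simp
      qed
      then obtain t where t: "t \<noteq> 0" "coord (y t) A {} \<noteq> 0" by auto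
      have sub: "coord E A (S \<union> R) = coord E A' (S \<union> R)" if "S \<subseteq> Q" "R \<subseteq> T" "S \<union> R \<noteq> N" for S R
      proof (rule less.hyps)
        have "S \<union> R \<subset> N" using that T by blast
        then show "card (S \<union> R) < card N" using finN by (rule psubset_card_mono[rotated])
        show "S \<union> R \<subseteq> K" using \<open>S \<union> R \<subset> N\<close> less.prems by blast
      qed
      have eq: "coord (y t) A' S = coord (y t) A S" if S: "S \<subseteq> Q" "S \<noteq> Q" for S
      proof -
        have "S \<union> R \<noteq> N" if "R \<subseteq> T" for R using S that T by blast
        then show ?thesis using S AF sub by (simp add: slice)
      qed
      \<comment> \<open>Among the sets \<open>Q \<union> R\<close> only \<open>N\<close> itself
        escapes the induction hypothesis, so the difference reduces to the term
        \<open>R = T\<close>.\<close>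
      have top: "coord (y t) A Q - coord (y t) A' Q = t ^ card T * (coord E A N - coord E A' N)"
      proof -
        have "coord (y t) A Q - coord (y t) A' Q =
            (\<Sum>R\<in>Pow T. t ^ card R * (coord E A (Q \<union> R) - coord E A' (Q \<union> R)))"
          using AF by (simp add: slice sum_subtractf right_diff_distrib)
        also have "\<dots> = (\<Sum>R\<in>{T}. t ^ card R * (coord E A (Q \<union> R) - coord E A' (Q \<union> R)))"
        proof (rule sum.mono_neutral_right)
          show "\<forall>R\<in>Pow T - {T}. t ^ card R * (coord E A (Q \<union> R) - coord E A' (Q \<union> R)) = 0"
          proof
            fix R assume R: "R \<in> Pow T - {T}"
            then have "Q \<union> R \<noteq> N" using T by blast
            then show "t ^ card R * (coord E A (Q \<union> R) - coord E A' (Q \<union> R)) = 0"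
              using R sub[of Q R] by simp
          qed
        qed (use T in auto)
        finally show ?thesis using T by simp
      qed
      have QK: "{i, j, k, l} \<subseteq> K" using Q less.prems ijkl by auto
      have yU: "y t k b \<in> U k" if "k \<in> K" for k b
        using basesD(1)[OF B that] subspace_planes[OF that] by (simp add: y_def subspace_add subspace_scale)
      note cub = cubic_equation[where y = "y t", OF B _ QK ijkl(2) yU]
      have eqs: "coord (y t) A' {} = coord (y t) A {}" "coord (y t) A' {i} = coord (y t) A {i}"
        "coord (y t) A' {j} = coord (y t) A {j}" "coord (y t) A' {k} = coord (y t) A {k}"
        "coord (y t) A' {l} = coord (y t) A {l}" "coord (y t) A' {i, j} = coord (y t) A {i, j}"
        "coord (y t) A' {i, k} = coord (y t) A {i, k}" "coord (y t) A' {i, l} = coord (y t) A {i, l}"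
        "coord (y t) A' {j, k} = coord (y t) A {j, k}" "coord (y t) A' {j, l} = coord (y t) A {j, l}"
        "coord (y t) A' {k, l} = coord (y t) A {k, l}" "coord (y t) A' {i, j, k} = coord (y t) A {i, j, k}"
        "coord (y t) A' {i, j, l} = coord (y t) A {i, j, l}" "coord (y t) A' {i, k, l} = coord (y t) A {i, k, l}"
        "coord (y t) A' {j, k, l} = coord (y t) A {j, k, l}"
        by (rule eq; use ijkl in auto)+
      have "coord (y t) A {} * coord (y t) A {} * (coord (y t) A {i, j, k, l} - coord (y t) A' {i, j, k, l}) = 0"
        using cub[OF A(1)] cub[OF A(2)] unfolding eqs by algebra
      then have "coord (y t) A Q = coord (y t) A' Q" using t ijkl by simp
      then show ?thesis using top t by simp
    qed
  qed
qed

lemma truncation: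
  assumes B: "bases E D"
  obtains A' where "A' \<in> tangent_forms E"
    "\<And>N. N \<subseteq> K \<Longrightarrow> coord E A' N = (if card N \<le> 1 then coord E A N else 0)"
proof -
  obtain A' where "A' \<in> forms" "\<And>N. N \<subseteq> K \<Longrightarrow> coord E A' N = (if card N \<le> 1 then coord E A N else 0)"
    using form_with_coord[OF B, of "\<lambda>N. if card N \<le> 1 then coord E A N else 0"] by blast
  then show thesis using that by (auto simp: tangent_forms_def)
qed

lemma normalized_bases:
  assumes dim: "\<And>k. k \<in> K \<Longrightarrow> dim (U k) = 2"
    and A: "A \<in> forms" and x: "x \<in> Pi\<^sub>E K U" "A x = 1"
  obtains E D where "bases E D" "coord E A {} = 1" "\<And>k. k \<in> K \<Longrightarrow> coord E A {k} = 0"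
proof -
  have x0: "x k \<noteq> 0" if k: "k \<in> K" for k
  proof
    assume "x k = 0"
    then have "x = x(k := scale 0 (x k))" by (auto simp: fun_eq_iff)
    then have "A x = A (x(k := scale 0 (x k)))" by simp
    also have "\<dots> = 0"
      using linear_on_scale[OF multilinear_forms_linear[OF A x(1) k], of "x k" 0] x k by (auto simp: PiE_iff)
    finally show False using x by simp
  qed
  have "\<forall>k\<in>K. \<exists>z. dual_bases scale (U k) (fst z) (snd z) \<and> fst z False = x k"
  proof
    fix k assume k: "k \<in> K"
    have "x k \<in> U k" using x k by auto
    then obtain E D where "dual_bases scale (U k) E D" "E False = x k"
      using dual_bases_exist[OF vector_space_axioms subspace_planes[OF k] dim[OF k] _ x0[OF k]] by blast
    then show "\<exists>z. dual_bases scale (U k) (fst z) (snd z) \<and> fst z False = x k"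
      by (intro exI[of _ "(E, D)"]) simp
  qed
  from bchoice[OF this] obtain z where
    z: "\<forall>k\<in>K. dual_bases scale (U k) (fst (z k)) (snd (z k)) \<and> fst (z k) False = x k" ..
  define E D where "E = (\<lambda>k. fst (z k))" and "D = (\<lambda>k. snd (z k))"
  have B: "bases E D" and Ex: "\<And>k. k \<in> K \<Longrightarrow> E k False = x k"
    using z by (auto simp: bases_def E_def D_def)
  \<comment> \<open>As the coordinate at the empty set is 1, a shear by \<open>c k\<close> adds
    \<open>c k\<close> to the coordinate at \<open>{k}\<close>.\<close>
  define c where "c = (\<lambda>k. - coord E A {k})"
  define E' where "E' = (\<lambda>k. (E k)(True := E k True + scale (c k) (E k False)))"
  define D' where "D' = (\<lambda>k. (D k)(False := D k False - fscale (c k) (D k True)))"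
  have B': "bases E' D'"
    using B dual_bases_shear[OF _ vector_space_axioms subspace_planes] by (simp add: bases_def E'_def D'_def)
  have "(\<lambda>k\<in>K. E k (k \<in> {})) = x" using Ex x(1) by (auto simp: fun_eq_iff PiE_iff extensional_def)
  then have 0: "coord E A {} = 1" using x by (simp add: coord_def)
  have 1: "coord E' A {} = 1" unfolding E'_def using coord_shear[OF A B, of "{}" c] 0 by simp
  have "coord E' A {k} = 0" if "k \<in> K" for k
    unfolding E'_def using coord_shear[OF A B, of "{k}" c] that 0 by (simp add: sum_Pow_insert c_def)
  then show thesis using that B' 1 by blast
qed

text \<open>In each case the form is cut down, in the new bases, to its coordinates at sets of at
  most one element. The result is tangent, hence itself a common zero, and its coordinates agree
  with those of \<open>A\<close> up to three-element sets; since the cubics determine the rest, the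
  two forms are equal.\<close>

lemma isotypic_zeros_tangent:
  assumes dim: "\<And>k. k \<in> K \<Longrightarrow> dim (U k) = 2" and ne: "K \<noteq> {}"
    and A: "A \<in> isotypic_zeros" and x: "x \<in> Pi\<^sub>E K U" "A x = 1"
  obtains E D where "bases E D" "A \<in> tangent_forms E"
proof -
  have AF: "A \<in> forms" using A by (simp add: isotypic_zeros_def)
  obtain E D where B: "bases E D" and norm: "coord E A {} = 1" "\<And>k. k \<in> K \<Longrightarrow> coord E A {k} = 0"
    using normalized_bases[OF dim AF x] by blast
  let ?a = "coord E A"
  define s where "s = (\<lambda>i j. ?a {i, j})"
  define t where "t = (\<lambda>i j k. ?a {i, j, k})"
  have sym: "s i j = s j i" "t i j k = t j i k" "t i j k = t i k j" for i j k
    by (simp_all add: s_def t_def insert_commute)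
  have four: "?a {i, j, k, l} = - 3 * s i j * s k l" if "{i, j, k, l} \<subseteq> K" "distinct [i, j, k, l]" for i j k l
    using cubic_equation[where y = E, OF B A that basesD(1)[OF B]] norm that
    by (simp add: s_def eq_neg_iff_add_eq_0)
  have pair: "s i j * s k l = s i k * s j l" if "{i, j, k, l} \<subseteq> K" "distinct [i, j, k, l]" for i j k l
    using four[OF that] four[of i k j l] that by (auto simp: insert_commute)
  have square: "t i j k ^ 2 = - 4 * s i j * s i k * s j k" if "{i, j, k} \<subseteq> K" "distinct [i, j, k]" for i j k
    using quartic_equation[where y = E, OF B A that basesD(1)[OF B]] norm that
    by (simp add: s_def t_def eq_neg_iff_add_eq_0)
  have three: "2 * s i j * t i k l - s i k * t i j l - s i l * t i j k = 0"
    if ijkl: "{i, j, k, l} \<subseteq> K" "distinct [i, j, k, l]" for i j k l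
  proof -
    \<comment> \<open>The base point is moved to \<open>e + f\<close> in slot \<open>i\<close>,
      which adds the coordinate at \<open>insert i S\<close> to the one at \<open>S\<close>; the
      cubic there relates coordinates at pairs and triples.\<close>
    define y where "y = E(i := (E i)(False := E i False + E i True))"
    have i: "i \<in> K" using ijkl by simp
    have yU: "y k b \<in> U k" if "k \<in> K" for k b
      using basesD(1)[OF B that] subspace_planes[OF that] by (auto simp: y_def subspace_add)
    have y1: "coord y A S = ?a S" if "i \<in> S" for S
      unfolding coord_def using that by (intro arg_cong[of _ _ A]) (auto simp: y_def fun_eq_iff)
    have y2: "coord y A S = ?a S + ?a (insert i S)" if "i \<notin> S" for S
    proof -
      let ?x = "\<lambda>k\<in>K. E k (k \<in> S)"
      have X: "?x \<in> Pi\<^sub>E K U" using basesD(1)[OF B] by auto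
      have "coord y A S = A (?x(i := E i False + E i True))"
        unfolding coord_def using that i by (intro arg_cong[of _ _ A]) (auto simp: y_def fun_eq_iff)
      also have "\<dots> = A (?x(i := E i False)) + A (?x(i := E i True))"
        using linear_on_add[OF multilinear_forms_linear[OF AF X i]] basesD(1)[OF B i] by simp
      also have "?x(i := E i False) = ?x" using that i by (auto simp: fun_eq_iff)
      also have "?x(i := E i True) = (\<lambda>k\<in>K. E k (k \<in> insert i S))" using i by (auto simp: fun_eq_iff)
      finally show ?thesis by (simp only: coord_def)
    qed
    have "j \<noteq> i" "k \<noteq> i" "l \<noteq> i" "i \<noteq> j" "i \<noteq> k" "i \<noteq> l" using ijkl by auto
    then have "coord y A {} = 1" "coord y A {i} = 0" "coord y A {j} = s i j" "coord y A {k} = s i k"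
      "coord y A {l} = s i l" "coord y A {i, j} = s i j" "coord y A {i, k} = s i k" "coord y A {i, l} = s i l"
      "coord y A {k, l} = s k l + t i k l" "coord y A {i, j, k} = t i j k" "coord y A {i, j, l} = t i j l"
      "coord y A {i, k, l} = t i k l" "coord y A {i, j, k, l} = ?a {i, j, k, l}"
      using norm ijkl by (simp_all add: y1 y2 s_def t_def insert_commute)
    then have "?a {i, j, k, l} - (s i j * t i k l + s i k * t i j l + s i l * t i j k) +
        s i j * s i k * s i l + s i j * s i l * s i k - 2 * s i k * s i l * s i j + 3 * s i j * (s k l + t i k l) = 0"
      using cubic_equation[where y = y, OF B A ijkl yU] by simp
    then show ?thesis unfolding four[OF ijkl] by algebra
  qed
  have sign: "s i j * t i k l = s i k * t i j l" if "{i, j, k, l} \<subseteq> K" "distinct [i, j, k, l]" for i j k l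
  proof -
    \<comment> \<open>This is the previous relation with \<open>j\<close> and \<open>k\<close>
      exchanged; the difference of the two is three times the claim.\<close>
    have "2 * s i k * t i j l - s i j * t i k l - s i l * t i k j = 0" using that by (intro three) auto
    then have "3 * (s i j * t i k l - s i k * t i j l) = 0" using three[OF that] sym(3)[of i k j] by algebra
    then show ?thesis by simp
  qed
  show thesis
  proof (cases "\<exists>p q r. {p, q, r} \<subseteq> K \<and> distinct [p, q, r] \<and> s p q \<noteq> 0 \<and> s p r \<noteq> 0 \<and> s q r \<noteq> 0")
    case True
    then obtain p q r where pqr: "{p, q, r} \<subseteq> K" "distinct [p, q, r]" "s p q \<noteq> 0" "s p r \<noteq> 0" "s q r \<noteq> 0"
      by blast
    have "\<exists>u. (\<forall>i j. {i, j} \<subseteq> K \<longrightarrow> i \<noteq> j \<longrightarrow> s i j = - u i * u j) \<and>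
        (\<forall>i j k. {i, j, k} \<subseteq> K \<longrightarrow> distinct [i, j, k] \<longrightarrow> t i j k = 2 * u i * u j * u k)"
    proof (rule off_diagonal_rank_one[where s = s and t = t and K = K and p = p and q = q and r = r,
          OF sym pair sign square pqr])
      fix u assume 1: "\<And>i j. {i, j} \<subseteq> K \<Longrightarrow> i \<noteq> j \<Longrightarrow> s i j = - u i * u j"
        and 2: "\<And>i j k. {i, j, k} \<subseteq> K \<Longrightarrow> distinct [i, j, k] \<Longrightarrow> t i j k = 2 * u i * u j * u k"
      show ?thesis
      proof (intro exI[of _ u] conjI allI impI)
        show "s i j = - u i * u j" if "{i, j} \<subseteq> K" "i \<noteq> j" for i j by (rule 1[OF that])
        show "t i j k = 2 * u i * u j * u k" if "{i, j, k} \<subseteq> K" "distinct [i, j, k]" for i j k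
          by (rule 2[OF that])
      qed
    qed
    then obtain u where su: "\<And>i j. {i, j} \<subseteq> K \<Longrightarrow> i \<noteq> j \<Longrightarrow> s i j = - u i * u j"
      and tu: "\<And>i j k. {i, j, k} \<subseteq> K \<Longrightarrow> distinct [i, j, k] \<Longrightarrow> t i j k = 2 * u i * u j * u k"
      by (elim exE conjE) metis
    define E' where "E' = (\<lambda>k. (E k)(True := E k True + scale (u k) (E k False)))"
    define D' where "D' = (\<lambda>k. (D k)(False := D k False - fscale (u k) (D k True)))"
    have B': "bases E' D'"
      using B dual_bases_shear[OF _ vector_space_axioms subspace_planes] by (simp add: bases_def E'_def D'_def)
    note shear = coord_shear[OF AF B, of _ u, folded E'_def]
    have two: "coord E' A N = 0" if N: "N \<subseteq> K" "card N = 2" for N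
    proof -
      obtain i j where ij: "N = {i, j}" "i \<noteq> j" using N(2) by (auto simp: card_2_iff)
      then have K: "i \<in> K" "j \<in> K" using N by auto
      have "coord E' A N = u i * u j + s i j"
        using shear[OF N(1)] ij norm K by (simp add: sum_Pow_insert s_def insert_commute)
      then show ?thesis using su ij K by simp
    qed
    have three: "coord E' A N = 0" if N: "N \<subseteq> K" "card N = 3" for N
    proof -
      obtain i j k where ijk: "N = {i, j, k}" "i \<noteq> j" "i \<noteq> k" "j \<noteq> k" using N(2) by (auto simp: card_3_iff)
      then have K: "i \<in> K" "j \<in> K" "k \<in> K" using N by auto
      \<comment> \<open>After substituting for \<open>s\<close> and \<open>t\<close>, the multiples
        of \<open>u i * u j * u k\<close> add up to 1 - 3 + 2 = 0.\<close>
      have "coord E' A N = u i * u j * u k + u i * s j k + u j * s i k + u k * s i j + t i j k"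
        using shear[OF N(1)] ijk norm K by (simp add: sum_Pow_insert s_def t_def insert_commute algebra_simps)
      then show ?thesis using su[of i j] su[of i k] su[of j k] tu[of i j k] ijk K by simp
    qed
    obtain A' where A': "A' \<in> tangent_forms E'"
      "\<And>N. N \<subseteq> K \<Longrightarrow> coord E' A' N = (if card N \<le> 1 then coord E' A N else 0)"
      using truncation[OF B'] by blast
    have "A = A'"
    proof (rule isotypic_zeros_eqI[OF B' A tangent_forms_isotypic_zeros[OF B' A'(1)]])
      show "coord E' A {} \<noteq> 0" using shear[of "{}"] norm by simp
      fix N assume N: "N \<subseteq> K" "card N \<le> 3"
      then consider "card N \<le> 1" | "card N = 2" | "card N = 3" by linarith
      then show "coord E' A N = coord E' A' N" using two three A'(2) N by cases auto
    qed
    then show thesis using that B' A'(1) by blast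
  next
    case False
    then have triangle: "s i j = 0 \<or> s i k = 0 \<or> s j k = 0" if "{i, j, k} \<subseteq> K" "distinct [i, j, k]" for i j k
      using that by blast
    have "\<exists>c\<in>K. \<forall>i j. {i, j} \<subseteq> K - {c} \<longrightarrow> i \<noteq> j \<longrightarrow> s i j = 0"
    proof (rule triangle_free_star[where s = s and K = K, OF sym(1) pair triangle ne])
      fix c assume 1: "c \<in> K" and 2: "\<And>i j. {i, j} \<subseteq> K - {c} \<Longrightarrow> i \<noteq> j \<Longrightarrow> s i j = 0"
      show ?thesis
      proof (intro bexI[OF _ 1] allI impI)
        show "s i j = 0" if "{i, j} \<subseteq> K - {c}" "i \<noteq> j" for i j by (rule 2[OF that])
      qed
    qed
    then obtain c where c: "c \<in> K" "\<And>i j. {i, j} \<subseteq> K - {c} \<Longrightarrow> i \<noteq> j \<Longrightarrow> s i j = 0"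
      by (elim bexE) metis
    define E' where "E' = E(c := (\<lambda>b. E c (\<not> b)))"
    define D' where "D' = D(c := (\<lambda>b. D c (\<not> b)))"
    have B': "bases E' D'"
      using B c(1) dual_bases_swap[of scale "U c"] by (auto simp: bases_def E'_def D'_def)
    \<comment> \<open>Exchanging the two basis vectors at \<open>c\<close> toggles membership of
      \<open>c\<close> in the index set.\<close>
    define \<sigma> where "\<sigma> = (\<lambda>N. if c \<in> N then N - {c} else insert c N)"
    have swap: "coord E F N = coord E' F (\<sigma> N)" for F :: "('k \<Rightarrow> 'a) \<Rightarrow> complex" and N
      unfolding coord_def by (intro arg_cong[of _ _ F]) (auto simp: E'_def \<sigma>_def fun_eq_iff)
    obtain A' where A': "A' \<in> tangent_forms E'"
      "\<And>N. N \<subseteq> K \<Longrightarrow> coord E' A' N = (if card N \<le> 1 then coord E' A N else 0)"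
      using truncation[OF B'] by blast
    \<comment> \<open>The comparison is made in the old bases: in the new ones the coordinate at the
      empty set is the old one at \<open>{c}\<close>, which is zero.\<close>
    have "A = A'"
    proof (rule isotypic_zeros_eqI[OF B A tangent_forms_isotypic_zeros[OF B' A'(1)]])
      show "?a {} \<noteq> 0" using norm by simp
      fix N assume N: "N \<subseteq> K" "card N \<le> 3"
      have fin: "finite N" using N finite_slots finite_subset by blast
      have \<sigma>K: "\<sigma> N \<subseteq> K" using N c by (auto simp: \<sigma>_def)
      show "?a N = coord E A' N"
      proof (cases "card (\<sigma> N) \<le> 1")
        case True
        then show ?thesis unfolding swap using A'(2)[OF \<sigma>K] by simp
      next
        case False
        \<comment> \<open>Here \<open>N\<close> is a singleton, a pair avoiding the centre, or a
          triple; the coordinate at a triple vanishes because its square contains the product over a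
          triangle.\<close>
        have "?a N = 0"
        proof -
          have "N \<noteq> {}" using False by (auto simp: \<sigma>_def)
          then have "card N \<noteq> 0" using fin by simp
          then consider "card N = 1" | "card N = 2" | "card N = 3" using N(2) by linarith
          then show ?thesis
          proof cases
            case 1
            then show ?thesis using norm(2) N by (auto simp: card_1_singleton_iff)
          next
            case 2
            then obtain i j where ij: "N = {i, j}" "i \<noteq> j" by (auto simp: card_2_iff)
            have "c \<notin> N" using False 2 fin by (auto simp: \<sigma>_def)
            then show ?thesis using c(2)[of i j] ij N by (auto simp: s_def)
          next
            case 3
            then obtain i j k where ijk: "N = {i, j, k}" "i \<noteq> j" "i \<noteq> k" "j \<noteq> k" by (auto simp: card_3_iff)
            then have "t i j k ^ 2 = - 4 * s i j * s i k * s j k" using N by (intro square) auto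
            moreover have "s i j = 0 \<or> s i k = 0 \<or> s j k = 0" using triangle[of i j k] ijk N by auto
            ultimately show ?thesis using ijk by (auto simp: t_def)
          qed
        qed
        then show ?thesis unfolding swap[of A'] using A'(2)[OF \<sigma>K] False by simp
      qed
    qed
    then show thesis using that B' A'(1) by blast
  qed
qed

end

theorem theorem1p3:
  fixes scale :: "complex \<Rightarrow> 'v::ab_group_add \<Rightarrow> 'v"
    and V :: "nat \<Rightarrow> 'v set"
    and n :: nat
  assumes "vector_space scale"
    and "n \<ge> 1"
    and "\<And>i. i \<in> {1..n} \<Longrightarrow> module.subspace scale (V i)"
    and "\<And>i. i \<in> {1..n} \<Longrightarrow> vector_space.dim scale (V i) = 2"
  shows "tangential_variety fscale (multilinear_forms scale {1..n} V) (segre scale {1..n} V) =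
    zero_locus fscale (multilinear_forms scale {1..n} V)
      ((\<Union>\<pi>\<in>types_with {1..n} 4 [2, 1] [3, 0]. isotypic_component scale {1..n} V 3 \<pi>) \<union>
       (\<Union>\<pi>\<in>types_with {1..n} 3 [2, 2] [4, 0]. isotypic_component scale {1..n} V 4 \<pi>))"
    (is "?T = zero_locus fscale ?W ?F")
proof -
  interpret vs: vector_space scale by fact
  interpret planes scale "{1..n}" V
    by unfold_locales (use assms(3) in auto)
  have ne: "{1..n} \<noteq> {}" using assms(2) by simp
  show ?thesis
  proof (intro equalityI subsetI)
    fix P assume P: "P \<in> ?T"
    have "p A = 0" if "p \<in> ?F" "A \<in> P" for p A
    proof -
      obtain E D where "bases E D" "A \<in> tangent_forms E"
        using tangential_variety_segre_subset[OF assms(4) P \<open>A \<in> P\<close>] by blast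
      then have "A \<in> isotypic_zeros" by (rule tangent_forms_isotypic_zeros)
      then show ?thesis using that(1) unfolding isotypic_zeros_def by blast
    qed
    moreover have "P \<in> proj_space fscale ?W" using P by (simp add: tangential_variety_def)
    ultimately show "P \<in> zero_locus fscale ?W ?F" by (auto simp: zero_locus_def)
  next
    fix P assume P: "P \<in> zero_locus fscale ?W ?F"
    then obtain w where w: "P = fs.span {w}" "w \<in> ?W" "w \<noteq> 0"
      by (auto simp: zero_locus_def proj_space_def)
    obtain x where x: "w x \<noteq> 0" using w(3) by (auto simp: fun_eq_iff)
    then have xV: "x \<in> Pi\<^sub>E {1..n} V" using multilinear_forms_outside[OF w(2)] by blast
    \<comment> \<open>The multiple of \<open>w\<close> with value 1 at \<open>x\<close>; the entries
      of \<open>x\<close> will serve as first basis vectors.\<close>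
    define A where "A = fscale (1 / w x) w"
    have AP: "A \<in> P" unfolding w A_def by (intro fs.span_scale fs.span_base) simp
    have AW: "A \<in> ?W" unfolding A_def by (intro fs.subspace_scale subspace_multilinear_forms w(2))
    have Ax: "A x = 1" using x by (simp add: A_def)
    have Az: "A \<in> isotypic_zeros"
      unfolding isotypic_zeros_def using P AP AW by (auto simp: zero_locus_def)
    obtain E D where B: "bases E D" "A \<in> tangent_forms E"
      using isotypic_zeros_tangent[OF assms(4) ne Az xV Ax] by blast
    have "A \<noteq> 0" using Ax by auto
    then have "fs.span {A} \<in> ?T" by (rule tangent_forms_tangential_variety[OF ne B])
    moreover have "fs.span {A} = P"
    proof (rule equalityI)
      show "fs.span {A} \<subseteq> P" using AP unfolding w by (intro fs.span_minimal) auto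
      have "w = fscale (w x) A" using x by (simp add: A_def fun_eq_iff)
      then have "w \<in> fs.span {A}" by (metis fs.span_base fs.span_scale insertI1)
      then show "P \<subseteq> fs.span {A}" unfolding w by (intro fs.span_minimal) auto
    qed
    ultimately show "P \<in> ?T" by simp
  qed
qed

end
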